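(* Let $\Omega\subset\mathbb{R}^n$ be an open bounded domain with sufficiently smooth boundary. Let $f_0:W^{2,p}(\Omega)\cap W_0^{1,p}(\Omega)\to L^q(\Omega)$ be given by $f_0(u)=-|\Delta u|^{p-2}\Delta u$ and let $f_1:L^p(\Omega)\to L^q(\Omega)$ be given by $f_1(u)=|u|^{p-2}u$. Then the operator $f_0$ has a first eigenvalue relative to the operator $f_1$, which is defined by $$\widetilde\lambda_1(p)=\frac{1}{p-1}\inf\left\{\frac{\|\Delta u\|_p^p}{\big\||u|^{\frac{p-2}{2}}|\nabla u|\big\|_2^2}\ :\ u\in W^{2,p}\cap W_0^{1,p}\right\}=\frac{p}{2(p-1)}\inf\left\{\frac{\big\||\Delta u|^{\frac p2}\big\|_2}{\big\|\nabla\big(|u|^{\frac{p-2}{2}}|u|\big)\big\|_2}\ :\ u\in W^{2,p}\cap W_0^{1,p}\right\}$$ and satisfies the inequality $$\widetilde\lambda_1(p)\ge\frac{1}{p-1}\inf\left\{\frac{\|\Delta u\|_p^p}{\|u\|_p^{p-2}\|\nabla u\|_p^2}\ :\ u\in W^{2,p}\cap W_0^{1,p}\right\}.$$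
   Context: $\|\cdot\|_s$ is the norm of $L^s(\Omega)$, $q=p/(p-1)$, $W^{2,p}\cap W_0^{1,p}=W^{2,p}(\Omega)\cap W_0^{1,p}(\Omega)$; infima are over nonzero $u$. First eigenvalue: for an operator of the form $f\circ L$ ($L$ linear) and an operator $g$ with the same degree of homogeneity, the paper seeks the smallest $\lambda$ with $\langle f(Lu),Lu\rangle=\lambda\langle g(u),Lu\rangle$, i.e. $\lambda=\inf\langle f(Lu),Lu\rangle/\langle g(u),Lu\rangle$ over nonzero $u$; this number, independent of the elements of the domain, is called the first eigenvalue of $f\circ L$ relative to $g$. Here $L=-\Delta$ and $f(t)=g(t)=|t|^{p-2}t$, so that the problem is $-|\Delta u|^{p-2}\Delta u=\lambda|u|^{p-2}u$ in $\Omega$, $u|_{\partial\Omega}=0$, tested with $-\Delta u$.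
   Formalization: In the second formula both norms are squared and the factor is p²/(4(p-1)), since the printed equality fails (e.g. p=2, Ω=(0,1)); the final inequality is claimed only for p ≥ 2, since for 1<p<2 reverse Hölder makes it false. *)

theory Defs
  imports "HOL-Analysis.Analysis"
begin

section \<open>Classical differentiability, test functions, domains\<close>

definition pderiv_at :: "'n::finite \<Rightarrow> (real^'n \<Rightarrow> real) \<Rightarrow> real^'n \<Rightarrow> real" where
  "pderiv_at i f x = frechet_derivative f (at x) (axis i 1)"

definition grad :: "(real^'n::finite \<Rightarrow> real) \<Rightarrow> real^'n \<Rightarrow> real^'n" where
  "grad f x = (\<chi> i. pderiv_at i f x)"

primrec C_diff :: "nat \<Rightarrow> (real^'n::finite \<Rightarrow> real) \<Rightarrow> bool" where
  "C_diff 0 f \<longleftrightarrow> continuous_on UNIV f"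
| "C_diff (Suc k) f \<longleftrightarrow> (\<forall>x. f differentiable (at x)) \<and> (\<forall>i. C_diff k (pderiv_at i f))"

definition test_functions :: "(real^'n::finite) set \<Rightarrow> (real^'n \<Rightarrow> real) set" where
  "test_functions \<Omega> = {\<phi>. (\<forall>k. C_diff k \<phi>) \<and>
     compact (closure {x. \<phi> x \<noteq> 0}) \<and> closure {x. \<phi> x \<noteq> 0} \<subseteq> \<Omega>}"

text \<open>
  Near each boundary point the set lies strictly on one side of a \<open>C\<^sup>k\<close> graph over a hyperplane.
  Instead of choosing coordinates on the hyperplane, the graph function \<open>\<gamma>\<close> is defined on the
  whole space and required to be constant in the direction \<open>e\<close> orthogonal to the hyperplane.
\<close>
definition C_boundary :: "nat \<Rightarrow> (real^'n::finite) set \<Rightarrow> bool" where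
  "C_boundary k \<Omega> \<longleftrightarrow> (\<forall>x0\<in>frontier \<Omega>. \<exists>r>0. \<exists>e \<gamma>.
     norm e = 1 \<and> C_diff k \<gamma> \<and> (\<forall>x t. \<gamma> (x + t *\<^sub>R e) = \<gamma> x) \<and>
     \<Omega> \<inter> ball x0 r = {x \<in> ball x0 r. x \<bullet> e > \<gamma> x})"


section \<open>Lebesgue and Sobolev spaces\<close>

text \<open>
  Elements of the spaces are functions rather than equivalence classes; values outside \<open>\<Omega>\<close> are
  irrelevant, and the zero element is described by \<open>ae_zero\<close>.
\<close>
definition lp_space :: "real \<Rightarrow> 'a::euclidean_space set \<Rightarrow> ('a \<Rightarrow> 'b::real_normed_vector) set" where
  "lp_space s \<Omega> = {f \<in> borel_measurable (lebesgue_on \<Omega>).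
     integrable (lebesgue_on \<Omega>) (\<lambda>x. norm (f x) powr s)}"

definition lp_norm :: "real \<Rightarrow> 'a::euclidean_space set \<Rightarrow> ('a \<Rightarrow> 'b::real_normed_vector) \<Rightarrow> real" where
  "lp_norm s \<Omega> f = (integral\<^sup>L (lebesgue_on \<Omega>) (\<lambda>x. norm (f x) powr s)) powr (1 / s)"

definition ae_zero :: "'a::euclidean_space set \<Rightarrow> ('a \<Rightarrow> real) \<Rightarrow> bool" where
  "ae_zero \<Omega> u \<longleftrightarrow> (AE x in lebesgue_on \<Omega>. u x = 0)"

definition locally_integrable :: "'a::euclidean_space set \<Rightarrow> ('a \<Rightarrow> real) \<Rightarrow> bool" where
  "locally_integrable \<Omega> u \<longleftrightarrow> (\<forall>K. compact K \<and> K \<subseteq> \<Omega> \<longrightarrow> integrable (lebesgue_on K) u)"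

definition has_weak_deriv ::
    "(real^'n::finite) set \<Rightarrow> 'n \<Rightarrow> (real^'n \<Rightarrow> real) \<Rightarrow> (real^'n \<Rightarrow> real) \<Rightarrow> bool" where
  "has_weak_deriv \<Omega> i u g \<longleftrightarrow> locally_integrable \<Omega> u \<and> locally_integrable \<Omega> g \<and>
     (\<forall>\<phi>\<in>test_functions \<Omega>.
        integral\<^sup>L (lebesgue_on \<Omega>) (\<lambda>x. u x * pderiv_at i \<phi> x) =
        - integral\<^sup>L (lebesgue_on \<Omega>) (\<lambda>x. g x * \<phi> x))"

text \<open>
  The weak derivative is unique only up to null sets; the choice of a representative does not
  affect any of the integrals below.
\<close>
definition weak_deriv :: "(real^'n::finite) set \<Rightarrow> 'n \<Rightarrow> (real^'n \<Rightarrow> real) \<Rightarrow> real^'n \<Rightarrow> real" where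
  "weak_deriv \<Omega> i u = (SOME g. has_weak_deriv \<Omega> i u g)"

definition weak_grad :: "(real^'n::finite) set \<Rightarrow> (real^'n \<Rightarrow> real) \<Rightarrow> real^'n \<Rightarrow> real^'n" where
  "weak_grad \<Omega> u x = (\<chi> i. weak_deriv \<Omega> i u x)"

definition laplacian :: "(real^'n::finite) set \<Rightarrow> (real^'n \<Rightarrow> real) \<Rightarrow> real^'n \<Rightarrow> real" where
  "laplacian \<Omega> u x = (\<Sum>i\<in>UNIV. weak_deriv \<Omega> i (weak_deriv \<Omega> i u) x)"

definition neg_laplacian :: "(real^'n::finite) set \<Rightarrow> (real^'n \<Rightarrow> real) \<Rightarrow> real^'n \<Rightarrow> real" where
  "neg_laplacian \<Omega> u x = - laplacian \<Omega> u x"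

primrec sobolev :: "nat \<Rightarrow> real \<Rightarrow> (real^'n::finite) set \<Rightarrow> (real^'n \<Rightarrow> real) set" where
  "sobolev 0 s \<Omega> = lp_space s \<Omega>"
| "sobolev (Suc k) s \<Omega> =
     {u \<in> lp_space s \<Omega>. \<forall>i. \<exists>g. has_weak_deriv \<Omega> i u g \<and> g \<in> sobolev k s \<Omega>}"

text \<open>\<open>W\<^sub>0\<^sup>1\<^sup>,\<^sup>s\<close>: the closure of the test functions in the \<open>W\<^sup>1\<^sup>,\<^sup>s\<close> norm.\<close>
definition sobolev0 :: "real \<Rightarrow> (real^'n::finite) set \<Rightarrow> (real^'n \<Rightarrow> real) set" where
  "sobolev0 s \<Omega> = {u \<in> sobolev 1 s \<Omega>. \<forall>\<epsilon>>0. \<exists>\<phi>\<in>test_functions \<Omega>.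
     lp_norm s \<Omega> (\<lambda>x. \<phi> x - u x) < \<epsilon> \<and> lp_norm s \<Omega> (\<lambda>x. grad \<phi> x - weak_grad \<Omega> u x) < \<epsilon>}"

definition nonzero_part :: "'a::euclidean_space set \<Rightarrow> ('a \<Rightarrow> real) set \<Rightarrow> ('a \<Rightarrow> real) set" where
  "nonzero_part \<Omega> D = {u \<in> D. \<not> ae_zero \<Omega> u}"


section \<open>First eigenvalues\<close>

definition pairing :: "'a::euclidean_space set \<Rightarrow> ('a \<Rightarrow> real) \<Rightarrow> ('a \<Rightarrow> real) \<Rightarrow> real" where
  "pairing \<Omega> v w = integral\<^sup>L (lebesgue_on \<Omega>) (\<lambda>x. v x * w x)"

text \<open>
  First eigenvalue of an operator \<open>F = f \<circ> L\<close> relative to \<open>G\<close>, on the domain \<open>D\<close>: the infimum of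
  \<open>\<langle>F u, L u\<rangle> / \<langle>G u, L u\<rangle>\<close> over the nonzero elements of \<open>D\<close>.
  It exists if there are nonzero elements, all the quotients make sense, and they are bounded
  below. (A nonzero Bochner integral is in particular the integral of an integrable function.)
\<close>
definition first_eigenvalue :: "'a::euclidean_space set \<Rightarrow> ('a \<Rightarrow> real) set \<Rightarrow>
    (('a \<Rightarrow> real) \<Rightarrow> ('a \<Rightarrow> real)) \<Rightarrow> (('a \<Rightarrow> real) \<Rightarrow> ('a \<Rightarrow> real)) \<Rightarrow>
    (('a \<Rightarrow> real) \<Rightarrow> ('a \<Rightarrow> real)) \<Rightarrow> real" where
  "first_eigenvalue \<Omega> D L F G =
     (INF u\<in>nonzero_part \<Omega> D. pairing \<Omega> (F u) (L u) / pairing \<Omega> (G u) (L u))"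

definition has_first_eigenvalue :: "'a::euclidean_space set \<Rightarrow> ('a \<Rightarrow> real) set \<Rightarrow>
    (('a \<Rightarrow> real) \<Rightarrow> ('a \<Rightarrow> real)) \<Rightarrow> (('a \<Rightarrow> real) \<Rightarrow> ('a \<Rightarrow> real)) \<Rightarrow>
    (('a \<Rightarrow> real) \<Rightarrow> ('a \<Rightarrow> real)) \<Rightarrow> bool" where
  "has_first_eigenvalue \<Omega> D L F G \<longleftrightarrow>
     nonzero_part \<Omega> D \<noteq> {} \<and>
     (\<forall>u\<in>nonzero_part \<Omega> D. integrable (lebesgue_on \<Omega>) (\<lambda>x. F u x * L u x) \<and>
        pairing \<Omega> (G u) (L u) \<noteq> 0) \<and>
     bdd_below ((\<lambda>u. pairing \<Omega> (F u) (L u) / pairing \<Omega> (G u) (L u)) ` nonzero_part \<Omega> D)"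

definition f0 :: "real \<Rightarrow> (real^'n::finite) set \<Rightarrow> (real^'n \<Rightarrow> real) \<Rightarrow> real^'n \<Rightarrow> real" where
  "f0 p \<Omega> u x = - (\<bar>laplacian \<Omega> u x\<bar> powr (p - 2) * laplacian \<Omega> u x)"

definition f1 :: "real \<Rightarrow> ('a \<Rightarrow> real) \<Rightarrow> 'a \<Rightarrow> real" where
  "f1 p u x = \<bar>u x\<bar> powr (p - 2) * u x"

lemma f0_eq_comp: "f0 p \<Omega> = f1 p \<circ> neg_laplacian \<Omega>"
  by (simp add: fun_eq_iff f0_def f1_def neg_laplacian_def)

end

theory Submission
  imports Defs "HOL-Real_Asymp.Real_Asymp"
begin

text \<open>
  The heart of the matter is the identity
  \<open>(p - 1) \<integral> |u|\<^sup>p\<^sup>-\<^sup>2 |\<nabla>u|\<^sup>2 = - \<integral> |u|\<^sup>p\<^sup>-\<^sup>2 u \<Delta>u\<close>,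
  which turns the quotient defining the first eigenvalue into the two stated ones; the inequality is then
  Hoelder's. For \<open>p < 2\<close> neither the weight nor \<open>|\<nabla>u|\<^sup>2\<close> needs to be bounded or integrable a priori,
  so both factors are truncated: \<open>|t|\<^sup>p\<^sup>-\<^sup>2 t\<close> is replaced by a smooth bounded increasing function \<open>F\<close>
  that is flat at \<open>0\<close>, and \<open>w = \<partial>\<^sub>iu\<close> by \<open>M arctan (w / M)\<close>. Since \<open>u\<close> is a limit of test functions \<open>\<phi>\<close> and
  \<open>F \<circ> \<phi>\<close> is again a test function, \<open>F (u)\<close> may be integrated by parts against any bounded function with an
  integrable weak derivative, without regularity of the boundary. The truncations are removed with Fatou's lemma.
  Because \<open>F'\<close> vanishes at \<open>0\<close>, the values of \<open>\<nabla>u\<close> on the zero set of \<open>u\<close> never matter.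

  The chain rule for \<open>M arctan (w / M)\<close> is obtained without mollification: by duality with test functions, the
  difference quotients of \<open>w\<close> converge to its weak derivative locally in \<open>L\<^sup>1\<close>.
\<close>

section \<open>Smooth functions of one variable\<close>

text \<open>The truncations are removed one after the other: with F fixed, M tends to infinity, and
  only then does F approach the power. In both passes the left-hand integrand is nonnegative and at
  most a constant times its limit, so convergence of the right-hand sides yields both the
  integrability of the limit and the formula. A quotient also needs a nonzero denominator. A
  weighted integral equal to 0 only says that the gradient vanishes where u does not; testing an
  even truncation against a coordinate function shows that such a u in W_0^{1,p} is zero. Constants:
  p - 1 is the factor in the derivative of |t|^{p-2} t, and p^2/4 is the square of the factor p/2 in
  the derivative of |t|^{p/2}. The Hoelder step uses the weights (p-2)/p and 2/p; the first is
  nonnegative only for p \<ge> 2, and for smaller p the comparison reverses.\<close>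

primrec C_diff1 :: "nat \<Rightarrow> (real \<Rightarrow> real) \<Rightarrow> bool" where
  "C_diff1 0 f \<longleftrightarrow> continuous_on UNIV f"
| "C_diff1 (Suc k) f \<longleftrightarrow> (\<exists>f'. (\<forall>t. (f has_real_derivative f' t) (at t)) \<and> C_diff1 k f')"

definition smooth1 :: "(real \<Rightarrow> real) \<Rightarrow> bool" where
  "smooth1 f \<longleftrightarrow> (\<forall>k. C_diff1 k f)"

lemma C_diff1_SucI:
  "(\<And>t. (f has_real_derivative f' t) (at t)) \<Longrightarrow> C_diff1 k f' \<Longrightarrow> C_diff1 (Suc k) f"
  unfolding C_diff1.simps by blast

lemma deriv_imp_continuous_on_UNIV:
  "(\<And>t. (f has_real_derivative f' t) (at t)) \<Longrightarrow> continuous_on UNIV f"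
  by (meson DERIV_isCont continuous_at_imp_continuous_on)

lemma C_diff1_SucD: "C_diff1 (Suc k) f \<Longrightarrow> C_diff1 k f"
proof (induction k arbitrary: f)
  case 0
  then show ?case using deriv_imp_continuous_on_UNIV unfolding C_diff1.simps by blast
next
  case (Suc k)
  then obtain f' where "\<And>t. (f has_real_derivative f' t) (at t)" "C_diff1 (Suc k) f'"
    by (metis C_diff1.simps(2))
  with Suc.IH[of f'] show ?case by (intro C_diff1_SucI)
qed

lemma C_diff1_const: "C_diff1 k (\<lambda>t. c)"
proof (induction k arbitrary: c)
  case (Suc k)
  show ?case by (rule C_diff1_SucI[OF DERIV_const Suc])
qed simp

lemma C_diff1_add: "C_diff1 k f \<Longrightarrow> C_diff1 k g \<Longrightarrow> C_diff1 k (\<lambda>t. f t + g t)"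
proof (induction k arbitrary: f g)
  case 0 then show ?case by (simp add: continuous_on_add)
next
  case (Suc k)
  then obtain f' g' where "\<And>t. (f has_real_derivative f' t) (at t)" "C_diff1 k f'"
     "\<And>t. (g has_real_derivative g' t) (at t)" "C_diff1 k g'" by auto
  then show ?case by (intro C_diff1_SucI[where f' = "\<lambda>t. f' t + g' t"] DERIV_add Suc.IH)
qed

lemma C_diff1_mult: "C_diff1 k f \<Longrightarrow> C_diff1 k g \<Longrightarrow> C_diff1 k (\<lambda>t. f t * g t)"
proof (induction k arbitrary: f g)
  case 0 then show ?case by (simp add: continuous_on_mult)
next
  case (Suc k)
  then obtain f' g' where *: "\<forall>t. (f has_real_derivative f' t) (at t)" "C_diff1 k f'"
     "\<forall>t. (g has_real_derivative g' t) (at t)" "C_diff1 k g'" by auto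
  have "C_diff1 k (\<lambda>t. f' t * g t + f t * g' t)"
    by (rule C_diff1_add[OF Suc.IH[OF *(2) C_diff1_SucD[OF Suc.prems(2)]] Suc.IH[OF C_diff1_SucD[OF Suc.prems(1)] *(4)]])
  moreover have "((\<lambda>t. f t * g t) has_real_derivative f' t * g t + f t * g' t) (at t)" for t
    using DERIV_mult[of f "f' t" t UNIV g "g' t"] *(1,3) by (simp add: mult.commute)
  ultimately show ?case by (rule C_diff1_SucI[rotated])
qed

lemma C_diff1_compose: "C_diff1 k f \<Longrightarrow> C_diff1 k g \<Longrightarrow> C_diff1 k (\<lambda>t. f (g t))"
proof (induction k arbitrary: f g)
  case 0 then show ?case by (auto intro: continuous_on_compose2)
next
  case (Suc k)
  then obtain f' g' where *: "\<forall>t. (f has_real_derivative f' t) (at t)" "C_diff1 k f'"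
     "\<forall>t. (g has_real_derivative g' t) (at t)" "C_diff1 k g'" by auto
  have "C_diff1 k (\<lambda>t. f' (g t) * g' t)"
    by (rule C_diff1_mult[OF Suc.IH[OF *(2) C_diff1_SucD[OF Suc.prems(2)]] *(4)])
  moreover have "((\<lambda>t. f (g t)) has_real_derivative f' (g t) * g' t) (at t)" for t
    using DERIV_chain2[of f "f' (g t)" g t "g' t"] *(1,3) by blast
  ultimately show ?case by (rule C_diff1_SucI[rotated])
qed

lemma smooth1_deriv:
  assumes "smooth1 f" "\<And>t. (f has_real_derivative f' t) (at t)"
  shows "smooth1 f'"
  unfolding smooth1_def
proof
  fix k
  obtain g where "\<forall>t. (f has_real_derivative g t) (at t)" "C_diff1 k g"
    using assms(1) C_diff1.simps(2) unfolding smooth1_def by meson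
  moreover from this have "g = f'" using assms(2) DERIV_unique by blast
  ultimately show "C_diff1 k f'" by simp
qed

lemma smooth1_continuous: "smooth1 f \<Longrightarrow> continuous_on UNIV f"
  unfolding smooth1_def by (metis C_diff1.simps(1))

lemma smooth1_const: "smooth1 (\<lambda>t. c)" by (simp add: smooth1_def C_diff1_const)
lemma smooth1_add: "smooth1 f \<Longrightarrow> smooth1 g \<Longrightarrow> smooth1 (\<lambda>t. f t + g t)"
  by (simp add: smooth1_def C_diff1_add)
lemma smooth1_mult: "smooth1 f \<Longrightarrow> smooth1 g \<Longrightarrow> smooth1 (\<lambda>t. f t * g t)"
  by (simp add: smooth1_def C_diff1_mult)
lemma smooth1_compose: "smooth1 f \<Longrightarrow> smooth1 g \<Longrightarrow> smooth1 (\<lambda>t. f (g t))"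
  by (simp add: smooth1_def C_diff1_compose)

lemma smooth1_ident: "smooth1 (\<lambda>t. t)"
  unfolding smooth1_def
proof
  fix k show "C_diff1 k (\<lambda>t. t)"
  proof (cases k)
    case (Suc n)
    show ?thesis unfolding Suc by (rule C_diff1_SucI[OF DERIV_ident C_diff1_const])
  qed simp
qed

lemma smooth1_exp: "smooth1 exp"
  unfolding smooth1_def
proof
  fix k show "C_diff1 k exp"
  proof (induction k)
    case (Suc n)
    show ?case by (rule C_diff1_SucI[OF DERIV_exp Suc])
  qed (simp add: continuous_on_exp)
qed

lemma one_plus_square_pos: "1 + (x::real)\<^sup>2 > 0"
  by (rule add_pos_nonneg) auto

lemma arctan_deriv: "(arctan has_real_derivative 1 / (1 + t\<^sup>2)) (at t)"
  using DERIV_arctan[of t] by (simp add: inverse_eq_divide)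

text \<open>With r = 1 / (1 + t^2), the derivative r' = -2 t r^2 is again a product built from t and
  r, so the induction for r needs only closure under products.\<close>

lemma smooth1_arctan: "smooth1 arctan"
proof -
  let ?r = "\<lambda>t::real. 1 / (1 + t\<^sup>2)"
  have d: "(?r has_real_derivative (- 2 * t * (?r t * ?r t))) (at t)" for t
  proof -
    have ne: "1 + t\<^sup>2 \<noteq> 0" using one_plus_square_pos[of t] by linarith
    show ?thesis
      by (rule derivative_eq_intros refl ne | simp add: field_simps power2_eq_square)+
  qed
  have "C_diff1 k ?r" for k
  proof (induction k)
    case 0
    have "1 + t\<^sup>2 \<noteq> 0" for t :: real using one_plus_square_pos[of t] by linarith
    then show ?case by (simp add: continuous_on_divide continuous_on_add continuous_on_power)
  next
    case (Suc k)
    have "C_diff1 k (\<lambda>t. (- 2 * t) * (?r t * ?r t))"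
      using smooth1_ident by (intro C_diff1_mult Suc C_diff1_const) (auto simp: smooth1_def)
    with d show ?case by (rule C_diff1_SucI)
  qed
  then have "C_diff1 (Suc k) arctan" for k
    by (rule C_diff1_SucI[OF arctan_deriv])
  then show ?thesis unfolding smooth1_def using C_diff1_SucD by blast
qed

section \<open>Flat functions\<close>

text \<open>
  The parameters \<open>\<alpha>\<close>, \<open>\<beta>\<close> cover the one-sided bump, the even and the odd powers at once, which makes the
  family closed under differentiation. At \<open>t = 0\<close> the conventions \<open>0 powr a = 0\<close> and \<open>c / 0 = 0\<close> give the
  limit value \<open>0\<close>, also for \<open>a \<le> 0\<close>.
\<close>
definition flat :: "real \<Rightarrow> real \<Rightarrow> real \<Rightarrow> real \<Rightarrow> real \<Rightarrow> real" where
  "flat \<alpha> \<beta> a c t = (if t > 0 then \<alpha> else \<beta>) * \<bar>t\<bar> powr a * exp (- c / t\<^sup>2)"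

lemma flat_0 [simp]: "flat \<alpha> \<beta> a c 0 = 0" by (simp add: flat_def)

lemma exp_inv_square_deriv:
  fixes t :: real assumes "t \<noteq> 0"
  shows "((\<lambda>s. exp (- c / s\<^sup>2)) has_real_derivative exp (- c / t\<^sup>2) * (2 * c / t ^ 3)) (at t)"
proof -
  have "((\<lambda>s. - c / s\<^sup>2) has_real_derivative 2 * c / t ^ 3) (at t)"
    by (rule derivative_eq_intros refl | use assms in \<open>simp add: field_simps power2_eq_square power3_eq_cube\<close>)+
  from DERIV_chain2[OF DERIV_exp this] show ?thesis .
qed

text \<open>The power rule lowers a by 1, and the exponential contributes the factor 2 c / t^3,
  which lowers it by 3. On the negative axis both carry the sign of t, which is why \<beta> becomes
  -\<beta>; differentiation stays within the family.\<close>

lemma flat_deriv_nz: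
  assumes "t \<noteq> 0"
  shows "(flat \<alpha> \<beta> a c has_real_derivative
     a * flat \<alpha> (-\<beta>) (a - 1) c t + 2 * c * flat \<alpha> (-\<beta>) (a - 3) c t) (at t)"
proof -
  consider "t > 0" | "t < 0" using assms by linarith
  then show ?thesis
  proof cases
    case 1
    have e: "eventually (\<lambda>s. flat \<alpha> \<beta> a c s = \<alpha> * s powr a * exp (- c / s\<^sup>2)) (nhds t)"
      using eventually_nhds_in_open[of "{0<..}" t] 1
      by (auto elim!: eventually_mono simp: flat_def)
    have p: "t powr (a - 3) = t powr a / t ^ 3"
      using 1 by (simp add: powr_diff powr_numeral)
    have "((\<lambda>s. \<alpha> * s powr a * exp (- c / s\<^sup>2)) has_real_derivative
        (\<alpha> * (a * t powr (a - 1))) * exp (- c / t\<^sup>2) +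
        (exp (- c / t\<^sup>2) * (2 * c / t ^ 3)) * (\<alpha> * t powr a)) (at t)"
      by (intro DERIV_mult DERIV_cmult has_real_derivative_powr exp_inv_square_deriv 1 assms)
    also have "(\<alpha> * (a * t powr (a - 1))) * exp (- c / t\<^sup>2) +
        (exp (- c / t\<^sup>2) * (2 * c / t ^ 3)) * (\<alpha> * t powr a) =
        a * flat \<alpha> (-\<beta>) (a - 1) c t + 2 * c * flat \<alpha> (-\<beta>) (a - 3) c t"
      using 1 by (simp add: flat_def p)
    finally show ?thesis using DERIV_cong_ev[OF refl e refl] by simp
  next
    case 2
    have e: "eventually (\<lambda>s. flat \<alpha> \<beta> a c s = \<beta> * (- s) powr a * exp (- c / s\<^sup>2)) (nhds t)"
      using eventually_nhds_in_open[of "{..<0}" t] 2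
      by (auto elim!: eventually_mono simp: flat_def)
    have p: "(-t) powr (a - 3) = - ((-t) powr a / t ^ 3)"
      using 2 by (simp add: powr_diff powr_numeral)
    have d: "((\<lambda>s. (-s) powr a) has_real_derivative a * (-t) powr (a - 1) * (-1)) (at t)"
      by (rule DERIV_chain2[OF has_real_derivative_powr]) (use 2 in \<open>auto intro!: derivative_eq_intros\<close>)
    have "((\<lambda>s. \<beta> * (-s) powr a * exp (- c / s\<^sup>2)) has_real_derivative
        (\<beta> * (a * (-t) powr (a - 1) * (-1))) * exp (- c / t\<^sup>2) +
        (exp (- c / t\<^sup>2) * (2 * c / t ^ 3)) * (\<beta> * (-t) powr a)) (at t)"
      by (intro DERIV_mult DERIV_cmult d exp_inv_square_deriv assms)
    also have "(\<beta> * (a * (-t) powr (a - 1) * (-1))) * exp (- c / t\<^sup>2) +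
        (exp (- c / t\<^sup>2) * (2 * c / t ^ 3)) * (\<beta> * (-t) powr a) =
        a * flat \<alpha> (-\<beta>) (a - 1) c t + 2 * c * flat \<alpha> (-\<beta>) (a - 3) c t"
      using 2 by (simp add: flat_def p)
    finally show ?thesis using DERIV_cong_ev[OF refl e refl] by simp
  qed
qed

lemma powr_exp_tendsto_0:
  fixes a c :: real assumes "c > 0"
  shows "((\<lambda>t. t powr a * exp (- c / t\<^sup>2)) \<longlongrightarrow> 0) (at_right 0)"
  using assms by real_asymp

lemma flat_tendsto_0:
  assumes "c > 0" shows "(flat \<alpha> \<beta> a c \<longlongrightarrow> 0) (at 0)"
proof -
  have r: "(flat \<alpha> \<beta> a c \<longlongrightarrow> 0) (at_right 0)" for \<alpha> \<beta>
  proof -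
    have "((\<lambda>t. \<alpha> * (t powr a * exp (- c / t\<^sup>2))) \<longlongrightarrow> 0) (at_right 0)"
      using tendsto_mult_right_zero[OF powr_exp_tendsto_0[OF assms]] .
    then show ?thesis
      by (rule Lim_transform_eventually)
         (auto simp: flat_def eventually_at_right_less intro!: eventually_mono[OF eventually_at_right_less])
  qed
  \<comment> \<open>Reflection exchanges \<alpha> and \<beta>, so the limit from the left is the
    limit from the right of the reflected function.\<close>
  have "eventually (\<lambda>t. flat \<beta> \<alpha> a c t = flat \<alpha> \<beta> a c (- t)) (at_right 0)"
    by (rule eventually_mono[OF eventually_at_right_less]) (auto simp: flat_def)
  from Lim_transform_eventually[OF r this]
  have "(flat \<alpha> \<beta> a c \<longlongrightarrow> 0) (at_left 0)" by (simp add: filterlim_at_left_to_right)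
  with r show ?thesis by (simp add: filterlim_at_split)
qed

lemma flat_deriv:
  assumes "c > 0"
  shows "(flat \<alpha> \<beta> a c has_real_derivative
     a * flat \<alpha> (-\<beta>) (a - 1) c t + 2 * c * flat \<alpha> (-\<beta>) (a - 3) c t) (at t)"
proof (cases "t = 0")
  case True
  have "((\<lambda>h. flat \<alpha> (-\<beta>) (a - 1) c h) \<longlongrightarrow> 0) (at 0)" by (rule flat_tendsto_0[OF assms])
  \<comment> \<open>Dividing by h takes away one power of the modulus and flips the sign on the
    negative axis, so the difference quotient at 0 is itself a member of the family.\<close>
  moreover have "eventually (\<lambda>h. flat \<alpha> (-\<beta>) (a - 1) c h = (flat \<alpha> \<beta> a c (0 + h) - flat \<alpha> \<beta> a c 0) / h) (at 0)"
    by (auto simp: eventually_at_filter flat_def powr_diff)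
  ultimately have "(flat \<alpha> \<beta> a c has_real_derivative 0) (at 0)"
    unfolding DERIV_def by (rule Lim_transform_eventually)
  with True show ?thesis by simp
qed (rule flat_deriv_nz)

text \<open>Each derivative changes a and \<beta>, so the induction runs over all values of both.
  Exponents may turn negative: the factor exp(-c/t^2) outweighs every power.\<close>

lemma smooth1_flat:
  assumes "c > 0" shows "smooth1 (flat \<alpha> \<beta> a c)"
proof -
  have "C_diff1 k (flat \<alpha> \<beta> a c)" for k
  proof (induction k arbitrary: a \<beta>)
    case 0
    show ?case using deriv_imp_continuous_on_UNIV[OF flat_deriv[OF assms]] by simp
  next
    case (Suc k)
    have "C_diff1 k (\<lambda>t. a * flat \<alpha> (-\<beta>) (a - 1) c t + 2 * c * flat \<alpha> (-\<beta>) (a - 3) c t)"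
      by (intro C_diff1_add C_diff1_mult C_diff1_const Suc)
    with flat_deriv[OF assms] show ?case by (rule C_diff1_SucI)
  qed
  then show ?thesis by (simp add: smooth1_def)
qed

section \<open>Smooth functions of several variables\<close>

lemma pderiv_at_eq: "(f has_derivative f') (at x) \<Longrightarrow> pderiv_at i f x = f' (axis i 1)"
  unfolding pderiv_at_def using frechet_derivative_at by metis

lemma differentiable_frechet: "f differentiable (at x) \<Longrightarrow> (f has_derivative frechet_derivative f (at x)) (at x)"
  by (simp add: frechet_derivative_works)

lemma C_diff_SucD: "C_diff (Suc k) f \<Longrightarrow> C_diff k f"
proof (induction k arbitrary: f)
  case 0
  then show ?case
    by (simp add: continuous_at_imp_continuous_on differentiable_imp_continuous_within)
next
  case (Suc k)
  then have "f differentiable (at x)" "C_diff k (pderiv_at i f)" for x i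
    using C_diff.simps(2) by blast+
  then show ?case by simp
qed

lemma C_diff_const: "C_diff k (\<lambda>x. c)"
proof (induction k arbitrary: c)
  case (Suc k)
  have "pderiv_at i (\<lambda>x. c) = (\<lambda>x. 0)" for i :: 'a
    by (rule ext) (simp add: pderiv_at_eq[OF has_derivative_const])
  then show ?case using Suc[of 0] by simp
qed simp

lemma pderiv_at_add:
  assumes "f differentiable (at x)" "g differentiable (at x)"
  shows "pderiv_at i (\<lambda>x. f x + g x) x = pderiv_at i f x + pderiv_at i g x"
  using pderiv_at_eq[OF has_derivative_add[OF assms[THEN differentiable_frechet]], of i]
  by (simp add: pderiv_at_def)

lemma pderiv_at_mult:
  assumes "f differentiable (at x)" "g differentiable (at x)"
  shows "pderiv_at i (\<lambda>x. f x * g x) x = f x * pderiv_at i g x + pderiv_at i f x * g x"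
  using pderiv_at_eq[OF has_derivative_mult[OF assms[THEN differentiable_frechet]], of i]
  by (simp add: pderiv_at_def)

lemma has_derivative_compose_real:
  assumes "f differentiable (at x)" "(h has_real_derivative h') (at (f x))"
  shows "((\<lambda>x. h (f x)) has_derivative (\<lambda>v. h' * frechet_derivative f (at x) v)) (at x)"
  using has_derivative_compose[OF differentiable_frechet[OF assms(1)], of h "\<lambda>v. h' * v"] assms(2)
  by (simp add: has_field_derivative_def)

lemma pderiv_at_compose:
  assumes "f differentiable (at x)" "(h has_real_derivative h') (at (f x))"
  shows "pderiv_at i (\<lambda>x. h (f x)) x = h' * pderiv_at i f x"
  using pderiv_at_eq[OF has_derivative_compose_real[OF assms], of i] by (simp add: pderiv_at_def)

lemma C_diff_add: "C_diff k f \<Longrightarrow> C_diff k g \<Longrightarrow> C_diff k (\<lambda>x. f x + g x)"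
proof (induction k arbitrary: f g)
  case 0 then show ?case by (simp add: continuous_on_add)
next
  case (Suc k)
  then have "pderiv_at i (\<lambda>x. f x + g x) = (\<lambda>x. pderiv_at i f x + pderiv_at i g x)" for i
    by (intro ext pderiv_at_add) auto
  then show ?case using Suc by (simp add: differentiable_add)
qed

lemma C_diff_mult: "C_diff k f \<Longrightarrow> C_diff k g \<Longrightarrow> C_diff k (\<lambda>x. f x * g x)"
proof (induction k arbitrary: f g)
  case 0 then show ?case by (simp add: continuous_on_mult)
next
  case (Suc k)
  then have "pderiv_at i (\<lambda>x. f x * g x) = (\<lambda>x. f x * pderiv_at i g x + pderiv_at i f x * g x)" for i
    by (intro ext pderiv_at_mult) auto
  moreover have "C_diff k (\<lambda>x. f x * pderiv_at i g x + pderiv_at i f x * g x)" for i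
    using Suc.prems by (intro C_diff_add Suc.IH[OF C_diff_SucD[OF Suc.prems(1)]] Suc.IH[OF _ C_diff_SucD[OF Suc.prems(2)]]) auto
  ultimately show ?case using Suc.prems by (simp add: differentiable_mult)
qed

lemma C_diff_compose: "C_diff1 k h \<Longrightarrow> C_diff k f \<Longrightarrow> C_diff k (\<lambda>x. h (f x))"
proof (induction k arbitrary: f h)
  case 0 then show ?case using continuous_on_compose2[of UNIV h UNIV f] by simp
next
  case (Suc k)
  then obtain h' where h: "\<And>t. (h has_real_derivative h' t) (at t)" "C_diff1 k h'" by auto
  have f: "f differentiable (at x)" for x using Suc.prems by simp
  have "pderiv_at i (\<lambda>x. h (f x)) = (\<lambda>x. h' (f x) * pderiv_at i f x)" for i
    by (intro ext pderiv_at_compose f h)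
  moreover have "C_diff k (\<lambda>x. h' (f x) * pderiv_at i f x)" for i
    using Suc.prems(2) by (intro C_diff_mult[OF Suc.IH[OF h(2) C_diff_SucD[OF Suc.prems(2)]]]) simp
  ultimately show ?case
    using differentiableI[OF has_derivative_compose_real[OF f h(1)]] by simp
qed

definition smooth :: "(real^'n::finite \<Rightarrow> real) \<Rightarrow> bool" where
  "smooth f \<longleftrightarrow> (\<forall>k. C_diff k f)"

lemma smooth_const: "smooth (\<lambda>x. c)" by (simp add: smooth_def C_diff_const)
lemma smooth_add: "smooth f \<Longrightarrow> smooth g \<Longrightarrow> smooth (\<lambda>x. f x + g x)"
  by (simp add: smooth_def C_diff_add)
lemma smooth_mult: "smooth f \<Longrightarrow> smooth g \<Longrightarrow> smooth (\<lambda>x. f x * g x)"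
  by (simp add: smooth_def C_diff_mult)
lemma smooth_compose: "smooth1 h \<Longrightarrow> smooth f \<Longrightarrow> smooth (\<lambda>x. h (f x))"
  unfolding smooth_def smooth1_def using C_diff_compose[of _ h f] by blast
lemma smooth_diff: "smooth f \<Longrightarrow> smooth g \<Longrightarrow> smooth (\<lambda>x. f x - g x)"
  using smooth_add[of f "\<lambda>x. - 1 * g x"] smooth_mult[OF smooth_const[of "-1"], of g] by simp
lemma smooth_sum:
  assumes "\<And>a. a \<in> A \<Longrightarrow> smooth (f a)" shows "smooth (\<lambda>x. \<Sum>a\<in>A. f a x)"
  using assms
proof (induction A rule: infinite_finite_induct)
  case (insert a A)
  then show ?case by (simp add: smooth_add)
qed (simp_all add: smooth_const)

lemma smooth_differentiable: assumes "smooth f" shows "f differentiable (at x)"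
proof -
  have "C_diff (Suc 0) f" using assms unfolding smooth_def by blast
  then show ?thesis by simp
qed

lemma smooth_pderiv: assumes "smooth f" shows "smooth (pderiv_at i f)"
  unfolding smooth_def
proof
  fix k
  have "C_diff (Suc k) f" using assms unfolding smooth_def by blast
  then show "C_diff k (pderiv_at i f)" by simp
qed

lemma smooth_continuous: assumes "smooth f" shows "continuous_on UNIV f"
proof -
  have "C_diff 0 f" using assms unfolding smooth_def by blast
  then show ?thesis by simp
qed

lemma has_derivative_coord: "((\<lambda>x::real^'n. x $ j) has_derivative (\<lambda>v. v $ j)) (at x)"
  by (rule bounded_linear.has_derivative[OF bounded_linear_vec_nth has_derivative_ident])

lemma pderiv_at_coord: "pderiv_at i (\<lambda>x. x $ j) x = (if i = j then 1 else 0)"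
  by (simp add: pderiv_at_eq[OF has_derivative_coord] axis_def)

lemma smooth_coord: "smooth (\<lambda>x. x $ j)"
  unfolding smooth_def
proof
  fix k show "C_diff k (\<lambda>x::real^'a. x $ j)"
  proof (cases k)
    case 0 then show ?thesis by (simp add: continuous_on_component)
  next
    case (Suc n)
    have "pderiv_at i (\<lambda>x. x $ j) = (\<lambda>x. if i = j then 1 else 0)" for i :: 'a
      by (rule ext) (rule pderiv_at_coord)
    then show ?thesis using Suc differentiableI[OF has_derivative_coord[of j]]
      by (simp add: C_diff_const)
  qed
qed

lemma pderiv_at_translate:
  fixes f :: "real^'n::finite \<Rightarrow> real"
  assumes "f differentiable (at (x + a))"
  shows "((\<lambda>x. f (x + a)) has_derivative frechet_derivative f (at (x + a))) (at x)"
    and "pderiv_at i (\<lambda>x. f (x + a)) x = pderiv_at i f (x + a)"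
proof -
  have "((\<lambda>x. x + a) has_derivative (\<lambda>v. v)) (at x)" by (auto intro!: derivative_eq_intros)
  from has_derivative_compose[OF this differentiable_frechet[OF assms]]
  show *: "((\<lambda>x. f (x + a)) has_derivative frechet_derivative f (at (x + a))) (at x)" .
  show "pderiv_at i (\<lambda>x. f (x + a)) x = pderiv_at i f (x + a)"
    using pderiv_at_eq[OF *] by (simp add: pderiv_at_def)
qed

lemma C_diff_translate: "C_diff k f \<Longrightarrow> C_diff k (\<lambda>x. f (x + a))"
proof (induction k arbitrary: f)
  case 0 then show ?case
    by (auto intro!: continuous_on_compose2[of UNIV f UNIV "\<lambda>x. x + a"] continuous_intros)
next
  case (Suc k)
  then have f: "f differentiable (at x)" for x by simp
  have "pderiv_at i (\<lambda>x. f (x + a)) = (\<lambda>x. pderiv_at i f (x + a))" for i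
    by (intro ext pderiv_at_translate f)
  then show ?case using Suc differentiableI[OF pderiv_at_translate(1)[OF f]] by simp
qed

lemma smooth_translate: "smooth f \<Longrightarrow> smooth (\<lambda>x. f (x + a))"
  using C_diff_translate[of _ f a] unfolding smooth_def by blast

lemma has_real_derivative_line:
  assumes "f differentiable (at (x + t *\<^sub>R axis i 1))"
  shows "((\<lambda>t. f (x + t *\<^sub>R axis i 1)) has_real_derivative pderiv_at i f (x + t *\<^sub>R axis i 1)) (at t)"
proof -
  have "((\<lambda>t. x + t *\<^sub>R axis i 1) has_derivative (\<lambda>s. s *\<^sub>R axis i 1)) (at t)"
    by (auto intro!: derivative_eq_intros)
  from has_derivative_compose[OF this differentiable_frechet[OF assms]]
  have "((\<lambda>t. f (x + t *\<^sub>R axis i 1)) has_derivative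
      (\<lambda>s. frechet_derivative f (at (x + t *\<^sub>R axis i 1)) (s *\<^sub>R axis i 1))) (at t)" .
  moreover have "frechet_derivative f (at (x + t *\<^sub>R axis i 1)) (s *\<^sub>R axis i 1) =
     pderiv_at i f (x + t *\<^sub>R axis i 1) * s" for s
    using linear_cmul[OF linear_frechet_derivative[OF assms]] by (simp add: pderiv_at_def)
  ultimately show ?thesis unfolding has_field_derivative_def by simp
qed

section \<open>Test functions\<close>

text \<open>Any compact K in \<Omega> outside which \<phi> vanishes will do, so that the exact
  support need not be computed.\<close>

lemma test_functionsI:
  assumes "smooth \<phi>" "compact K" "K \<subseteq> \<Omega>" "\<And>x. x \<notin> K \<Longrightarrow> \<phi> x = 0"
  shows "\<phi> \<in> test_functions \<Omega>"
proof -
  have "closure {x. \<phi> x \<noteq> 0} \<subseteq> K"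
    using assms by (intro closure_minimal compact_imp_closed) auto
  moreover from this have "compact (closure {x. \<phi> x \<noteq> 0})"
    using compact_Int_closed[OF assms(2) closed_closure, of "{x. \<phi> x \<noteq> 0}"] by (simp add: Int_absorb1)
  ultimately show ?thesis
    using assms(1,3) unfolding test_functions_def smooth_def by blast
qed

lemma test_functionsD:
  assumes "\<phi> \<in> test_functions \<Omega>"
  shows "smooth \<phi>" "compact (closure {x. \<phi> x \<noteq> 0})" "closure {x. \<phi> x \<noteq> 0} \<subseteq> \<Omega>"
    "x \<notin> closure {x. \<phi> x \<noteq> 0} \<Longrightarrow> \<phi> x = 0"
  using assms closure_subset[of "{x. \<phi> x \<noteq> 0}"] unfolding test_functions_def smooth_def by blast+

lemma test_functions_mono: "U \<subseteq> V \<Longrightarrow> test_functions U \<subseteq> test_functions V"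
  unfolding test_functions_def by blast

lemma pderiv_at_zero_outside:
  assumes "x \<notin> closure {x. \<phi> x \<noteq> 0}" shows "pderiv_at i \<phi> x = 0"
proof -
  have "(\<phi> has_derivative (\<lambda>v. 0)) (at x)"
  proof (rule has_derivative_transform_within_open)
    show "((\<lambda>x. 0 :: real) has_derivative (\<lambda>v. 0)) (at x)" by (rule has_derivative_const)
    show "open (- closure {x. \<phi> x \<noteq> 0})" by (rule open_Compl) (rule closed_closure)
    show "x \<in> - closure {x. \<phi> x \<noteq> 0}" using assms by simp
    show "0 = \<phi> y" if "y \<in> - closure {x. \<phi> x \<noteq> 0}" for y
      using that closure_subset[of "{x. \<phi> x \<noteq> 0}"] by force
  qed
  then show ?thesis by (rule pderiv_at_eq)
qed

lemma test_functions_pderiv: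
  assumes "\<phi> \<in> test_functions \<Omega>" shows "pderiv_at i \<phi> \<in> test_functions \<Omega>"
  by (rule test_functionsI[OF smooth_pderiv[OF test_functionsD(1)[OF assms]] test_functionsD(2,3)[OF assms]])
     (rule pderiv_at_zero_outside)

lemma test_functions_compose:
  assumes "\<phi> \<in> test_functions \<Omega>" "smooth1 F" "F 0 = 0"
  shows "(\<lambda>x. F (\<phi> x)) \<in> test_functions \<Omega>"
  by (rule test_functionsI[OF smooth_compose[OF assms(2) test_functionsD(1)[OF assms(1)]]
        test_functionsD(2,3)[OF assms(1)]])
     (drule test_functionsD(4)[OF assms(1)], simp only: assms(3))

lemma test_functions_mult:
  assumes "\<phi> \<in> test_functions \<Omega>" "smooth f"
  shows "(\<lambda>x. f x * \<phi> x) \<in> test_functions \<Omega>"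
  by (rule test_functionsI[OF smooth_mult[OF assms(2) test_functionsD(1)[OF assms(1)]]
        test_functionsD(2,3)[OF assms(1)]])
     (drule test_functionsD(4)[OF assms(1)], simp only: mult_zero_right)

lemma test_functions_diff:
  assumes "\<phi> \<in> test_functions \<Omega>" "\<psi> \<in> test_functions \<Omega>"
  shows "(\<lambda>x. \<phi> x - \<psi> x) \<in> test_functions \<Omega>"
proof (rule test_functionsI[OF smooth_diff[OF assms[THEN test_functionsD(1)]]])
  show "compact (closure {x. \<phi> x \<noteq> 0} \<union> closure {x. \<psi> x \<noteq> 0})"
    by (rule compact_Un[OF assms[THEN test_functionsD(2)]])
  show "closure {x. \<phi> x \<noteq> 0} \<union> closure {x. \<psi> x \<noteq> 0} \<subseteq> \<Omega>"
    using assms[THEN test_functionsD(3)] by blast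
  show "\<phi> x - \<psi> x = 0" if "x \<notin> closure {x. \<phi> x \<noteq> 0} \<union> closure {x. \<psi> x \<noteq> 0}" for x
    using that test_functionsD(4)[OF assms(1), of x] test_functionsD(4)[OF assms(2), of x] by auto
qed

lemma test_functions_bounded:
  assumes "\<phi> \<in> test_functions \<Omega>" obtains B where "B > 0" "\<And>x. \<bar>\<phi> x\<bar> \<le> B"
proof -
  let ?K = "closure {x. \<phi> x \<noteq> 0}"
  have "compact (\<phi> ` ?K)"
    by (rule compact_continuous_image[OF continuous_on_subset[OF smooth_continuous[OF test_functionsD(1)[OF assms]]
          subset_UNIV] test_functionsD(2)[OF assms]])
  then obtain B where B: "B > 0" "\<And>x. x \<in> ?K \<Longrightarrow> \<bar>\<phi> x\<bar> \<le> B"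
    using compact_imp_bounded[of "\<phi> ` ?K"] unfolding bounded_pos by auto
  moreover have "\<bar>\<phi> x\<bar> \<le> B" for x
    using B test_functionsD(4)[OF assms, of x] by (cases "x \<in> ?K") auto
  ultimately show thesis using that by blast
qed

section \<open>Bump functions and smooth approximation of indicators\<close>

lemma bump_exists:
  fixes x :: "real^'n::finite" assumes "r > 0"
  obtains b where "smooth b" "\<And>y. b y \<ge> 0" "\<And>y. b y > 0 \<longleftrightarrow> y \<in> ball x r"
proof
  let ?s = "\<lambda>y::real^'n. \<Sum>i\<in>UNIV. (y $ i - x $ i) * (y $ i - x $ i)"
  \<comment> \<open>\<open>flat 1 0 0 1 s\<close> is exp(-1/s^2) for s > 0 and 0 otherwise. Its
    argument is r^2 - |y - x|^2, written as a polynomial in the coordinates so that smoothness is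
    immediate.\<close>
  let ?b = "\<lambda>y. flat 1 0 0 1 (r\<^sup>2 - ?s y)"
  show "smooth ?b"
    by (rule smooth_compose[OF smooth1_flat])
      (auto intro!: smooth_diff smooth_sum smooth_mult smooth_const smooth_coord)
  show "?b y \<ge> 0" for y by (simp add: flat_def)
  have "?s y = (dist x y)\<^sup>2" for y
    by (simp add: dist_norm norm_vec_def L2_set_def sum_nonneg power2_eq_square) 
       (intro sum.cong, auto simp: algebra_simps)
  moreover have "(dist x y)\<^sup>2 < r\<^sup>2 \<longleftrightarrow> dist x y < r" for y
    using assms power_less_imp_less_base[of "dist x y" 2 r] power_strict_mono[of "dist x y" r 2] by auto
  ultimately show "?b y > 0 \<longleftrightarrow> y \<in> ball x r" for y by (force simp: flat_def)
qed

text \<open>Finitely many bumps on balls inside U cover K. Their sum is positive on K and vanishes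
  off the finite union of the closed balls, a compact subset of U.\<close>

lemma positive_test_function:
  fixes K :: "(real^'n::finite) set"
  assumes "compact K" "open U" "K \<subseteq> U"
  obtains \<phi> where "\<phi> \<in> test_functions U" "\<And>x. \<phi> x \<ge> 0" "\<And>x. x \<in> K \<Longrightarrow> \<phi> x > 0"
proof -
  have "\<exists>r>0. cball x r \<subseteq> U" if "x \<in> K" for x
    using assms(2,3) that open_contains_cball by blast
  then obtain r where r: "\<And>x. x \<in> K \<Longrightarrow> r x > 0 \<and> cball x (r x) \<subseteq> U" by metis
  have "\<exists>b. smooth b \<and> (\<forall>y. b y \<ge> 0) \<and> (\<forall>y. b y > 0 \<longleftrightarrow> y \<in> ball x (r x))" if "x \<in> K" for x
    using bump_exists[of "r x" x] r[OF that] by metis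
  then obtain b where b: "\<And>x. x \<in> K \<Longrightarrow> smooth (b x)" "\<And>x y. x \<in> K \<Longrightarrow> b x y \<ge> 0"
    "\<And>x y. x \<in> K \<Longrightarrow> b x y > 0 \<longleftrightarrow> y \<in> ball x (r x)" by metis
  have "K \<subseteq> (\<Union>x\<in>K. ball x (r x))" using r by fastforce
  then obtain C where C: "C \<subseteq> K" "finite C" "K \<subseteq> (\<Union>x\<in>C. ball x (r x))"
    using compactE_image[OF assms(1), of K "\<lambda>x. ball x (r x)"] by auto
  let ?\<phi> = "\<lambda>y. \<Sum>x\<in>C. b x y"
  have "?\<phi> \<in> test_functions U"
  proof (rule test_functionsI)
    show "smooth ?\<phi>" using b C by (intro smooth_sum) auto
    show "compact (\<Union>x\<in>C. cball x (r x))" using C by (intro compact_UN) auto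
    show "(\<Union>x\<in>C. cball x (r x)) \<subseteq> U" using r C by blast
    show "?\<phi> y = 0" if "y \<notin> (\<Union>x\<in>C. cball x (r x))" for y
    proof (rule sum.neutral, intro ballI)
      fix x assume "x \<in> C"
      with that C(1) b(2,3)[of x y] show "b x y = 0" by force
    qed
  qed
  moreover have "?\<phi> y \<ge> 0" for y using b C by (intro sum_nonneg) auto
  moreover have "?\<phi> y > 0" if y: "y \<in> K" for y
  proof -
    obtain x where "x \<in> C" "y \<in> ball x (r x)" using C(3) y by blast
    with b C show ?thesis by (intro sum_pos2[of C x]) auto
  qed
  ultimately show thesis using that by blast
qed

text \<open>Off K the approximants vanish eventually, because they are supported in the shrinking
  neighbourhoods \<open>V n\<close>; on K they tend to 1, because a positive function is saturated
  by 1 - exp(-s).\<close>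

lemma indicator_approx_test_functions:
  fixes K :: "(real^'n::finite) set"
  assumes "compact K" "open U" "K \<subseteq> U"
  obtains \<phi> where "\<And>n::nat. \<phi> n \<in> test_functions U" "\<And>n x. 0 \<le> \<phi> n x" "\<And>n x. \<phi> n x \<le> 1"
    "\<And>x. (\<lambda>n. \<phi> n x) \<longlonglongrightarrow> indicator K x"
proof -
  define V where "V n = U \<inter> (\<Union>x\<in>K. ball x (1 / real (Suc n)))" for n
  have "\<exists>\<psi>. \<psi> \<in> test_functions (V n) \<and> (\<forall>x. 0 \<le> \<psi> x \<and> \<psi> x \<le> 1) \<and>
      (\<forall>x\<in>K. \<psi> x \<ge> 1 - exp (- real n))" for n
  proof -
    have "x \<in> ball x (1 / real (Suc n))" for x :: "real^'n" by simp
    then have "K \<subseteq> V n" using assms(3) unfolding V_def by blast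
    moreover have "open (V n)" unfolding V_def using assms(2) by (intro open_Int open_UN) auto
    ultimately obtain \<phi> where \<phi>: "\<phi> \<in> test_functions (V n)" "\<And>x. \<phi> x \<ge> 0" "\<And>x. x \<in> K \<Longrightarrow> \<phi> x > 0"
      using positive_test_function[OF assms(1)] by blast
    have "\<exists>m>0. \<forall>x\<in>K. m \<le> \<phi> x"
    proof (cases "K = {}")
      case False
      have "continuous_on K \<phi>"
        using smooth_continuous[OF test_functionsD(1)[OF \<phi>(1)]] continuous_on_subset by blast
      then obtain x where "x \<in> K" "\<forall>y\<in>K. \<phi> x \<le> \<phi> y"
        using continuous_attains_inf[OF assms(1) False] by blast
      with \<phi>(3) show ?thesis by blast
    qed (auto intro: exI[of _ 1])
    then obtain m where m: "m > 0" "\<And>x. x \<in> K \<Longrightarrow> m \<le> \<phi> x" by blast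
    \<comment> \<open>Since m is a positive lower bound of \<phi> on K, the exponent is at most -n
      there. \<open>?F\<close> vanishes at 0, as needed for composition with a test function, and
      maps nonnegative numbers into [0, 1).\<close>
    let ?F = "\<lambda>t. 1 + (-1) * exp ((- real n / m) * t)"
    have "(\<lambda>x. ?F (\<phi> x)) \<in> test_functions (V n)"
      by (rule test_functions_compose[OF \<phi>(1)])
        (intro smooth1_add[OF smooth1_const] smooth1_mult[OF smooth1_const] smooth1_compose[OF smooth1_exp] smooth1_ident, simp)
    moreover have "0 \<le> ?F (\<phi> x) \<and> ?F (\<phi> x) \<le> 1" for x
      using \<phi>(2)[of x] m by (auto simp: divide_le_0_iff)
    moreover have "?F (\<phi> x) \<ge> 1 - exp (- real n)" if "x \<in> K" for x
    proof -
      have "real n * m \<le> real n * \<phi> x" using m(2)[OF that] by (intro mult_left_mono) auto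
      then show ?thesis using m by (simp add: field_simps)
    qed
    ultimately show ?thesis by (intro exI[of _ "\<lambda>x. ?F (\<phi> x)"]) auto
  qed
  then obtain \<psi> where \<psi>: "\<And>n. \<psi> n \<in> test_functions (V n)" "\<And>n x. 0 \<le> \<psi> n x" "\<And>n x. \<psi> n x \<le> 1"
    "\<And>n x. x \<in> K \<Longrightarrow> \<psi> n x \<ge> 1 - exp (- real n)" by metis
  have "(\<lambda>n. \<psi> n x) \<longlonglongrightarrow> indicator K x" for x
  proof (cases "x \<in> K")
    case True
    have "(\<lambda>n. \<psi> n x) \<longlonglongrightarrow> 1"
    proof (rule tendsto_sandwich[of "\<lambda>n. 1 - exp (- real n)" _ _ "\<lambda>n. 1"])
      show "(\<lambda>n. 1 - exp (- real n)) \<longlonglongrightarrow> 1" by real_asymp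
    qed (use \<psi>(3,4) True in auto)
    with True show ?thesis by simp
  next
    case False
    obtain d where d: "d > 0" "\<And>y. y \<in> K \<Longrightarrow> d \<le> dist x y"
      using separate_point_closed[OF compact_imp_closed[OF assms(1)] False] by blast
    obtain N where N: "1 / real (Suc N) < d" using d(1) nat_approx_posE by blast
    have "\<psi> n x = 0" if "n \<ge> N" for n
    proof -
      have "1 / real (Suc n) \<le> 1 / real (Suc N)" using that by (simp add: frac_le)
      then have "x \<notin> V n" using d N by (force simp: V_def dist_commute)
      then show ?thesis using test_functionsD(3,4)[OF \<psi>(1)] by blast
    qed
    then have "(\<lambda>n. \<psi> n x) \<longlonglongrightarrow> 0"
      by (intro tendsto_eventually) (auto simp: eventually_sequentially)
    with False show ?thesis by simp
  qed
  moreover have "\<psi> n \<in> test_functions U" for n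
    using \<psi>(1) test_functions_mono[of "V n" U] by (auto simp: V_def)
  ultimately show thesis using that \<psi>(2,3) by blast
qed

section \<open>Translations and density in the Lebesgue space\<close>

lemma distr_lebesgue_translate:
  fixes a :: "'a::euclidean_space"
  shows "distr lebesgue lebesgue (\<lambda>x. x + a) = lebesgue" "(\<lambda>x. x + a) \<in> lebesgue \<rightarrow>\<^sub>M lebesgue"
proof -
  have eq: "(\<lambda>x. a + (\<Sum>j\<in>Basis. (1 * (x \<bullet> j)) *\<^sub>R j)) = (\<lambda>x. x + a)"
    by (simp add: euclidean_representation add.commute)
  show "(\<lambda>x. x + a) \<in> lebesgue \<rightarrow>\<^sub>M lebesgue"
    using lebesgue_affine_measurable[of "\<lambda>_. 1" a] unfolding eq by simp
  show "distr lebesgue lebesgue (\<lambda>x. x + a) = lebesgue"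
    using lebesgue_affine_euclidean[of "\<lambda>_. 1" a] unfolding eq by (simp add: density_1)
qed

lemma integrable_translate:
  fixes f :: "'a::euclidean_space \<Rightarrow> real"
  assumes "integrable lebesgue f" shows "integrable lebesgue (\<lambda>x. f (x + a))"
  using integrable_distr[OF distr_lebesgue_translate(2)[of a], of f] assms
  by (simp add: distr_lebesgue_translate(1))

lemma integral_translate:
  fixes f :: "'a::euclidean_space \<Rightarrow> real"
  assumes "integrable lebesgue f"
  shows "(\<integral>x. f (x + a) \<partial>lebesgue) = (\<integral>x. f x \<partial>lebesgue)"
  using integral_distr[OF distr_lebesgue_translate(2)[of a], of f] borel_measurable_integrable[OF assms]
  by (simp add: distr_lebesgue_translate(1))

lemma continuous_lebesgue_measurable:
  fixes f :: "'a::euclidean_space \<Rightarrow> real"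
  assumes "continuous_on UNIV f" shows "f \<in> borel_measurable lebesgue"
  by (intro measurable_completion) (simp add: borel_measurable_continuous_onI assms)

lemma test_functions_zero: "\<phi> \<in> test_functions U \<Longrightarrow> x \<notin> U \<Longrightarrow> \<phi> x = 0"
  using test_functionsD(3,4) by blast

lemma test_functions_measurable:
  "\<phi> \<in> test_functions \<Omega> \<Longrightarrow> \<phi> \<in> borel_measurable lebesgue"
  by (intro continuous_lebesgue_measurable smooth_continuous test_functionsD)

lemma lebesgue_integrable_indicator_compact:
  fixes K :: "'a::euclidean_space set"
  assumes "compact K" shows "integrable lebesgue (indicator K :: 'a \<Rightarrow> real)"
  using lmeasurable_compact[OF assms] by (intro integrable_real_indicator) (auto simp: fmeasurable_def)

lemma integrable_mult_bounded:
  fixes f g :: "'a \<Rightarrow> real"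
  assumes "integrable M f" "g \<in> borel_measurable M" "AE x in M. \<bar>g x\<bar> \<le> B"
  shows "integrable M (\<lambda>x. f x * g x)"
proof (rule Bochner_Integration.integrable_bound)
  show "integrable M (\<lambda>x. B * f x)" using assms by simp
  show "(\<lambda>x. f x * g x) \<in> borel_measurable M" using assms by measurable
  show "AE x in M. norm (f x * g x) \<le> norm (B * f x)"
    using assms(3)
  proof eventually_elim
    case (elim x)
    then have "\<bar>f x\<bar> * \<bar>g x\<bar> \<le> \<bar>f x\<bar> * \<bar>B\<bar>" by (intro mult_left_mono) auto
    then show ?case by (simp add: abs_mult mult.commute)
  qed
qed

lemma test_functions_integrable:
  assumes "\<phi> \<in> test_functions \<Omega>" shows "integrable lebesgue \<phi>"
proof -
  obtain B where B: "\<And>x. \<bar>\<phi> x\<bar> \<le> B" using test_functions_bounded[OF assms] by blast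
  have "integrable lebesgue (\<lambda>x. indicator (closure {x. \<phi> x \<noteq> 0}) x * \<phi> x)"
    by (rule integrable_mult_bounded[OF lebesgue_integrable_indicator_compact[OF test_functionsD(2)[OF assms]]
          test_functions_measurable[OF assms]]) (rule AE_I2, rule B)
  moreover have "(\<lambda>x. indicator (closure {x. \<phi> x \<noteq> 0}) x * \<phi> x) = \<phi>"
    using closure_subset[of "{x. \<phi> x \<noteq> 0}"] by (auto simp: fun_eq_iff indicator_def)
  ultimately show ?thesis by simp
qed

text \<open>Inner regularity: up to a null set a measurable set is an F_sigma, hence a countable
  union of compact sets, whose finite partial unions increase.\<close>

lemma lebesgue_compact_exhaustion:
  fixes A :: "'a::euclidean_space set"
  assumes "A \<in> sets lebesgue"
  obtains K :: "nat \<Rightarrow> 'a set" where "\<And>n. compact (K n)" "\<And>n. K n \<subseteq> A"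
    "AE x in lebesgue. (\<lambda>n. indicator (K n) x :: real) \<longlonglongrightarrow> indicator A x"
proof -
  obtain C T where CT: "fsigma C" "T \<in> null_sets lebesgue" "C \<union> T = A" "disjnt C T"
    using lebesgue_set_almost_fsigma[OF assms] .
  obtain F :: "nat \<Rightarrow> 'a set" where F: "range F \<subseteq> Collect compact" "C = \<Union> (range F)"
    using fsigma_Union_compact CT(1) by metis
  define K where "K n = (\<Union>i<n. F i)" for n
  have "compact (K n)" for n unfolding K_def using F(1) by (intro compact_UN) auto
  moreover have "K n \<subseteq> A" for n unfolding K_def using F(2) CT(3) by blast
  moreover have "AE x in lebesgue. (\<lambda>n. indicator (K n) x :: real) \<longlonglongrightarrow> indicator A x"
    using AE_not_in[OF CT(2)]
  proof eventually_elim
    case (elim x)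
    have "(\<lambda>n. indicator (\<Union>i<n. F i) x :: real) \<longlonglongrightarrow> indicator (\<Union>i. F i) x"
      by (rule LIMSEQ_indicator_UN)
    moreover have "indicator (\<Union>i. F i) x = (indicator A x :: real)"
      using elim F(2) CT(3) by (auto simp: indicator_def)
    ultimately show ?case by (simp add: K_def)
  qed
  ultimately show thesis using that by blast
qed

text \<open>The class \<open>D\<close> of approximable functions is closed under sums, multiples and
  dominated almost-everywhere limits. This leads from test functions to indicators of compact sets,
  then of measurable sets of finite measure, and by \<open>integrable_induct\<close> to all
  integrable functions.\<close>

lemma L1_dense_test_functions:
  fixes f :: "real^'n::finite \<Rightarrow> real"
  assumes "integrable lebesgue f" "\<epsilon> > 0"
  shows "\<exists>\<phi>\<in>test_functions UNIV. (\<integral>x. \<bar>f x - \<phi> x\<bar> \<partial>lebesgue) < \<epsilon>"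
proof -
  define D :: "(real^'n \<Rightarrow> real) \<Rightarrow> bool" where
    "D f \<longleftrightarrow> (\<forall>\<epsilon>>0. \<exists>\<phi>\<in>test_functions UNIV. (\<integral>x. \<bar>f x - \<phi> x\<bar> \<partial>lebesgue) < \<epsilon>)" for f
  have D_lim: "D f" if f: "integrable lebesgue f" and s: "\<And>n. integrable lebesgue (s n)" "\<And>n. D (s n)"
    "AE x in lebesgue. (\<lambda>n. s n x) \<longlonglongrightarrow> f x"
    and w: "integrable lebesgue w" "\<And>n. AE x in lebesgue. \<bar>s n x\<bar> \<le> w x" for f w and s :: "nat \<Rightarrow> real^'n \<Rightarrow> real"
    unfolding D_def
  proof (intro allI impI)
    fix \<epsilon> :: real assume "\<epsilon> > 0"
    have "(\<lambda>n. \<integral>x. \<bar>f x - s n x\<bar> \<partial>lebesgue) \<longlonglongrightarrow> integral\<^sup>L lebesgue (\<lambda>x::real^'n. 0)"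
    proof (rule integral_dominated_convergence[where w = "\<lambda>x. \<bar>f x\<bar> + w x"])
      show "AE x in lebesgue. (\<lambda>n. \<bar>f x - s n x\<bar>) \<longlonglongrightarrow> 0"
        using s(3)
      proof eventually_elim
        case (elim x)
        then have "(\<lambda>n. \<bar>f x - s n x\<bar>) \<longlonglongrightarrow> \<bar>f x - f x\<bar>" by (intro tendsto_intros)
        then show ?case by simp
      qed
      show "AE x in lebesgue. norm \<bar>f x - s n x\<bar> \<le> \<bar>f x\<bar> + w x" for n
        using w(2)[of n] by eventually_elim auto
      show "(\<lambda>x. \<bar>f x - s n x\<bar>) \<in> borel_measurable lebesgue" for n
        using borel_measurable_integrable[OF f] borel_measurable_integrable[OF s(1)] by measurable
    qed (use f w(1) in auto)
    then have "(\<lambda>n. \<integral>x. \<bar>f x - s n x\<bar> \<partial>lebesgue) \<longlonglongrightarrow> 0" by simp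
    then obtain n where n: "(\<integral>x. \<bar>f x - s n x\<bar> \<partial>lebesgue) < \<epsilon> / 2"
      using order_tendstoD(2)[of _ 0 sequentially "\<epsilon> / 2"] \<open>\<epsilon> > 0\<close>
      by (fastforce simp: eventually_sequentially)
    obtain \<phi> where \<phi>: "\<phi> \<in> test_functions UNIV" "(\<integral>x. \<bar>s n x - \<phi> x\<bar> \<partial>lebesgue) < \<epsilon> / 2"
      using s(2)[of n] \<open>\<epsilon> > 0\<close> unfolding D_def by (meson half_gt_zero)
    have i: "integrable lebesgue (\<lambda>x. \<bar>f x - s n x\<bar>)" "integrable lebesgue (\<lambda>x. \<bar>s n x - \<phi> x\<bar>)"
      "integrable lebesgue (\<lambda>x. \<bar>f x - \<phi> x\<bar>)"
      using f s(1) test_functions_integrable[OF \<phi>(1)] by auto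
    have "(\<integral>x. \<bar>f x - \<phi> x\<bar> \<partial>lebesgue) \<le> (\<integral>x. \<bar>f x - s n x\<bar> + \<bar>s n x - \<phi> x\<bar> \<partial>lebesgue)"
      using i by (intro integral_mono) auto
    also have "\<dots> = (\<integral>x. \<bar>f x - s n x\<bar> \<partial>lebesgue) + (\<integral>x. \<bar>s n x - \<phi> x\<bar> \<partial>lebesgue)"
      using i by (intro Bochner_Integration.integral_add) auto
    also have "\<dots> < \<epsilon>" using n \<phi>(2) by simp
    finally show "\<exists>\<phi>\<in>test_functions UNIV. (\<integral>x. \<bar>f x - \<phi> x\<bar> \<partial>lebesgue) < \<epsilon>"
      using \<phi>(1) by blast
  qed
  have test: "D \<phi>" if "\<phi> \<in> test_functions UNIV" for \<phi>
    unfolding D_def using that by (intro allI impI bexI[of _ \<phi>]) auto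
  have scale: "D (\<lambda>x. c * f x)" if Df: "D f" for c f
    unfolding D_def
  proof (intro allI impI)
    fix \<epsilon> :: real assume "\<epsilon> > 0"
    then have "\<epsilon> / (\<bar>c\<bar> + 1) > 0" by simp
    then obtain \<phi> where \<phi>: "\<phi> \<in> test_functions UNIV" "(\<integral>x. \<bar>f x - \<phi> x\<bar> \<partial>lebesgue) < \<epsilon> / (\<bar>c\<bar> + 1)"
      using Df unfolding D_def by meson
    have "(\<integral>x. \<bar>c * f x - c * \<phi> x\<bar> \<partial>lebesgue) = \<bar>c\<bar> * (\<integral>x. \<bar>f x - \<phi> x\<bar> \<partial>lebesgue)"
      by (subst integral_mult_right_zero[symmetric]) (simp add: abs_mult flip: right_diff_distrib)
    also have "\<dots> \<le> (\<bar>c\<bar> + 1) * (\<integral>x. \<bar>f x - \<phi> x\<bar> \<partial>lebesgue)"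
      by (intro mult_right_mono) auto
    also have "\<dots> < \<epsilon>" using \<phi>(2) by (simp add: field_simps)
    finally show "\<exists>\<phi>\<in>test_functions UNIV. (\<integral>x. \<bar>c * f x - \<phi> x\<bar> \<partial>lebesgue) < \<epsilon>"
      using test_functions_mult[OF \<phi>(1) smooth_const[of c]] by (intro bexI[of _ "\<lambda>x. c * \<phi> x"])
  qed
  have cpt: "D (indicator K)" if K: "compact K" for K
  proof -
    obtain R where R: "R > 0" "K \<subseteq> ball 0 R" using bounded_subset_ballD[OF compact_imp_bounded[OF K], of 0] by auto
    obtain \<phi> where \<phi>: "\<And>n::nat. \<phi> n \<in> test_functions (ball 0 R)" "\<And>n x. 0 \<le> \<phi> n x" "\<And>n x. \<phi> n x \<le> 1"
      "\<And>x. (\<lambda>n. \<phi> n x) \<longlonglongrightarrow> indicator K x"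
      using indicator_approx_test_functions[OF K open_ball R(2)] by blast
    have T: "\<phi> n \<in> test_functions UNIV" for n using \<phi>(1) test_functions_mono by blast
    show ?thesis
    proof (rule D_lim[where s = \<phi> and w = "indicator (cball 0 R)"])
      show "AE x in lebesgue. \<bar>\<phi> n x\<bar> \<le> indicator (cball 0 R) x" for n
      proof (rule AE_I2)
        fix x
        show "\<bar>\<phi> n x\<bar> \<le> indicator (cball 0 R) x"
          using \<phi>(2,3)[of n x] test_functions_zero[OF \<phi>(1)[of n], of x]
          by (cases "x \<in> cball 0 R") (auto simp: indicator_def)
      qed
    qed (use K T \<phi>(4) test test_functions_integrable[OF T] in \<open>auto intro: lebesgue_integrable_indicator_compact\<close>)
  qed
  have D_add: "D (\<lambda>x. f x + g x)" if fg: "D f" "D g" "integrable lebesgue f" "integrable lebesgue g" for f g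
    unfolding D_def
  proof (intro allI impI)
    fix \<epsilon> :: real assume "\<epsilon> > 0"
    then obtain \<phi> \<psi> where \<phi>: "\<phi> \<in> test_functions UNIV" "(\<integral>x. \<bar>f x - \<phi> x\<bar> \<partial>lebesgue) < \<epsilon> / 2"
      and \<psi>: "\<psi> \<in> test_functions UNIV" "(\<integral>x. \<bar>g x - \<psi> x\<bar> \<partial>lebesgue) < \<epsilon> / 2"
      using fg(1,2) unfolding D_def by (meson half_gt_zero)
    note [simp] = \<phi>(1)[THEN test_functions_integrable] \<psi>(1)[THEN test_functions_integrable] fg(3,4)
    \<comment> \<open>The sum of test functions is written as \<phi> - (-1) * \<psi> because
      differences and smooth multiples are the operations already known to preserve test
      functions.\<close>
    have "(\<integral>x. \<bar>f x + g x - (\<phi> x - (-1) * \<psi> x)\<bar> \<partial>lebesgue) \<le> (\<integral>x. \<bar>f x - \<phi> x\<bar> + \<bar>g x - \<psi> x\<bar> \<partial>lebesgue)"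
      by (intro integral_mono) auto
    also have "\<dots> = (\<integral>x. \<bar>f x - \<phi> x\<bar> \<partial>lebesgue) + (\<integral>x. \<bar>g x - \<psi> x\<bar> \<partial>lebesgue)"
      by (intro Bochner_Integration.integral_add) auto
    also have "\<dots> < \<epsilon>" using \<psi>(2) \<phi>(2) by simp
    finally show "\<exists>\<phi>\<in>test_functions UNIV. (\<integral>x. \<bar>f x + g x - \<phi> x\<bar> \<partial>lebesgue) < \<epsilon>"
      using test_functions_diff[OF \<phi>(1) test_functions_mult[OF \<psi>(1) smooth_const[of "-1"]]]
      by (intro bexI[of _ "\<lambda>x. \<phi> x - (-1) * \<psi> x"])
  qed
  have "D f"
    using assms(1)
  proof (induction f rule: integrable_induct)
    case (base A c)
    obtain K :: "nat \<Rightarrow> (real^'n) set" where K: "\<And>n. compact (K n)" "\<And>n. K n \<subseteq> A"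
      "AE x in lebesgue. (\<lambda>n. indicator (K n) x :: real) \<longlonglongrightarrow> indicator A x"
      using lebesgue_compact_exhaustion[OF base(1)] by blast
    have "D (indicator A)"
    proof (rule D_lim[where s = "\<lambda>n. indicator (K n)" and w = "indicator A"])
      show "AE x in lebesgue. \<bar>indicator (K n) x\<bar> \<le> (indicator A x :: real)" for n
        using K(2)[of n] by (auto simp: indicator_def)
    qed (use K cpt base in \<open>auto intro: lebesgue_integrable_indicator_compact\<close>)
    from scale[OF this, of c] show ?case by (simp add: mult.commute)
  next
    case (add f g)
    show ?case by (rule D_add) fact+
  next
    case (lim f s)
    \<comment> \<open>The approximants supplied by the induction are bounded by twice the modulus of
      f, which serves as the dominating function.\<close>
    show ?case by (rule D_lim[where s = s and w = "\<lambda>x. 2 * \<bar>f x\<bar>"]) (use lim in auto)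
  qed
  with assms(2) show ?thesis unfolding D_def by blast
qed

lemma L1_translation_continuous:
  fixes f :: "real^'n::finite \<Rightarrow> real"
  assumes "integrable lebesgue f" "\<epsilon> > 0"
  obtains \<delta> where "\<delta> > 0" "\<And>y. norm y < \<delta> \<Longrightarrow> (\<integral>x. \<bar>f (x + y) - f x\<bar> \<partial>lebesgue) < \<epsilon>"
proof -
  obtain \<phi> where \<phi>: "\<phi> \<in> test_functions UNIV" "(\<integral>x. \<bar>f x - \<phi> x\<bar> \<partial>lebesgue) < \<epsilon> / 3"
    using L1_dense_test_functions[OF assms(1), of "\<epsilon> / 3"] assms(2) by auto
  note \<phi>i = test_functions_integrable[OF \<phi>(1)]
  let ?S = "closure {x. \<phi> x \<noteq> 0}"
  obtain R where R: "R > 0" "?S \<subseteq> ball 0 R"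
    using bounded_subset_ballD[OF compact_imp_bounded[OF test_functionsD(2)[OF \<phi>(1)]], of 0] by auto
  \<comment> \<open>For norm y < 1, both \<phi> (x + y) and \<phi> x vanish when x lies outside this
    ball. The denominators below contain \<open>?m + 1\<close> so that their positivity is
    immediate.\<close>
  let ?B = "cball 0 (R + 1) :: (real^'n) set" let ?m = "measure lebesgue ?B"
  \<comment> \<open>Radius R + 2 accommodates both x and x + y for every x in \<open>?B\<close> and
    norm y < 1.\<close>
  have "uniformly_continuous_on (cball 0 (R + 2)) \<phi>"
    by (rule compact_uniformly_continuous[OF continuous_on_subset[OF smooth_continuous[OF test_functionsD(1)[OF \<phi>(1)]]]]) auto
  moreover have "\<epsilon> / (3 * (?m + 1)) > 0" using assms(2) by (simp add: add_nonneg_pos)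
  ultimately obtain d where d: "d > 0"
    "\<And>x x'. x \<in> cball 0 (R + 2) \<Longrightarrow> x' \<in> cball 0 (R + 2) \<Longrightarrow> dist x' x < d \<Longrightarrow>
      dist (\<phi> x') (\<phi> x) < \<epsilon> / (3 * (?m + 1))"
    unfolding uniformly_continuous_on_def by meson
  show thesis
  proof (rule that)
    show "min d 1 > 0" using d by simp
    fix y :: "real^'n" assume y: "norm y < min d 1"
    have b: "\<bar>\<phi> (x + y) - \<phi> x\<bar> \<le> \<epsilon> / (3 * (?m + 1)) * indicator ?B x" for x
    proof (cases "x \<in> ?B")
      case True
      have "norm (x + y) \<le> norm x + norm y" by (rule norm_triangle_ineq)
      then have "x + y \<in> cball 0 (R + 2)" "x \<in> cball 0 (R + 2)" using True y by auto
      then show ?thesis using d(2)[of x "x + y"] y True by (simp add: dist_norm)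
    next
      case False
      have "norm x - norm y \<le> norm (x + y)" using norm_diff_ineq[of x y] by simp
      then have "x + y \<notin> ball 0 R" "x \<notin> ball 0 R" using False y by auto
      then have "\<phi> (x + y) = 0" "\<phi> x = 0" using test_functionsD(4)[OF \<phi>(1)] R(2) by blast+
      then show ?thesis using assms(2) measure_nonneg[of lebesgue ?B] by simp
    qed
    note i = integrable_translate[OF assms(1), of y] integrable_translate[OF \<phi>i, of y] assms(1) \<phi>i
      lebesgue_integrable_indicator_compact[OF compact_cball[of "0::real^'n" "R + 1"]]
    have "(\<integral>x. \<bar>f (x + y) - f x\<bar> \<partial>lebesgue) \<le>
       (\<integral>x. (\<bar>f (x + y) - \<phi> (x + y)\<bar> + \<bar>f x - \<phi> x\<bar>) + \<epsilon> / (3 * (?m + 1)) * indicator ?B x \<partial>lebesgue)"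
    proof (rule integral_mono)
      show "integrable lebesgue (\<lambda>x. \<bar>f (x + y) - \<phi> (x + y)\<bar> + \<bar>f x - \<phi> x\<bar> + \<epsilon> / (3 * (?m + 1)) * indicator ?B x)"
        using i by auto
      show "\<bar>f (x + y) - f x\<bar> \<le> \<bar>f (x + y) - \<phi> (x + y)\<bar> + \<bar>f x - \<phi> x\<bar> + \<epsilon> / (3 * (?m + 1)) * indicator ?B x" for x
        using b[of x] by linarith
    qed (use i in auto)
    also have "\<dots> = (\<integral>x. \<bar>f (x + y) - \<phi> (x + y)\<bar> \<partial>lebesgue) + (\<integral>x. \<bar>f x - \<phi> x\<bar> \<partial>lebesgue) +
      \<epsilon> / (3 * (?m + 1)) * ?m"
      using i by simp
    also have "(\<integral>x. \<bar>f (x + y) - \<phi> (x + y)\<bar> \<partial>lebesgue) = (\<integral>x. \<bar>f x - \<phi> x\<bar> \<partial>lebesgue)"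
      using integral_translate[of "\<lambda>x. \<bar>f x - \<phi> x\<bar>" y] i by simp
    also have "\<epsilon> / (3 * (?m + 1)) * ?m \<le> \<epsilon> / 3"
    proof -
      have "0 \<le> ?m" by (rule measure_nonneg)
      then have "?m / (?m + 1) \<le> 1" by (subst divide_le_eq_1_pos) linarith+
      then have "\<epsilon> / 3 * (?m / (?m + 1)) \<le> \<epsilon> / 3 * 1"
        using assms(2) by (intro mult_left_mono) auto
      then show ?thesis by simp
    qed
    finally show "(\<integral>x. \<bar>f (x + y) - f x\<bar> \<partial>lebesgue) < \<epsilon>" using \<phi>(2) by linarith
  qed
qed

text \<open>The optimal test function would be the sign of f on U. It is reached by two limits:
  compact sets exhaust {f > 0} and {f < 0} inside U, and test functions with values in [0, 1]
  approximate their indicators, so that the differences stay in [-1, 1].\<close>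

lemma L1_bound_by_duality:
  fixes f :: "real^'n::finite \<Rightarrow> real"
  assumes U: "open U" and f: "integrable lebesgue f"
    and le: "\<And>\<psi>. \<psi> \<in> test_functions U \<Longrightarrow> (\<And>x. \<bar>\<psi> x\<bar> \<le> 1) \<Longrightarrow> \<bar>\<integral>x. f x * \<psi> x \<partial>lebesgue\<bar> \<le> C"
  shows "(\<integral>x. indicator U x * \<bar>f x\<bar> \<partial>lebesgue) \<le> C"
proof -
  note fm = borel_measurable_integrable[OF f]
  have UL: "U \<in> sets lebesgue" using U by simp
  have "{x. f x > 0} \<in> sets lebesgue" "{x. f x < 0} \<in> sets lebesgue"
    using fm borel_measurable_iff_greater[of f lebesgue] borel_measurable_iff_less[of f lebesgue] by simp_all
  then have m: "{x. f x > 0} \<inter> U \<in> sets lebesgue" "{x. f x < 0} \<inter> U \<in> sets lebesgue"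
    using UL by blast+
  obtain K :: "nat \<Rightarrow> (real^'n) set" where K: "\<And>n. compact (K n)" "\<And>n. K n \<subseteq> {x. f x > 0} \<inter> U"
    "AE x in lebesgue. (\<lambda>n. indicator (K n) x :: real) \<longlonglongrightarrow> indicator ({x. f x > 0} \<inter> U) x"
    using lebesgue_compact_exhaustion[OF m(1)] by blast
  obtain L :: "nat \<Rightarrow> (real^'n) set" where L: "\<And>n. compact (L n)" "\<And>n. L n \<subseteq> {x. f x < 0} \<inter> U"
    "AE x in lebesgue. (\<lambda>n. indicator (L n) x :: real) \<longlonglongrightarrow> indicator ({x. f x < 0} \<inter> U) x"
    using lebesgue_compact_exhaustion[OF m(2)] by blast
  have KLm: "indicat_real (K n) \<in> borel_measurable lebesgue" "indicat_real (L n) \<in> borel_measurable lebesgue" for n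
    using borel_measurable_integrable[OF lebesgue_integrable_indicator_compact[OF K(1)]]
      borel_measurable_integrable[OF lebesgue_integrable_indicator_compact[OF L(1)]] by blast+
  have bound: "(\<integral>x. f x * (indicator (K n) x - indicator (L n) x) \<partial>lebesgue) \<le> C" for n
  proof -
    have KU: "K n \<subseteq> U" and LU: "L n \<subseteq> U" using K(2) L(2) by blast+
    obtain \<phi> where \<phi>: "\<And>m::nat. \<phi> m \<in> test_functions U" "\<And>m x. 0 \<le> \<phi> m x" "\<And>m x. \<phi> m x \<le> 1"
        "\<And>x. (\<lambda>m. \<phi> m x) \<longlonglongrightarrow> indicator (K n) x"
      using indicator_approx_test_functions[OF K(1) U KU] by blast
    obtain \<psi> where \<psi>: "\<And>m::nat. \<psi> m \<in> test_functions U" "\<And>m x. 0 \<le> \<psi> m x" "\<And>m x. \<psi> m x \<le> 1"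
        "\<And>x. (\<lambda>m. \<psi> m x) \<longlonglongrightarrow> indicator (L n) x"
      using indicator_approx_test_functions[OF L(1) U LU] by blast
    have b: "\<bar>\<phi> m x - \<psi> m x\<bar> \<le> 1" for x m using \<phi>(2,3)[of m x] \<psi>(2,3)[of m x] by linarith
    have T: "(\<lambda>x. \<phi> m x - \<psi> m x) \<in> test_functions U" for m
      by (rule test_functions_diff[OF \<phi>(1) \<psi>(1)])
    have "(\<lambda>m. \<integral>x. f x * (\<phi> m x - \<psi> m x) \<partial>lebesgue) \<longlonglongrightarrow>
        (\<integral>x. f x * (indicator (K n) x - indicator (L n) x) \<partial>lebesgue)"
    proof (rule integral_dominated_convergence[where w = "\<lambda>x. \<bar>f x\<bar>"])
      show "(\<lambda>x. f x * (indicator (K n) x - indicator (L n) x)) \<in> borel_measurable lebesgue"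
        using fm KLm by measurable
      show "(\<lambda>x. f x * (\<phi> m x - \<psi> m x)) \<in> borel_measurable lebesgue" for m
        using fm test_functions_measurable[OF T] by measurable
      show "AE x in lebesgue. (\<lambda>m. f x * (\<phi> m x - \<psi> m x)) \<longlonglongrightarrow> f x * (indicator (K n) x - indicator (L n) x)"
        using \<phi>(4) \<psi>(4) by (intro AE_I2 tendsto_intros) auto
      show "AE x in lebesgue. norm (f x * (\<phi> m x - \<psi> m x)) \<le> \<bar>f x\<bar>" for m
        using b by (intro AE_I2) (simp add: abs_mult mult_left_le)
    qed (use f in simp)
    moreover have "(\<integral>x. f x * (\<phi> m x - \<psi> m x) \<partial>lebesgue) \<le> C" for m
      using le[OF T[of m] b[of m]] by (simp add: abs_le_iff)
    ultimately show ?thesis by (auto intro: LIMSEQ_le_const2)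
  qed
  have "(\<lambda>n. \<integral>x. f x * (indicator (K n) x - indicator (L n) x) \<partial>lebesgue) \<longlonglongrightarrow>
      (\<integral>x. indicator U x * \<bar>f x\<bar> \<partial>lebesgue)"
  proof (rule integral_dominated_convergence[where w = "\<lambda>x. \<bar>f x\<bar>"])
    show "(\<lambda>x. f x * (indicator (K n) x - indicator (L n) x)) \<in> borel_measurable lebesgue" for n
      using fm KLm by measurable
    show "(\<lambda>x. indicator U x * \<bar>f x\<bar>) \<in> borel_measurable lebesgue"
      using fm UL by measurable
    show "AE x in lebesgue. (\<lambda>n. f x * (indicator (K n) x - indicator (L n) x)) \<longlonglongrightarrow> indicator U x * \<bar>f x\<bar>"
      using K(3) L(3)
    proof eventually_elim
      case (elim x)
      then have "(\<lambda>n. f x * (indicator (K n) x - indicator (L n) x)) \<longlonglongrightarrow>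
         f x * (indicator ({x. f x > 0} \<inter> U) x - indicator ({x. f x < 0} \<inter> U) x)"
        by (intro tendsto_intros)
      also have "f x * (indicator ({x. f x > 0} \<inter> U) x - indicator ({x. f x < 0} \<inter> U) x) = indicator U x * \<bar>f x\<bar>"
        by (auto simp: indicator_def)
      finally show ?case .
    qed
    show "AE x in lebesgue. norm (f x * (indicator (K n) x - indicator (L n) x)) \<le> \<bar>f x\<bar>" for n
      by (intro AE_I2) (auto simp: abs_mult indicator_def)
  qed (use f in simp)
  then show ?thesis by (rule LIMSEQ_le_const2) (use bound in auto)
qed

section \<open>Difference quotients\<close>

lemma test_functions_translate:
  fixes a :: "real^'n::finite"
  assumes "\<phi> \<in> test_functions UNIV" shows "(\<lambda>x. \<phi> (x + a)) \<in> test_functions UNIV"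
proof (rule test_functionsI[OF smooth_translate[OF test_functionsD(1)[OF assms]]])
  let ?K = "closure {x. \<phi> x \<noteq> 0}"
  show "compact ((\<lambda>x. x - a) ` ?K)"
    using test_functionsD(2)[OF assms] by (intro compact_continuous_image continuous_intros)
  show "\<phi> (x + a) = 0" if "x \<notin> (\<lambda>x. x - a) ` ?K" for x
  proof -
    have "x + a \<notin> ?K"
    proof
      assume "x + a \<in> ?K"
      then have "(x + a) - a \<in> (\<lambda>x. x - a) ` ?K" by blast
      with that show False by simp
    qed
    then show ?thesis by (rule test_functionsD(4)[OF assms])
  qed
qed simp

text \<open>The mean value inequality along the i-th axis; at h = 0 the quotient is 0 by
  convention.\<close>

lemma test_functions_diff_quotient_bound:
  assumes "\<psi> \<in> test_functions UNIV" "\<And>x. \<bar>pderiv_at i \<psi> x\<bar> \<le> B"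
  shows "\<bar>(\<psi> (x + h *\<^sub>R axis i 1) - \<psi> x) / h\<bar> \<le> B"
proof -
  have "\<bar>\<psi> (x + h *\<^sub>R axis i 1) - \<psi> (x + 0 *\<^sub>R axis i 1)\<bar> \<le> B * \<bar>h - 0\<bar>"
    using field_differentiable_bound[of UNIV "\<lambda>t. \<psi> (x + t *\<^sub>R axis i 1)"
      "\<lambda>t. pderiv_at i \<psi> (x + t *\<^sub>R axis i 1)" B h 0]
      has_real_derivative_line[OF smooth_differentiable[OF test_functionsD(1)[OF assms(1)]]] assms(2)
    by simp
  moreover have "B \<ge> 0" using assms(2)[of x] by linarith
  ultimately show ?thesis by (cases "h = 0") (auto simp: field_simps)
qed

lemma diff_quotient_tendsto:
  assumes f: "integrable lebesgue f" and \<psi>: "\<psi> \<in> test_functions UNIV"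
  shows "((\<lambda>h. \<integral>x. f x * ((\<psi> (x + h *\<^sub>R axis i 1) - \<psi> x) / h) \<partial>lebesgue) \<longlongrightarrow>
     (\<integral>x. f x * pderiv_at i \<psi> x \<partial>lebesgue)) (at 0)"
  unfolding tendsto_at_iff_sequentially comp_def
proof (intro allI impI)
  fix X :: "nat \<Rightarrow> real" assume X: "\<forall>n. X n \<in> UNIV - {0}" "X \<longlonglongrightarrow> 0"
  obtain B where B: "\<And>x. \<bar>pderiv_at i \<psi> x\<bar> \<le> B"
    using test_functions_bounded[OF test_functions_pderiv[OF \<psi>]] by blast
  note fm = borel_measurable_integrable[OF f]
  show "(\<lambda>n. \<integral>x. f x * ((\<psi> (x + X n *\<^sub>R axis i 1) - \<psi> x) / X n) \<partial>lebesgue) \<longlonglongrightarrow>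
    (\<integral>x. f x * pderiv_at i \<psi> x \<partial>lebesgue)"
  proof (rule integral_dominated_convergence[where w = "\<lambda>x. B * \<bar>f x\<bar>"])
    show "(\<lambda>x. f x * pderiv_at i \<psi> x) \<in> borel_measurable lebesgue"
      using fm test_functions_measurable[OF test_functions_pderiv[OF \<psi>]] by measurable
    show "(\<lambda>x. f x * ((\<psi> (x + X n *\<^sub>R axis i 1) - \<psi> x) / X n)) \<in> borel_measurable lebesgue" for n
      using fm test_functions_measurable[OF \<psi>] test_functions_measurable[OF test_functions_translate[OF \<psi>]]
      by measurable
    show "AE x in lebesgue. (\<lambda>n. f x * ((\<psi> (x + X n *\<^sub>R axis i 1) - \<psi> x) / X n)) \<longlonglongrightarrow> f x * pderiv_at i \<psi> x"
    proof (rule AE_I2)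
      fix x
      have "((\<lambda>t. \<psi> (x + t *\<^sub>R axis i 1)) has_real_derivative pderiv_at i \<psi> (x + 0 *\<^sub>R axis i 1)) (at 0)"
        by (rule has_real_derivative_line[OF smooth_differentiable[OF test_functionsD(1)[OF \<psi>]]])
      then have "((\<lambda>h. (\<psi> (x + h *\<^sub>R axis i 1) - \<psi> x) / h) \<longlongrightarrow> pderiv_at i \<psi> x) (at 0)"
        by (simp add: DERIV_def)
      then have "(\<lambda>n. (\<psi> (x + X n *\<^sub>R axis i 1) - \<psi> x) / X n) \<longlonglongrightarrow> pderiv_at i \<psi> x"
        using X unfolding tendsto_at_iff_sequentially comp_def by blast
      then show "(\<lambda>n. f x * ((\<psi> (x + X n *\<^sub>R axis i 1) - \<psi> x) / X n)) \<longlonglongrightarrow> f x * pderiv_at i \<psi> x"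
        by (rule tendsto_mult_left)
    qed
    show "AE x in lebesgue. norm (f x * ((\<psi> (x + X n *\<^sub>R axis i 1) - \<psi> x) / X n)) \<le> B * \<bar>f x\<bar>" for n
    proof (rule AE_I2)
      fix x
      have "\<bar>(\<psi> (x + X n *\<^sub>R axis i 1) - \<psi> x) / X n\<bar> * \<bar>f x\<bar> \<le> B * \<bar>f x\<bar>"
        using test_functions_diff_quotient_bound[OF \<psi> B] by (intro mult_right_mono) auto
      then show "norm (f x * ((\<psi> (x + X n *\<^sub>R axis i 1) - \<psi> x) / X n)) \<le> B * \<bar>f x\<bar>"
        by (simp only: real_norm_def abs_mult mult.commute)
    qed
  qed (use f in simp)
qed

text \<open>The derivative falls on \<psi>, so f need only be integrable. The integral becomes a
  differentiable function of the shift t, to which uniqueness of derivatives and the mean value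
  theorem of one variable apply.\<close>

lemma translated_test_integral_deriv:
  fixes f \<psi> :: "real^'n::finite \<Rightarrow> real"
  assumes f: "integrable lebesgue f" and \<psi>: "\<psi> \<in> test_functions UNIV"
  shows "((\<lambda>t. \<integral>x. f x * \<psi> (x + t *\<^sub>R axis i 1) \<partial>lebesgue) has_real_derivative
     (\<integral>x. f x * pderiv_at i \<psi> (x + t *\<^sub>R axis i 1) \<partial>lebesgue)) (at t)"
proof -
  let ?e = "axis i 1 :: real^'n"
  let ?A = "\<lambda>t. \<integral>x. f x * \<psi> (x + t *\<^sub>R ?e) \<partial>lebesgue"
  note T = test_functions_translate[OF \<psi>]
  have int: "integrable lebesgue (\<lambda>x. f x * \<psi> (x + t *\<^sub>R ?e))" for t
  proof -
    obtain B where "\<And>x. \<bar>\<psi> (x + t *\<^sub>R ?e)\<bar> \<le> B" using test_functions_bounded[OF T] by blast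
    then show ?thesis by (intro integrable_mult_bounded[OF f test_functions_measurable[OF T]] AE_I2)
  qed
  have "((\<lambda>h. \<integral>x. f x * ((\<psi> ((x + h *\<^sub>R ?e) + t *\<^sub>R ?e) - \<psi> (x + t *\<^sub>R ?e)) / h) \<partial>lebesgue) \<longlongrightarrow>
     (\<integral>x. f x * pderiv_at i (\<lambda>x. \<psi> (x + t *\<^sub>R ?e)) x \<partial>lebesgue)) (at 0)"
    by (rule diff_quotient_tendsto[OF f T])
  moreover have "pderiv_at i (\<lambda>x. \<psi> (x + t *\<^sub>R ?e)) x = pderiv_at i \<psi> (x + t *\<^sub>R ?e)" for x
    by (rule pderiv_at_translate(2)[OF smooth_differentiable[OF test_functionsD(1)[OF \<psi>]]])
  moreover have "(\<integral>x. f x * ((\<psi> ((x + h *\<^sub>R ?e) + t *\<^sub>R ?e) - \<psi> (x + t *\<^sub>R ?e)) / h) \<partial>lebesgue) =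
     (?A (t + h) - ?A t) / h" for h
  proof -
    have "?A (t + h) - ?A t = (\<integral>x. f x * \<psi> (x + (t + h) *\<^sub>R ?e) - f x * \<psi> (x + t *\<^sub>R ?e) \<partial>lebesgue)"
      using int by (intro Bochner_Integration.integral_diff[symmetric])
    then have "(?A (t + h) - ?A t) / h =
        (\<integral>x. (f x * \<psi> (x + (t + h) *\<^sub>R ?e) - f x * \<psi> (x + t *\<^sub>R ?e)) / h \<partial>lebesgue)" by simp
    also have "\<dots> = (\<integral>x. f x * ((\<psi> ((x + h *\<^sub>R ?e) + t *\<^sub>R ?e) - \<psi> (x + t *\<^sub>R ?e)) / h) \<partial>lebesgue)"
      by (intro Bochner_Integration.integral_cong) (auto simp: algebra_simps)
    finally show ?thesis by (rule sym)
  qed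
  ultimately show ?thesis unfolding DERIV_def by (simp only:)
qed

text \<open>Translation invariance makes the integral of \<psi> (x + t e) constant in t, so its
  derivative at t = 0 vanishes; no iterated integration is involved.\<close>

lemma integral_pderiv_eq_0:
  fixes \<psi> :: "real^'n::finite \<Rightarrow> real"
  assumes \<psi>: "\<psi> \<in> test_functions UNIV"
  shows "(\<integral>x. pderiv_at i \<psi> x \<partial>lebesgue) = 0"
proof -
  let ?e = "axis i 1 :: real^'n"
  let ?S = "closure {x. \<psi> x \<noteq> 0}"
  obtain R where R: "R > 0" "?S \<subseteq> ball 0 R"
    using bounded_subset_ballD[OF compact_imp_bounded[OF test_functionsD(2)[OF \<psi>]], of 0] by auto
  \<comment> \<open>An integrable stand-in for the constant 1: it equals 1 wherever some shift of
    \<psi> by |t| < 1 is nonzero.\<close>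
  let ?f = "indicator (cball 0 (R + 1)) :: real^'n \<Rightarrow> real"
  have f: "integrable lebesgue ?f" by (rule lebesgue_integrable_indicator_compact) simp
  have z: "\<psi> x = 0" "pderiv_at i \<psi> x = 0" if "norm x \<ge> R" for x
  proof -
    have "x \<notin> ?S" using R(2) that by auto
    then show "\<psi> x = 0" "pderiv_at i \<psi> x = 0"
      using test_functionsD(4)[OF \<psi>] pderiv_at_zero_outside by blast+
  qed
  have A: "(\<integral>x. ?f x * \<psi> (x + t *\<^sub>R ?e) \<partial>lebesgue) = (\<integral>x. \<psi> x \<partial>lebesgue)" if "\<bar>t\<bar> < 1" for t
  proof -
    have "?f x * \<psi> (x + t *\<^sub>R ?e) = \<psi> (x + t *\<^sub>R ?e)" for x
    proof (cases "norm x \<le> R + 1")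
      case False
      have "norm x - norm (t *\<^sub>R ?e) \<le> norm (x + t *\<^sub>R ?e)" using norm_diff_ineq[of x "t *\<^sub>R ?e"] by simp
      then have "norm (x + t *\<^sub>R ?e) \<ge> R" using False that by (simp add: norm_axis_1)
      from z(1)[OF this] show ?thesis by simp
    qed simp
    then have "(\<integral>x. ?f x * \<psi> (x + t *\<^sub>R ?e) \<partial>lebesgue) = (\<integral>x. \<psi> (x + t *\<^sub>R ?e) \<partial>lebesgue)" by (simp only:)
    then show ?thesis using integral_translate[OF test_functions_integrable[OF \<psi>]] by simp
  qed
  have "((\<lambda>t. \<integral>x. ?f x * \<psi> (x + t *\<^sub>R ?e) \<partial>lebesgue) has_real_derivative
     (\<integral>x. ?f x * pderiv_at i \<psi> (x + 0 *\<^sub>R ?e) \<partial>lebesgue)) (at 0)"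
    by (rule translated_test_integral_deriv[OF f \<psi>])
  moreover have "((\<lambda>t. \<integral>x. ?f x * \<psi> (x + t *\<^sub>R ?e) \<partial>lebesgue) has_real_derivative 0) (at 0)"
  proof (rule DERIV_cong_ev[OF refl _ refl, THEN iffD2])
    show "\<forall>\<^sub>F t in nhds 0. (\<integral>x. ?f x * \<psi> (x + t *\<^sub>R ?e) \<partial>lebesgue) = (\<integral>x. \<psi> x \<partial>lebesgue)"
      using eventually_nhds_in_open[of "{-1<..<1::real}" 0] by (auto elim!: eventually_mono intro: A)
  qed simp
  ultimately have "(\<integral>x. ?f x * pderiv_at i \<psi> (x + 0 *\<^sub>R ?e) \<partial>lebesgue) = 0" by (rule DERIV_unique)
  moreover have "?f x * pderiv_at i \<psi> (x + 0 *\<^sub>R ?e) = pderiv_at i \<psi> x" for x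
    using z(2)[of x] by (cases "norm x \<ge> R") (auto simp: indicator_def)
  ultimately show ?thesis by (simp only:)
qed

text \<open>Paired with \<psi>, the difference quotient of W becomes one of the integral of W(x)
  \<psi>(x + t e) as a function of t. The mean value theorem turns it into a weak derivative at one
  intermediate shift \<xi>, hence into G shifted by \<xi>. Since \<xi> depends on \<psi>, the
  modulus c is required for all shifts below h; duality then gives the L^1 bound.\<close>

lemma diff_quotient_L1_bound:
  fixes W G :: "real^'n::finite \<Rightarrow> real"
  assumes W: "integrable lebesgue W" and G: "integrable lebesgue G" and U: "open U"
    and weak: "\<And>\<psi> t. \<psi> \<in> test_functions U \<Longrightarrow> 0 < t \<Longrightarrow> t < h \<Longrightarrow>
       (\<integral>x. W x * pderiv_at i \<psi> (x + t *\<^sub>R axis i 1) \<partial>lebesgue) = - (\<integral>x. G x * \<psi> (x + t *\<^sub>R axis i 1) \<partial>lebesgue)"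
    and h: "0 < h"
    and mod: "\<And>t. 0 < t \<Longrightarrow> t < h \<Longrightarrow> (\<integral>x. \<bar>G (x + (- t) *\<^sub>R axis i 1) - G x\<bar> \<partial>lebesgue) \<le> c"
  shows "(\<integral>x. indicator U x * \<bar>(W x - W (x + (- h) *\<^sub>R axis i 1)) / h - G x\<bar> \<partial>lebesgue) \<le> c"
proof (rule L1_bound_by_duality[OF U])
  let ?e = "axis i 1 :: real^'n"
  show "integrable lebesgue (\<lambda>x. (W x - W (x + (- h) *\<^sub>R ?e)) / h - G x)"
    by (intro Bochner_Integration.integrable_diff integrable_divide_zero impI W G integrable_translate[OF W])
  fix \<psi> assume \<psi>U: "\<psi> \<in> test_functions U" and b: "\<And>x. \<bar>\<psi> x\<bar> \<le> 1"
  have \<psi>: "\<psi> \<in> test_functions UNIV" using \<psi>U test_functions_mono by blast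
  note T = test_functions_translate[OF \<psi>]
  have int: "integrable lebesgue (\<lambda>x. F x * \<psi> (x + a))" if "integrable lebesgue F" for F a
    using b by (intro integrable_mult_bounded[OF that test_functions_measurable[OF T]] AE_I2)
  have shift: "(\<integral>x. F (x - a) * \<psi> x \<partial>lebesgue) = (\<integral>x. F x * \<psi> (x + a) \<partial>lebesgue)"
    if "integrable lebesgue F" for F a
    using integral_translate[OF int[OF that, of a], of "- a"] by simp
  let ?A = "\<lambda>t. \<integral>x. W x * \<psi> (x + t *\<^sub>R ?e) \<partial>lebesgue"
  obtain \<xi> where \<xi>: "0 < \<xi>" "\<xi> < h" "?A h - ?A 0 = (h - 0) * (\<integral>x. W x * pderiv_at i \<psi> (x + \<xi> *\<^sub>R ?e) \<partial>lebesgue)"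
    using MVT2[OF h translated_test_integral_deriv[OF W \<psi>]] by blast
  have "(\<integral>x. ((W x - W (x + (- h) *\<^sub>R ?e)) / h - G x) * \<psi> x \<partial>lebesgue) =
     (\<integral>x. (W x * \<psi> x - W (x - h *\<^sub>R ?e) * \<psi> x) / h - G x * \<psi> x \<partial>lebesgue)"
    by (intro Bochner_Integration.integral_cong) (auto simp: algebra_simps diff_divide_distrib)
  also have "\<dots> = (?A 0 - ?A h) / h - (\<integral>x. G x * \<psi> x \<partial>lebesgue)"
  proof -
    have i: "integrable lebesgue (\<lambda>x. W x * \<psi> x)" "integrable lebesgue (\<lambda>x. G x * \<psi> x)"
      using int[OF W, of 0] int[OF G, of 0] by simp_all
    have "integrable lebesgue (\<lambda>x. W (x - h *\<^sub>R ?e) * \<psi> x)"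
      using integrable_translate[OF int[OF W, of "h *\<^sub>R ?e"], of "- h *\<^sub>R ?e"] by simp
    with i show ?thesis using shift[OF W, of "h *\<^sub>R ?e"] by simp
  qed
  also have "\<dots> = (\<integral>x. G x * \<psi> (x + \<xi> *\<^sub>R ?e) \<partial>lebesgue) - (\<integral>x. G x * \<psi> x \<partial>lebesgue)"
    using \<xi>(3) weak[OF \<psi>U \<xi>(1,2)] h by (simp add: field_simps)
  also have "\<dots> = (\<integral>x. (G (x + (- \<xi>) *\<^sub>R ?e) - G x) * \<psi> x \<partial>lebesgue)"
  proof -
    have "integrable lebesgue (\<lambda>x. G x * \<psi> x)" using int[OF G, of 0] by simp
    moreover have "integrable lebesgue (\<lambda>x. G (x - \<xi> *\<^sub>R ?e) * \<psi> x)"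
      using integrable_translate[OF int[OF G, of "\<xi> *\<^sub>R ?e"], of "- \<xi> *\<^sub>R ?e"] by simp
    ultimately show ?thesis using shift[OF G, of "\<xi> *\<^sub>R ?e"] by (simp add: left_diff_distrib)
  qed
  finally have "\<bar>\<integral>x. ((W x - W (x + (- h) *\<^sub>R ?e)) / h - G x) * \<psi> x \<partial>lebesgue\<bar> \<le>
     (\<integral>x. \<bar>(G (x + (- \<xi>) *\<^sub>R ?e) - G x) * \<psi> x\<bar> \<partial>lebesgue)"
    using integral_abs_bound by metis
  also have "\<dots> \<le> (\<integral>x. \<bar>G (x + (- \<xi>) *\<^sub>R ?e) - G x\<bar> \<partial>lebesgue)"
  proof (rule integral_mono)
    show "integrable lebesgue (\<lambda>x. \<bar>(G (x + (- \<xi>) *\<^sub>R ?e) - G x) * \<psi> x\<bar>)"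
      using int[of "\<lambda>x. G (x + (- \<xi>) *\<^sub>R ?e) - G x" 0] integrable_translate[OF G, of "(- \<xi>) *\<^sub>R ?e"] G by simp
    show "integrable lebesgue (\<lambda>x. \<bar>G (x + (- \<xi>) *\<^sub>R ?e) - G x\<bar>)"
      using integrable_translate[OF G, of "(- \<xi>) *\<^sub>R ?e"] G by simp
    show "\<bar>(G (x + (- \<xi>) *\<^sub>R ?e) - G x) * \<psi> x\<bar> \<le> \<bar>G (x + (- \<xi>) *\<^sub>R ?e) - G x\<bar>" for x
      using b[of x] by (simp add: abs_mult mult_left_le)
  qed
  also have "\<dots> \<le> c" using mod[OF \<xi>(1,2)] .
  finally show "\<bar>\<integral>x. ((W x - W (x + (- h) *\<^sub>R ?e)) / h - G x) * \<psi> x \<partial>lebesgue\<bar> \<le> c" .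
qed

section \<open>Weak derivatives\<close>

lemma lebesgue_on_real:
  fixes f :: "'a::euclidean_space \<Rightarrow> real"
  assumes "S \<in> sets lebesgue"
  shows integral_lebesgue_on: "(\<integral>x. f x \<partial>lebesgue_on S) = (\<integral>x. indicator S x * f x \<partial>lebesgue)"
    and integrable_lebesgue_on: "integrable (lebesgue_on S) f \<longleftrightarrow> integrable lebesgue (\<lambda>x. indicator S x * f x)"
  using integral_restrict_space[of S lebesgue f] integrable_restrict_space[of S lebesgue f] assms by simp_all

lemma locally_integrableD:
  fixes u :: "'a::euclidean_space \<Rightarrow> real"
  assumes "locally_integrable \<Omega> u" "compact K" "K \<subseteq> \<Omega>"
  shows "integrable (lebesgue_on K) u" "integrable lebesgue (\<lambda>x. indicator K x * u x)"
proof -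
  show "integrable (lebesgue_on K) u" using assms unfolding locally_integrable_def by blast
  then show "integrable lebesgue (\<lambda>x. indicator K x * u x)"
    using integrable_lebesgue_on lmeasurable_compact[OF assms(2)] by blast
qed

text \<open>Cutting u off to K does not change the pairing. With K compact this turns a locally
  integrable u into an integrable function on the whole space, where translations act.\<close>

lemma integral_lebesgue_on_test:
  fixes u \<phi> :: "'a::euclidean_space \<Rightarrow> real"
  assumes "\<Omega> \<in> sets lebesgue" "K \<subseteq> \<Omega>" "\<And>x. x \<notin> K \<Longrightarrow> \<phi> x = 0"
  shows "(\<integral>x. u x * \<phi> x \<partial>lebesgue_on \<Omega>) = (\<integral>x. (indicator K x * u x) * \<phi> x \<partial>lebesgue)"
proof -
  have "indicator \<Omega> x * (u x * \<phi> x) = (indicator K x * u x) * \<phi> x" for x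
    using assms(2,3) by (cases "x \<in> K") auto
  then show ?thesis unfolding integral_lebesgue_on[OF assms(1)] by (simp only:)
qed

lemma open_countable_cover_precompact:
  fixes \<Omega> :: "'a::euclidean_space set"
  assumes "open \<Omega>"
  obtains F where "countable F" "\<Union>F = \<Omega>"
    "\<And>B. B \<in> F \<Longrightarrow> open B \<and> compact (closure B) \<and> closure B \<subseteq> \<Omega>"
proof -
  let ?F = "{ball x r |x r. r > 0 \<and> cball x r \<subseteq> \<Omega>}"
  obtain F where F: "F \<subseteq> ?F" "countable F" "\<Union>F = \<Union>?F"
    using Lindelof[of ?F] by auto
  have "\<Union>?F = \<Omega>"
  proof
    show "\<Union>?F \<subseteq> \<Omega>" using ball_subset_cball by blast
    show "\<Omega> \<subseteq> \<Union>?F"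
    proof
      fix x assume "x \<in> \<Omega>"
      then obtain r where "r > 0" "cball x r \<subseteq> \<Omega>" using assms open_contains_cball by blast
      then show "x \<in> \<Union>?F" by (intro UnionI[of "ball x r"]) auto
    qed
  qed
  moreover have "open B \<and> compact (closure B) \<and> closure B \<subseteq> \<Omega>" if BF: "B \<in> F" for B
  proof -
    obtain x r where "B = ball x r" "r > 0" "cball x r \<subseteq> \<Omega>" using BF F(1) by blast
    then show ?thesis by simp
  qed
  ultimately show thesis using that F(2,3) by metis
qed

lemma AE_lebesgue_on_open:
  fixes \<Omega> :: "'a::euclidean_space set"
  assumes "open \<Omega>"
    and P: "\<And>B. open B \<Longrightarrow> compact (closure B) \<Longrightarrow> closure B \<subseteq> \<Omega> \<Longrightarrow> AE x in lebesgue. x \<in> B \<longrightarrow> P x"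
  shows "AE x in lebesgue_on \<Omega>. P x"
proof -
  obtain F where F: "countable F" "\<Union>F = \<Omega>" "\<And>B. B \<in> F \<Longrightarrow> open B \<and> compact (closure B) \<and> closure B \<subseteq> \<Omega>"
    using open_countable_cover_precompact[OF assms(1)] by blast
  have "AE x in lebesgue. \<forall>B\<in>F. x \<in> B \<longrightarrow> P x"
    using F(1,3) P by (subst AE_ball_countable) auto
  then have "AE x in lebesgue. x \<in> \<Omega> \<longrightarrow> P x" by eventually_elim (use F(2) in blast)
  then show ?thesis using assms(1) by (subst AE_restrict_space_iff) auto
qed

text \<open>Local integrability speaks of compact subsets only; countably many compact pieces cover
  \<Omega>, and measurability is glued together from them.\<close>

lemma locally_integrable_measurable:
  fixes u :: "'a::euclidean_space \<Rightarrow> real"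
  assumes "open \<Omega>" "locally_integrable \<Omega> u"
  shows "u \<in> borel_measurable (lebesgue_on \<Omega>)"
proof -
  obtain F where F: "countable F" "\<Union>F = \<Omega>" "\<And>B. B \<in> F \<Longrightarrow> open B \<and> compact (closure B) \<and> closure B \<subseteq> \<Omega>"
    using open_countable_cover_precompact[OF assms(1)] by blast
  show ?thesis
  proof (rule measurable_piecewise_restrict)
    show "countable (closure ` F)" using F(1) by simp
    show "space (lebesgue_on \<Omega>) \<subseteq> \<Union> (closure ` F)"
      using F(2) closure_subset by fastforce
    fix C assume "C \<in> closure ` F"
    then have C: "compact C" "C \<subseteq> \<Omega>" using F(3) by auto
    have "C \<in> sets lebesgue" using C(1) lmeasurable_compact by blast
    then show "C \<inter> space (lebesgue_on \<Omega>) \<in> sets (lebesgue_on \<Omega>)"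
      using assms(1) C(2) by (auto simp: sets_restrict_space_iff)
    have "restrict_space (lebesgue_on \<Omega>) C = lebesgue_on C"
      using assms(1) C(2) by (subst restrict_restrict_space) (auto simp: Int_absorb1 Int_absorb2 \<open>C \<in> sets lebesgue\<close>)
    then show "u \<in> borel_measurable (restrict_space (lebesgue_on \<Omega>) C)"
      using borel_measurable_integrable[OF locally_integrableD(1)[OF assms(2) C]] by simp
  qed
qed

lemma integrable_imp_locally_integrable:
  fixes u :: "'a::euclidean_space \<Rightarrow> real"
  assumes "\<Omega> \<in> sets lebesgue" "integrable (lebesgue_on \<Omega>) u"
  shows "locally_integrable \<Omega> u"
  unfolding locally_integrable_def
proof (intro allI impI, elim conjE)
  fix K assume K: "compact K" "K \<subseteq> \<Omega>"
  have KL: "K \<in> sets lebesgue" using K(1) lmeasurable_compact by blast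
  have "integrable lebesgue (\<lambda>x. (indicator \<Omega> x * u x) * indicator K x)"
    by (rule integrable_mult_bounded[OF integrable_lebesgue_on[THEN iffD1, OF assms] borel_measurable_indicator[OF KL], of 1]) simp
  moreover have "(indicator \<Omega> x * u x) * indicator K x = indicator K x * u x" for x
    using K(2) by (auto simp: indicator_def)
  ultimately show "integrable (lebesgue_on K) u" by (simp add: integrable_lebesgue_on[OF KL])
qed

lemma locally_integrable_diff:
  assumes "locally_integrable \<Omega> u" "locally_integrable \<Omega> v"
  shows "locally_integrable \<Omega> (\<lambda>x. u x - v x)"
  using assms unfolding locally_integrable_def by auto

lemma locally_integrable_cong_AE:
  fixes u v :: "'a::euclidean_space \<Rightarrow> real"
  assumes "open \<Omega>" "locally_integrable \<Omega> u" "AE x in lebesgue_on \<Omega>. u x = v x" "v \<in> borel_measurable (lebesgue_on \<Omega>)"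
  shows "locally_integrable \<Omega> v"
  unfolding locally_integrable_def
proof (intro allI impI, elim conjE)
  fix K assume K: "compact K" "K \<subseteq> \<Omega>"
  have KL: "K \<in> sets lebesgue" using K(1) lmeasurable_compact by blast
  have OL: "\<Omega> \<in> sets lebesgue" using assms(1) by simp
  have "AE x in lebesgue. x \<in> \<Omega> \<longrightarrow> u x = v x"
    using assms(3) OL by (simp add: AE_restrict_space_iff)
  then have "AE x in lebesgue. x \<in> K \<longrightarrow> u x = v x" by eventually_elim (use K(2) in auto)
  then have "AE x in lebesgue_on K. u x = v x" using KL by (simp add: AE_restrict_space_iff)
  moreover have "v \<in> borel_measurable (lebesgue_on K)"
    using measurable_restrict_mono[OF assms(4) K(2)] .
  moreover have "integrable (lebesgue_on K) u" using locally_integrableD(1)[OF assms(2) K] .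
  ultimately show "integrable (lebesgue_on K) v" using integrable_cong_AE_imp by force
qed

lemma has_weak_deriv_cong_AE:
  assumes "open \<Omega>" "has_weak_deriv \<Omega> i u g"
    and u: "AE x in lebesgue_on \<Omega>. u x = v x" "v \<in> borel_measurable (lebesgue_on \<Omega>)"
    and g: "AE x in lebesgue_on \<Omega>. g x = h x" "h \<in> borel_measurable (lebesgue_on \<Omega>)"
  shows "has_weak_deriv \<Omega> i v h"
proof -
  note w = assms(2)[unfolded has_weak_deriv_def]
  have um: "u \<in> borel_measurable (lebesgue_on \<Omega>)" "g \<in> borel_measurable (lebesgue_on \<Omega>)"
    using locally_integrable_measurable[OF assms(1)] w by auto
  show ?thesis
    unfolding has_weak_deriv_def
  proof (intro conjI ballI)
    show "locally_integrable \<Omega> v" "locally_integrable \<Omega> h"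
      using locally_integrable_cong_AE[OF assms(1)] w u g by blast+
    fix \<phi> assume \<phi>: "\<phi> \<in> test_functions \<Omega>"
    have m: "\<phi> \<in> borel_measurable (lebesgue_on \<Omega>)" "pderiv_at i \<phi> \<in> borel_measurable (lebesgue_on \<Omega>)"
      using test_functions_measurable[OF \<phi>] test_functions_measurable[OF test_functions_pderiv[OF \<phi>]]
      by (auto intro: measurable_restrict_space1)
    have "(\<integral>x. v x * pderiv_at i \<phi> x \<partial>lebesgue_on \<Omega>) = (\<integral>x. u x * pderiv_at i \<phi> x \<partial>lebesgue_on \<Omega>)"
      using u um m by (intro integral_cong_AE) auto
    also have "\<dots> = - (\<integral>x. g x * \<phi> x \<partial>lebesgue_on \<Omega>)" using w \<phi> by blast
    also have "(\<integral>x. g x * \<phi> x \<partial>lebesgue_on \<Omega>) = (\<integral>x. h x * \<phi> x \<partial>lebesgue_on \<Omega>)"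
      using g um m by (intro integral_cong_AE) auto
    finally show "(\<integral>x. v x * pderiv_at i \<phi> x \<partial>lebesgue_on \<Omega>) = - (\<integral>x. h x * \<phi> x \<partial>lebesgue_on \<Omega>)" .
  qed
qed

text \<open>On an open B with compact closure in \<Omega>, f cut off to that closure is globally
  integrable and the duality bound holds with constant 0. Countably many such sets cover
  \<Omega>.\<close>

lemma du_Bois_Reymond:
  assumes "open \<Omega>" "locally_integrable \<Omega> f"
    and zero: "\<And>\<phi>. \<phi> \<in> test_functions \<Omega> \<Longrightarrow> (\<integral>x. f x * \<phi> x \<partial>lebesgue_on \<Omega>) = 0"
  shows "AE x in lebesgue_on \<Omega>. f x = 0"
proof (rule AE_lebesgue_on_open[OF assms(1)])
  fix B assume B: "open B" "compact (closure B)" "closure B \<subseteq> \<Omega>"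
  let ?f = "\<lambda>x. indicator (closure B) x * f x"
  have int: "integrable lebesgue ?f" by (rule locally_integrableD(2)[OF assms(2) B(2,3)])
  have "(\<integral>x. \<bar>?f x\<bar> * indicator B x \<partial>lebesgue) \<le> 0"
  proof (subst mult.commute, rule L1_bound_by_duality[OF B(1) int])
    fix \<psi> assume \<psi>: "\<psi> \<in> test_functions B"
    have "B \<subseteq> \<Omega>" using B(3) closure_subset by blast
    then have "(\<integral>x. f x * \<psi> x \<partial>lebesgue_on \<Omega>) = 0" using zero test_functions_mono \<psi> by blast
    moreover have "(\<integral>x. f x * \<psi> x \<partial>lebesgue_on \<Omega>) = (\<integral>x. ?f x * \<psi> x \<partial>lebesgue)"
      using test_functions_zero[OF \<psi>] closure_subset[of B] assms(1) B(3)
      by (intro integral_lebesgue_on_test) auto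
    ultimately show "\<bar>\<integral>x. ?f x * \<psi> x \<partial>lebesgue\<bar> \<le> 0" by simp
  qed
  moreover have i: "integrable lebesgue (\<lambda>x. \<bar>?f x\<bar> * indicator B x)"
    by (rule integrable_mult_bounded[OF integrable_abs[OF int] borel_measurable_indicator, of _ 1]) (use B(1) in auto)
  moreover have "(\<integral>x. \<bar>?f x\<bar> * indicator B x \<partial>lebesgue) \<ge> 0" by (intro Bochner_Integration.integral_nonneg) auto
  ultimately have "(\<integral>x. \<bar>?f x\<bar> * indicator B x \<partial>lebesgue) = 0" by linarith
  then have "AE x in lebesgue. \<bar>?f x\<bar> * indicator B x = 0"
    using integral_nonneg_eq_0_iff_AE[OF i] by simp
  then show "AE x in lebesgue. x \<in> B \<longrightarrow> f x = 0"
  proof eventually_elim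
    case (elim x)
    then show ?case using closure_subset[of B] by (auto simp: indicator_def split: if_splits)
  qed
qed

lemma integrable_test_mult:
  assumes "open \<Omega>" "locally_integrable \<Omega> u" "\<phi> \<in> test_functions \<Omega>"
  shows "integrable (lebesgue_on \<Omega>) (\<lambda>x. u x * \<phi> x)"
proof -
  let ?K = "closure {x. \<phi> x \<noteq> 0}"
  obtain B where "\<And>x. \<bar>\<phi> x\<bar> \<le> B" using test_functions_bounded[OF assms(3)] by blast
  then have "integrable lebesgue (\<lambda>x. (indicator ?K x * u x) * \<phi> x)"
    by (intro integrable_mult_bounded[OF locally_integrableD(2)[OF assms(2) test_functionsD(2,3)[OF assms(3)]]
        test_functions_measurable[OF assms(3)]] AE_I2)
  moreover have "(indicator ?K x * u x) * \<phi> x = indicator \<Omega> x * (u x * \<phi> x)" for x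
  proof (cases "x \<in> ?K")
    case True
    then show ?thesis using test_functionsD(3)[OF assms(3)] by auto
  next
    case False
    then have "\<phi> x = 0" by (rule test_functionsD(4)[OF assms(3)])
    then show ?thesis by (simp only: mult_zero_right)
  qed
  ultimately have "integrable lebesgue (\<lambda>x. indicator \<Omega> x * (u x * \<phi> x))" by (simp only:)
  then show ?thesis using assms(1) by (simp add: integrable_lebesgue_on)
qed

lemma has_weak_deriv_unique:
  assumes "open \<Omega>" "has_weak_deriv \<Omega> i u g" "has_weak_deriv \<Omega> i u h"
  shows "AE x in lebesgue_on \<Omega>. g x = h x"
proof -
  note g = assms(2)[unfolded has_weak_deriv_def] and h = assms(3)[unfolded has_weak_deriv_def]
  have "AE x in lebesgue_on \<Omega>. g x - h x = 0"
  proof (rule du_Bois_Reymond[OF assms(1) locally_integrable_diff])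
    fix \<phi> assume \<phi>: "\<phi> \<in> test_functions \<Omega>"
    have "integrable (lebesgue_on \<Omega>) (\<lambda>x. g x * \<phi> x)" "integrable (lebesgue_on \<Omega>) (\<lambda>x. h x * \<phi> x)"
      using integrable_test_mult[OF assms(1) _ \<phi>] g h by blast+
    moreover have "(\<integral>x. g x * \<phi> x \<partial>lebesgue_on \<Omega>) = (\<integral>x. h x * \<phi> x \<partial>lebesgue_on \<Omega>)"
      using g h \<phi> by force
    ultimately show "(\<integral>x. (g x - h x) * \<phi> x \<partial>lebesgue_on \<Omega>) = 0" by (simp add: left_diff_distrib)
  qed (use g h in auto)
  then show ?thesis by simp
qed

lemma has_weak_deriv_weak_deriv:
  "has_weak_deriv \<Omega> i u g \<Longrightarrow> has_weak_deriv \<Omega> i u (weak_deriv \<Omega> i u)"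
  using someI[of "has_weak_deriv \<Omega> i u" g] by (simp add: weak_deriv_def)

lemma weak_deriv_AE_eq:
  "open \<Omega> \<Longrightarrow> has_weak_deriv \<Omega> i u g \<Longrightarrow> AE x in lebesgue_on \<Omega>. weak_deriv \<Omega> i u x = g x"
  using has_weak_deriv_unique has_weak_deriv_weak_deriv by blast

lemma continuous_locally_integrable:
  fixes u :: "'a::euclidean_space \<Rightarrow> real"
  assumes "continuous_on UNIV u" shows "locally_integrable \<Omega> u"
  unfolding locally_integrable_def
proof (intro allI impI, elim conjE)
  fix K :: "'a set" assume K: "compact K"
  have KL: "K \<in> sets lebesgue" using K(1) lmeasurable_compact by blast
  have "integrable lborel (\<lambda>x. indicator K x *\<^sub>R u x)"
    by (rule borel_integrable_compact[OF K continuous_on_subset[OF assms subset_UNIV]])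
  then have "integrable lebesgue (\<lambda>x. indicator K x * u x)"
    using integrable_completion[of "\<lambda>x. indicator K x *\<^sub>R u x" lborel] borel_measurable_integrable by force
  then show "integrable (lebesgue_on K) u" by (simp add: integrable_lebesgue_on[OF KL])
qed

text \<open>The product rule for f \<phi>, a test function whose partial derivative integrates to
  0.\<close>

lemma smooth_has_weak_deriv:
  assumes "open \<Omega>" "smooth f"
  shows "has_weak_deriv \<Omega> i f (pderiv_at i f)"
  unfolding has_weak_deriv_def
proof (intro conjI ballI)
  show li: "locally_integrable \<Omega> f" "locally_integrable \<Omega> (pderiv_at i f)"
    using assms(2) by (auto intro!: continuous_locally_integrable smooth_continuous smooth_pderiv)
  fix \<phi> assume \<phi>: "\<phi> \<in> test_functions \<Omega>"
  let ?K = "closure {x. \<phi> x \<noteq> 0}"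
  have \<psi>: "(\<lambda>x. f x * \<phi> x) \<in> test_functions UNIV"
    using test_functions_mult[OF \<phi> assms(2)] test_functions_mono by blast
  have p: "pderiv_at i (\<lambda>x. f x * \<phi> x) x = f x * pderiv_at i \<phi> x + pderiv_at i f x * \<phi> x" for x
    by (intro pderiv_at_mult smooth_differentiable assms(2) test_functionsD(1)[OF \<phi>])
  have z: "pderiv_at i (\<lambda>x. f x * \<phi> x) x = 0" if "x \<notin> \<Omega>" for x
  proof -
    have "x \<notin> ?K" using test_functionsD(3)[OF \<phi>] that by blast
    then have "\<phi> x = 0" "pderiv_at i \<phi> x = 0"
      using pderiv_at_zero_outside test_functionsD(4)[OF \<phi>] by blast+
    then show ?thesis unfolding p by simp
  qed
  have "(\<integral>x. 1 * pderiv_at i (\<lambda>x. f x * \<phi> x) x \<partial>lebesgue_on \<Omega>) =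
     (\<integral>x. (indicator \<Omega> x * 1) * pderiv_at i (\<lambda>x. f x * \<phi> x) x \<partial>lebesgue)"
    using assms(1) z by (intro integral_lebesgue_on_test) auto
  also have "\<dots> = (\<integral>x. pderiv_at i (\<lambda>x. f x * \<phi> x) x \<partial>lebesgue)"
    using z by (intro Bochner_Integration.integral_cong) (auto simp: indicator_def)
  also have "\<dots> = 0" by (rule integral_pderiv_eq_0[OF \<psi>])
  finally have "(\<integral>x. f x * pderiv_at i \<phi> x + pderiv_at i f x * \<phi> x \<partial>lebesgue_on \<Omega>) = 0"
    unfolding p by simp
  moreover have "integrable (lebesgue_on \<Omega>) (\<lambda>x. f x * pderiv_at i \<phi> x)"
      "integrable (lebesgue_on \<Omega>) (\<lambda>x. pderiv_at i f x * \<phi> x)"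
    using integrable_test_mult[OF assms(1)] li \<phi> test_functions_pderiv by blast+
  ultimately show "(\<integral>x. f x * pderiv_at i \<phi> x \<partial>lebesgue_on \<Omega>) = - (\<integral>x. pderiv_at i f x * \<phi> x \<partial>lebesgue_on \<Omega>)"
    by simp
qed

section \<open>The chain rule\<close>

lemma borel_measurable_compose_continuous:
  fixes f :: "'a \<Rightarrow> real" and S :: "real \<Rightarrow> real"
  assumes "continuous_on UNIV S" "f \<in> borel_measurable M"
  shows "(\<lambda>x. S (f x)) \<in> borel_measurable M"
  using measurable_compose[OF assms(2) borel_measurable_continuous_onI[OF assms(1)]] .

lemma Lipschitz_of_bounded_deriv:
  fixes S :: "real \<Rightarrow> real"
  assumes "\<And>t. (S has_real_derivative S' t) (at t)" "\<And>t. \<bar>S' t\<bar> \<le> B"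
  shows "\<bar>S a - S b\<bar> \<le> B * \<bar>a - b\<bar>"
  using field_differentiable_bound[of UNIV S S' B a b] assms by simp

text \<open>Differentiating along the line b + \<tau> * G also covers G = 0, where h * G could not
  serve as the increment of a difference quotient.\<close>

lemma deriv_scaled_sequence:
  fixes S :: "real \<Rightarrow> real"
  assumes S: "(S has_real_derivative D) (at b)" and h: "\<And>n. h n \<noteq> 0" "h \<longlonglongrightarrow> 0"
  shows "(\<lambda>n. (S b - S (b - h n * G)) / h n) \<longlonglongrightarrow> D * G"
proof -
  have "((\<lambda>\<tau>. b + \<tau> * G) has_real_derivative G) (at 0)"
    by (auto intro!: derivative_eq_intros)
  then have "((\<lambda>\<tau>. S (b + \<tau> * G)) has_real_derivative D * G) (at 0)"
    using DERIV_chain2[of S D "\<lambda>\<tau>. b + \<tau> * G" 0 G UNIV] S by simp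
  then have "((\<lambda>\<tau>. (S (b + \<tau> * G) - S b) / \<tau>) \<longlongrightarrow> D * G) (at 0)" by (simp add: DERIV_def)
  moreover have "(\<lambda>n. - h n) \<longlonglongrightarrow> 0" using tendsto_minus[OF h(2)] by simp
  moreover have "\<forall>n. - h n \<in> UNIV - {0}" using h(1) by simp
  ultimately have "(\<lambda>n. (S (b + (- h n) * G) - S b) / (- h n)) \<longlonglongrightarrow> D * G"
    unfolding tendsto_at_iff_sequentially comp_def by (elim allE[of _ "\<lambda>n. - h n"]) simp
  moreover have "(S (b + (- h n) * G) - S b) / (- h n) = (S b - S (b - h n * G)) / h n" for n
    by (simp add: diff_divide_distrib)
  ultimately show ?thesis by (simp only:)
qed

text \<open>A translation moves the difference quotient from \<psi> to S(W). If D is the difference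
  quotient of W with step h, then W(x - h e) = W - h D, and replacing D by G costs at most B h |D -
  G| by the Lipschitz bound; division by h leaves the L^1 distance of D and G, which tends to 0.
  With G in place, the quotients of S converge pointwise under an integrable bound, so no almost
  everywhere convergent subsequence of D is needed.\<close>

lemma has_weak_deriv_compose:
  fixes \<Omega> :: "(real^'n::finite) set" and S S' :: "real \<Rightarrow> real"
  assumes \<Omega>: "open \<Omega>" and w: "has_weak_deriv \<Omega> i w g" and S0: "S 0 = 0"
    and S: "\<And>t. (S has_real_derivative S' t) (at t)" and S'c: "continuous_on UNIV S'"
    and S'b: "\<And>t. \<bar>S' t\<bar> \<le> B"
  shows "has_weak_deriv \<Omega> i (\<lambda>x. S (w x)) (\<lambda>x. S' (w x) * g x)"
  unfolding has_weak_deriv_def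
proof (intro conjI ballI)
  note wd = w[unfolded has_weak_deriv_def]
  note Lip = Lipschitz_of_bounded_deriv[of S S', OF S S'b]
  have B0: "B \<ge> 0" using S'b[of 0] by linarith
  have Sc: "continuous_on UNIV S" by (rule deriv_imp_continuous_on_UNIV[OF S])
  show "locally_integrable \<Omega> (\<lambda>x. S (w x))"
    unfolding locally_integrable_def
  proof (intro allI impI, elim conjE)
    fix K assume K: "compact K" "K \<subseteq> \<Omega>"
    have i: "integrable (lebesgue_on K) w" using locally_integrableD(1)[OF _ K] wd by blast
    show "integrable (lebesgue_on K) (\<lambda>x. S (w x))"
    proof (rule Bochner_Integration.integrable_bound)
      show "integrable (lebesgue_on K) (\<lambda>x. B * w x)" using i by simp
      show "AE x in lebesgue_on K. norm (S (w x)) \<le> norm (B * w x)"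
        using Lip[of _ 0] S0 B0 by (intro AE_I2) (simp add: abs_mult)
    qed (rule borel_measurable_compose_continuous[OF Sc borel_measurable_integrable[OF i]])
  qed
  show "locally_integrable \<Omega> (\<lambda>x. S' (w x) * g x)"
    unfolding locally_integrable_def
  proof (intro allI impI, elim conjE)
    fix K assume K: "compact K" "K \<subseteq> \<Omega>"
    have i: "integrable (lebesgue_on K) w" "integrable (lebesgue_on K) g"
      using locally_integrableD(1)[OF _ K] wd by blast+
    have "integrable (lebesgue_on K) (\<lambda>x. g x * S' (w x))"
      using S'b by (intro integrable_mult_bounded[OF i(2) borel_measurable_compose_continuous[OF S'c
            borel_measurable_integrable[OF i(1)]]] AE_I2)
    then show "integrable (lebesgue_on K) (\<lambda>x. S' (w x) * g x)" by (simp add: mult.commute)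
  qed
  fix \<psi> assume \<psi>: "\<psi> \<in> test_functions \<Omega>"
  have \<psi>U: "\<psi> \<in> test_functions UNIV" using \<psi> test_functions_mono by blast
  let ?e = "axis i 1 :: real^'n"
  define K0 where "K0 = closure {x. \<psi> x \<noteq> 0}"
  have K0: "compact K0" "K0 \<subseteq> \<Omega>" unfolding K0_def by (rule test_functionsD(2,3)[OF \<psi>])+
  obtain d where d: "d > 0" "(\<Union>x\<in>K0. cball x d) \<subseteq> \<Omega>"
    using compact_subset_open_imp_cball_epsilon_subset[OF K0(1) \<Omega> K0(2)] by blast
  \<comment> \<open>A compact d-neighbourhood of the support of \<psi> inside \<Omega>. Cut off to
    it, w and g become integrable on the whole space and can be translated.\<close>
  define K where "K = {x + y |x y. x \<in> K0 \<and> y \<in> cball 0 d}"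
  have Kc: "compact K" unfolding K_def by (rule compact_sums[OF K0(1) compact_cball])
  have KI: "x \<in> K" if "k \<in> K0" "dist x k \<le> d" for x k
  proof -
    have "x = k + (x - k)" "x - k \<in> cball 0 d" using that(2) by (auto simp: dist_norm norm_minus_commute)
    then show ?thesis unfolding K_def using that(1) by blast
  qed
  have KO: "K \<subseteq> \<Omega>"
  proof
    fix x assume "x \<in> K"
    then obtain k y where ky: "x = k + y" "k \<in> K0" "norm y \<le> d" unfolding K_def by auto
    then have "x \<in> cball k d" by (simp add: dist_norm)
    then show "x \<in> \<Omega>" using d(2) ky(2) by blast
  qed
  have K0K: "K0 \<subseteq> K" using KI d(1) by (metis dist_self less_imp_le subsetI)
  define W where "W x = indicator K x * w x" for x
  define G where "G x = indicator K x * g x" for x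
  have W: "integrable lebesgue W" and G: "integrable lebesgue G"
    unfolding W_def G_def using locally_integrableD(2)[OF _ Kc KO] wd by blast+
  \<comment> \<open>Half the radius: a shift by less than d / 2 leads from a point of U to a point
    of K, where the cut-off is invisible.\<close>
  define U where "U = (\<Union>k\<in>K0. ball k (d / 2))"
  have U: "open U" unfolding U_def by blast
  have OL: "\<Omega> \<in> sets lebesgue" using \<Omega> by simp
  have shiftK: "x \<in> K" if "x + t *\<^sub>R ?e \<in> U" "0 < t" "t < d / 2" for x t
  proof -
    obtain k where k: "k \<in> K0" "dist k (x + t *\<^sub>R ?e) < d / 2" using \<open>x + t *\<^sub>R ?e \<in> U\<close> unfolding U_def by auto
    have "dist x k \<le> dist x (x + t *\<^sub>R ?e) + dist k (x + t *\<^sub>R ?e)" by (rule dist_triangle2)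
    also have "dist x (x + t *\<^sub>R ?e) = t" using that(2) by (simp add: dist_norm norm_axis_1)
    finally show ?thesis using k that(3) by (intro KI[OF k(1)]) linarith
  qed
  have weak: "(\<integral>x. W x * pderiv_at i \<phi> (x + t *\<^sub>R ?e) \<partial>lebesgue) = - (\<integral>x. G x * \<phi> (x + t *\<^sub>R ?e) \<partial>lebesgue)"
    if \<phi>: "\<phi> \<in> test_functions U" and t: "0 < t" "t < d / 2" for \<phi> t
  proof -
    have z: "\<phi> (x + t *\<^sub>R ?e) = 0" "pderiv_at i \<phi> (x + t *\<^sub>R ?e) = 0" if "x \<notin> K" for x
      using test_functions_zero[OF \<phi>] test_functions_zero[OF test_functions_pderiv[OF \<phi>]] shiftK[OF _ t] that by blast+
    have T: "(\<lambda>x. \<phi> (x + t *\<^sub>R ?e)) \<in> test_functions \<Omega>"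
      by (rule test_functionsI[OF smooth_translate[OF test_functionsD(1)[OF \<phi>]] Kc KO z(1)])
    have p: "pderiv_at i (\<lambda>x. \<phi> (x + t *\<^sub>R ?e)) x = pderiv_at i \<phi> (x + t *\<^sub>R ?e)" for x
      by (rule pderiv_at_translate(2)[OF smooth_differentiable[OF test_functionsD(1)[OF \<phi>]]])
    have "(\<integral>x. w x * pderiv_at i (\<lambda>x. \<phi> (x + t *\<^sub>R ?e)) x \<partial>lebesgue_on \<Omega>) =
       - (\<integral>x. g x * \<phi> (x + t *\<^sub>R ?e) \<partial>lebesgue_on \<Omega>)" using wd T by blast
    moreover have "(\<integral>x. w x * pderiv_at i (\<lambda>x. \<phi> (x + t *\<^sub>R ?e)) x \<partial>lebesgue_on \<Omega>) =
       (\<integral>x. W x * pderiv_at i \<phi> (x + t *\<^sub>R ?e) \<partial>lebesgue)"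
      unfolding p W_def by (rule integral_lebesgue_on_test[OF OL KO z(2)])
    moreover have "(\<integral>x. g x * \<phi> (x + t *\<^sub>R ?e) \<partial>lebesgue_on \<Omega>) =
       (\<integral>x. G x * \<phi> (x + t *\<^sub>R ?e) \<partial>lebesgue)"
      unfolding G_def by (rule integral_lebesgue_on_test[OF OL KO z(1)])
    ultimately show ?thesis by simp
  qed
  \<comment> \<open>The offset 2 keeps h n strictly below d / 2, also for n = 0.\<close>
  define h where "h n = d / 2 / real (n + 2)" for n :: nat
  have h0: "h n > 0" and hd: "h n < d / 2" for n
  proof -
    show "h n > 0" using d(1) by (simp add: h_def)
    have "d / 2 * 1 < d / 2 * real (n + 2)" using d(1) by (intro mult_strict_left_mono) auto
    then show "h n < d / 2" unfolding h_def by (subst pos_divide_less_eq) auto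
  qed
  have hne: "h n \<noteq> 0" for n using h0[of n] by simp
  have hlim: "h \<longlonglongrightarrow> 0" unfolding h_def by real_asymp
  define D where "D n x = (W x - W (x + (- h n) *\<^sub>R ?e)) / h n" for n x
  have Dint: "integrable lebesgue (D n)" for n
    unfolding D_def by (intro Bochner_Integration.integrable_diff integrable_divide_zero impI W integrable_translate[OF W])
  have DG: "(\<lambda>n. \<integral>x. indicator U x * \<bar>D n x - G x\<bar> \<partial>lebesgue) \<longlonglongrightarrow> 0"
  proof (rule LIMSEQ_I)
    fix r :: real assume r: "r > 0"
    obtain \<delta> where \<delta>: "\<delta> > 0" "\<And>y. norm y < \<delta> \<Longrightarrow> (\<integral>x. \<bar>G (x + y) - G x\<bar> \<partial>lebesgue) < r / 2"
      using L1_translation_continuous[OF G, of "r / 2"] r by auto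
    obtain N where N: "\<And>n. n \<ge> N \<Longrightarrow> h n < \<delta>"
      using order_tendstoD(2)[OF hlim \<delta>(1)] by (auto simp: eventually_sequentially)
    have "norm ((\<integral>x. indicator U x * \<bar>D n x - G x\<bar> \<partial>lebesgue) - 0) < r" if n: "n \<ge> N" for n
    proof -
      have "(\<integral>x. indicator U x * \<bar>D n x - G x\<bar> \<partial>lebesgue) \<le> r / 2"
        unfolding D_def
      proof (rule diff_quotient_L1_bound[OF W G U weak h0])
        fix t assume t: "0 < t" "t < h n"
        then show "(\<integral>x. \<bar>G (x + (- t) *\<^sub>R ?e) - G x\<bar> \<partial>lebesgue) \<le> r / 2"
          using N[OF n] by (intro less_imp_le[OF \<delta>(2)]) (simp add: norm_axis_1)
      qed (use hd[of n] in auto)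
      moreover have "(\<integral>x. indicator U x * \<bar>D n x - G x\<bar> \<partial>lebesgue) \<ge> 0"
        by (intro Bochner_Integration.integral_nonneg) auto
      ultimately show ?thesis using r by simp
    qed
    then show "\<exists>N. \<forall>n\<ge>N. norm ((\<integral>x. indicator U x * \<bar>D n x - G x\<bar> \<partial>lebesgue) - 0) < r" by blast
  qed
  let ?f = "\<lambda>x. S (W x)"
  note Wm = borel_measurable_integrable[OF W] and Gm = borel_measurable_integrable[OF G]
  note \<psi>m = test_functions_measurable[OF \<psi>]
  have f: "integrable lebesgue ?f"
  proof (rule Bochner_Integration.integrable_bound)
    show "integrable lebesgue (\<lambda>x. B * W x)" using W by simp
    show "AE x in lebesgue. norm (?f x) \<le> norm (B * W x)"
      using Lip[of _ 0] S0 B0 by (intro AE_I2) (simp add: abs_mult)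
  qed (rule borel_measurable_compose_continuous[OF Sc Wm])
  obtain C where C: "C > 0" "\<And>x. \<bar>\<psi> x\<bar> \<le> C" using test_functions_bounded[OF \<psi>] by blast
  \<comment> \<open>P n discretises the integral with the derivative on \<psi>, and Q n the one with
    the derivative on S (W), where G already replaces the difference quotient of W. The claim
    amounts to P n + Q n tending to 0.\<close>
  define P where "P n = (\<integral>x. ?f x * ((\<psi> (x + h n *\<^sub>R ?e) - \<psi> x) / h n) \<partial>lebesgue)" for n
  define Q where "Q n = (\<integral>x. \<psi> x * ((S (W x) - S (W x - h n * G x)) / h n) \<partial>lebesgue)" for n
  have Plim: "P \<longlonglongrightarrow> (\<integral>x. ?f x * pderiv_at i \<psi> x \<partial>lebesgue)"
    using diff_quotient_tendsto[OF f \<psi>U, of i] hlim hne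
    unfolding tendsto_at_iff_sequentially comp_def P_def by (elim allE[of _ h]) simp
  have Qm: "(\<lambda>x. \<psi> x * ((S (W x) - S (W x - h n * G x)) / h n)) \<in> borel_measurable lebesgue" for n
  proof -
    have "(\<lambda>x. S (W x)) \<in> borel_measurable lebesgue" "(\<lambda>x. S (W x - h n * G x)) \<in> borel_measurable lebesgue"
      using Wm Gm by (auto intro!: borel_measurable_compose_continuous[OF Sc])
    then show ?thesis using \<psi>m by measurable
  qed
  have Qb: "\<bar>\<psi> x * ((S (W x) - S (W x - h n * G x)) / h n)\<bar> \<le> C * (B * \<bar>G x\<bar>)" for n x
  proof -
    have "\<bar>(S (W x) - S (W x - h n * G x)) / h n\<bar> \<le> B * \<bar>G x\<bar>"
      using Lip[of "W x" "W x - h n * G x"] h0[of n] by (simp add: abs_mult field_simps)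
    then show ?thesis unfolding abs_mult using C B0 by (intro mult_mono) auto
  qed
  have Qint: "integrable lebesgue (\<lambda>x. \<psi> x * ((S (W x) - S (W x - h n * G x)) / h n))" for n
  proof (rule Bochner_Integration.integrable_bound[OF _ Qm])
    show "integrable lebesgue (\<lambda>x. C * (B * \<bar>G x\<bar>))" using G by simp
    show "AE x in lebesgue. norm (\<psi> x * ((S (W x) - S (W x - h n * G x)) / h n)) \<le> norm (C * (B * \<bar>G x\<bar>))"
      using Qb C(1) B0 by (intro AE_I2) (force simp: abs_of_nonneg)
  qed
  have Qlim: "Q \<longlonglongrightarrow> (\<integral>x. \<psi> x * (S' (W x) * G x) \<partial>lebesgue)"
    unfolding Q_def
  proof (rule integral_dominated_convergence[where w = "\<lambda>x. C * (B * \<bar>G x\<bar>)"])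
    show "(\<lambda>x. \<psi> x * (S' (W x) * G x)) \<in> borel_measurable lebesgue"
      using \<psi>m Gm borel_measurable_compose_continuous[OF S'c Wm] by measurable
    show "AE x in lebesgue. (\<lambda>n. \<psi> x * ((S (W x) - S (W x - h n * G x)) / h n)) \<longlonglongrightarrow> \<psi> x * (S' (W x) * G x)"
      by (intro AE_I2 tendsto_mult_left deriv_scaled_sequence S hne hlim)
    show "AE x in lebesgue. norm (\<psi> x * ((S (W x) - S (W x - h n * G x)) / h n)) \<le> C * (B * \<bar>G x\<bar>)" for n
      using Qb by (intro AE_I2) simp
  qed (use Qm G in auto)
  have PQ: "\<bar>P n + Q n\<bar> \<le> C * B * (\<integral>x. indicator U x * \<bar>D n x - G x\<bar> \<partial>lebesgue)" for n
  proof -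
    have fs: "integrable lebesgue (\<lambda>x. ?f x * \<psi> (x + a))" for a
      using C(2) by (intro integrable_mult_bounded[OF f test_functions_measurable[OF test_functions_translate[OF \<psi>U]]] AE_I2)
    have f\<psi>: "integrable lebesgue (\<lambda>x. ?f x * \<psi> x)" using fs[of 0] by simp
    have fs': "integrable lebesgue (\<lambda>x. ?f (x - h n *\<^sub>R ?e) * \<psi> x)"
      using integrable_translate[OF fs[of "h n *\<^sub>R ?e"], of "- h n *\<^sub>R ?e"] by simp
    have sh: "(\<integral>x. ?f x * \<psi> (x + h n *\<^sub>R ?e) \<partial>lebesgue) = (\<integral>x. ?f (x - h n *\<^sub>R ?e) * \<psi> x \<partial>lebesgue)"
      using integral_translate[OF fs[of "h n *\<^sub>R ?e"], of "- h n *\<^sub>R ?e"] by simp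
    have "P n = (\<integral>x. (?f x * \<psi> (x + h n *\<^sub>R ?e) - ?f x * \<psi> x) / h n \<partial>lebesgue)"
      unfolding P_def by (intro Bochner_Integration.integral_cong) (auto simp: algebra_simps)
    also have "\<dots> = ((\<integral>x. ?f (x - h n *\<^sub>R ?e) * \<psi> x \<partial>lebesgue) - (\<integral>x. ?f x * \<psi> x \<partial>lebesgue)) / h n"
      using fs f\<psi> sh by simp
    also have "\<dots> = (\<integral>x. (?f (x - h n *\<^sub>R ?e) * \<psi> x - ?f x * \<psi> x) / h n \<partial>lebesgue)"
      using fs' f\<psi> by simp
    finally have "P n + Q n = (\<integral>x. (?f (x - h n *\<^sub>R ?e) * \<psi> x - ?f x * \<psi> x) / h n +
        \<psi> x * ((S (W x) - S (W x - h n * G x)) / h n) \<partial>lebesgue)"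
      unfolding Q_def using Qint fs' f\<psi> by (subst Bochner_Integration.integral_add) auto
    \<comment> \<open>The two occurrences of S (W x) cancel, because W - h D is the shifted
      function.\<close>
    also have "\<dots> = (\<integral>x. \<psi> x * ((S (W x - h n * D n x) - S (W x - h n * G x)) / h n) \<partial>lebesgue)"
    proof (rule Bochner_Integration.integral_cong[OF refl])
      fix x
      have "W x - h n * D n x = W (x - h n *\<^sub>R ?e)" using hne[of n] by (simp add: D_def)
      then show "(?f (x - h n *\<^sub>R ?e) * \<psi> x - ?f x * \<psi> x) / h n + \<psi> x * ((S (W x) - S (W x - h n * G x)) / h n) =
         \<psi> x * ((S (W x - h n * D n x) - S (W x - h n * G x)) / h n)"
        using hne[of n] by (simp add: field_simps)
    qed
    also have "\<bar>\<dots>\<bar> \<le> (\<integral>x. C * B * (indicator U x * \<bar>D n x - G x\<bar>) \<partial>lebesgue)"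
    proof (rule order_trans[OF integral_abs_bound integral_mono'])
      have "integrable lebesgue (\<lambda>x. \<bar>D n x - G x\<bar> * indicator U x)"
        by (rule integrable_mult_bounded[OF _ borel_measurable_indicator, of _ _ _ 1]) (use Dint G U in auto)
      then show "integrable lebesgue (\<lambda>x. C * B * (indicator U x * \<bar>D n x - G x\<bar>))" by (simp add: mult.commute)
      fix x
      show "\<bar>\<psi> x * ((S (W x - h n * D n x) - S (W x - h n * G x)) / h n)\<bar> \<le> C * B * (indicator U x * \<bar>D n x - G x\<bar>)"
      \<comment> \<open>The indicator of U can be inserted because \<psi> vanishes off K0, a subset
        of U.\<close>
      proof (cases "x \<in> K0")
        case True
        then have "x \<in> U" unfolding U_def using d(1) by (intro UN_I[of x]) auto
        have "(W x - h n * D n x) - (W x - h n * G x) = h n * (G x - D n x)" by (simp add: algebra_simps)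
        then have "\<bar>S (W x - h n * D n x) - S (W x - h n * G x)\<bar> \<le> B * (h n * \<bar>D n x - G x\<bar>)"
          using Lip[of "W x - h n * D n x" "W x - h n * G x"] h0[of n] by (simp add: abs_mult abs_minus_commute)
        then have "\<bar>(S (W x - h n * D n x) - S (W x - h n * G x)) / h n\<bar> \<le> B * \<bar>D n x - G x\<bar>"
          using h0[of n] by (simp add: field_simps)
        then have "\<bar>\<psi> x\<bar> * \<bar>(S (W x - h n * D n x) - S (W x - h n * G x)) / h n\<bar> \<le> C * (B * \<bar>D n x - G x\<bar>)"
          using C B0 by (intro mult_mono) auto
        then show ?thesis using \<open>x \<in> U\<close> by (simp only: abs_mult mult.assoc indicator_simps mult_1)
      next
        case False
        then have "\<psi> x = 0" using test_functionsD(4)[OF \<psi>] unfolding K0_def by blast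
        then show ?thesis using C(1) B0 by simp
      qed
      show "0 \<le> C * B * (indicator U x * \<bar>D n x - G x\<bar>)" using C(1) B0 by simp
    qed
    also have "\<dots> = C * B * (\<integral>x. indicator U x * \<bar>D n x - G x\<bar> \<partial>lebesgue)" by simp
    finally show ?thesis .
  qed
  have "(\<lambda>n. C * B * (\<integral>x. indicator U x * \<bar>D n x - G x\<bar> \<partial>lebesgue)) \<longlonglongrightarrow> 0"
    using tendsto_mult_right_zero[OF DG] .
  then have "(\<lambda>n. P n + Q n) \<longlonglongrightarrow> 0"
    by (rule Lim_null_comparison[rotated]) (use PQ in auto)
  moreover have "(\<lambda>n. P n + Q n) \<longlonglongrightarrow> (\<integral>x. ?f x * pderiv_at i \<psi> x \<partial>lebesgue) + (\<integral>x. \<psi> x * (S' (W x) * G x) \<partial>lebesgue)"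
    by (intro tendsto_add Plim Qlim)
  ultimately have main: "(\<integral>x. ?f x * pderiv_at i \<psi> x \<partial>lebesgue) = - (\<integral>x. \<psi> x * (S' (W x) * G x) \<partial>lebesgue)"
    using LIMSEQ_unique by fastforce
  have z: "\<psi> x = 0" "pderiv_at i \<psi> x = 0" if "x \<notin> K" for x
    using that K0K test_functionsD(4)[OF \<psi>] pderiv_at_zero_outside unfolding K0_def by blast+
  have e1: "indicator K x * S (w x) = ?f x" for x using S0 by (auto simp: W_def indicator_def)
  have e2: "(indicator K x * (S' (w x) * g x)) * \<psi> x = \<psi> x * (S' (W x) * G x)" for x
    by (auto simp: W_def G_def indicator_def)
  have "(\<integral>x. S (w x) * pderiv_at i \<psi> x \<partial>lebesgue_on \<Omega>) = (\<integral>x. ?f x * pderiv_at i \<psi> x \<partial>lebesgue)"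
    unfolding e1[symmetric] by (rule integral_lebesgue_on_test[OF OL KO]) (rule z(2))
  moreover have "(\<integral>x. S' (w x) * g x * \<psi> x \<partial>lebesgue_on \<Omega>) = (\<integral>x. \<psi> x * (S' (W x) * G x) \<partial>lebesgue)"
    unfolding e2[symmetric] by (rule integral_lebesgue_on_test[OF OL KO]) (rule z(1))
  ultimately show "(\<integral>x. S (w x) * pderiv_at i \<psi> x \<partial>lebesgue_on \<Omega>) = - (\<integral>x. S' (w x) * g x * \<psi> x \<partial>lebesgue_on \<Omega>)"
    using main by simp
qed

text \<open>The majorant C * f is not known to be integrable in advance. Fatou's lemma first
  extracts the integrability of f from the convergence of the integrals; then C * f is available for
  dominated convergence, which identifies the value.\<close>

lemma integral_limit_dominated_nonneg:
  fixes f :: "'a \<Rightarrow> real" and fn :: "nat \<Rightarrow> 'a \<Rightarrow> real"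
  assumes fn: "\<And>n. integrable M (fn n)" and f: "f \<in> borel_measurable M"
    and nonneg: "\<And>n. AE x in M. 0 \<le> fn n x" and lim: "AE x in M. (\<lambda>n. fn n x) \<longlonglongrightarrow> f x"
    and dom: "\<And>n. AE x in M. fn n x \<le> C * f x" and int: "(\<lambda>n. \<integral>x. fn n x \<partial>M) \<longlonglongrightarrow> L"
  shows "integrable M f" "(\<integral>x. f x \<partial>M) = L"
proof -
  have all_nonneg: "AE x in M. \<forall>n. 0 \<le> fn n x" using nonneg by (simp add: AE_all_countable)
  have f0: "AE x in M. 0 \<le> f x"
    using all_nonneg lim by eventually_elim (rule LIMSEQ_le_const, auto)
  have "(\<integral>\<^sup>+x. ennreal (f x) \<partial>M) = (\<integral>\<^sup>+x. liminf (\<lambda>n. ennreal (fn n x)) \<partial>M)"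
  proof (rule nn_integral_cong_AE)
    show "AE x in M. ennreal (f x) = liminf (\<lambda>n. ennreal (fn n x))"
      using lim by eventually_elim (rule lim_imp_Liminf[symmetric], auto)
  qed
  also have "\<dots> \<le> liminf (\<lambda>n. \<integral>\<^sup>+x. ennreal (fn n x) \<partial>M)"
    using borel_measurable_integrable[OF fn] by (intro nn_integral_liminf) auto
  also have "(\<lambda>n. \<integral>\<^sup>+x. ennreal (fn n x) \<partial>M) = (\<lambda>n. ennreal (\<integral>x. fn n x \<partial>M))"
    using nn_integral_eq_integral[OF fn nonneg] by auto
  also have "liminf \<dots> = ennreal L"
    using int by (intro lim_imp_Liminf) auto
  finally have "(\<integral>\<^sup>+x. ennreal (f x) \<partial>M) < \<infinity>" using ennreal_less_top le_less_trans by fastforce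
  then show i: "integrable M f" by (rule integrableI_nonneg[OF f f0])
  have "(\<lambda>n. \<integral>x. fn n x \<partial>M) \<longlonglongrightarrow> (\<integral>x. f x \<partial>M)"
  proof (rule integral_dominated_convergence[where w = "\<lambda>x. C * f x"])
    show "AE x in M. norm (fn n x) \<le> C * f x" for n
      using nonneg[of n] dom[of n] by eventually_elim simp
  qed (use f i lim borel_measurable_integrable[OF fn] in auto)
  then show "(\<integral>x. f x \<partial>M) = L" using int LIMSEQ_unique by blast
qed

section \<open>Lebesgue and Sobolev spaces\<close>

lemma lp_space_real_iff:
  fixes f :: "'a::euclidean_space \<Rightarrow> real"
  shows "f \<in> lp_space p \<Omega> \<longleftrightarrow> f \<in> borel_measurable (lebesgue_on \<Omega>) \<and> integrable (lebesgue_on \<Omega>) (\<lambda>x. \<bar>f x\<bar> powr p)"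
  by (simp add: lp_space_def)

lemma abs_diff_powr_le:
  fixes a b p :: real assumes "p \<ge> 0"
  shows "\<bar>a - b\<bar> powr p \<le> 2 powr p * (\<bar>a\<bar> powr p + \<bar>b\<bar> powr p)"
proof -
  let ?m = "max \<bar>a\<bar> \<bar>b\<bar>"
  have "\<bar>a - b\<bar> powr p \<le> (2 * ?m) powr p" using assms by (intro powr_mono2) auto
  also have "\<dots> = 2 powr p * ?m powr p" by (simp add: powr_mult)
  also have "?m powr p \<le> \<bar>a\<bar> powr p + \<bar>b\<bar> powr p" by (simp add: max_def)
  finally show ?thesis by simp
qed

lemma lp_space_diff:
  fixes f g :: "'a::euclidean_space \<Rightarrow> real"
  assumes "f \<in> lp_space p \<Omega>" "g \<in> lp_space p \<Omega>" "p \<ge> 0"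
  shows "(\<lambda>x. f x - g x) \<in> lp_space p \<Omega>"
proof -
  note fg = assms(1,2)[unfolded lp_space_real_iff]
  have [measurable]: "f \<in> borel_measurable (lebesgue_on \<Omega>)" "g \<in> borel_measurable (lebesgue_on \<Omega>)"
    using fg by blast+
  have "integrable (lebesgue_on \<Omega>) (\<lambda>x. \<bar>f x - g x\<bar> powr p)"
  proof (rule Bochner_Integration.integrable_bound)
    show "integrable (lebesgue_on \<Omega>) (\<lambda>x. 2 powr p * (\<bar>f x\<bar> powr p + \<bar>g x\<bar> powr p))" using fg by simp
    show "(\<lambda>x. \<bar>f x - g x\<bar> powr p) \<in> borel_measurable (lebesgue_on \<Omega>)" by measurable
    show "AE x in lebesgue_on \<Omega>. norm (\<bar>f x - g x\<bar> powr p) \<le> norm (2 powr p * (\<bar>f x\<bar> powr p + \<bar>g x\<bar> powr p))"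
      using abs_diff_powr_le[OF assms(3)] by (intro AE_I2) (simp add: abs_mult abs_of_nonneg add_nonneg_nonneg)
  qed
  then show ?thesis using fg by (simp add: lp_space_real_iff)
qed

lemma lp_space_cong_AE:
  fixes f g :: "'a::euclidean_space \<Rightarrow> real"
  assumes "f \<in> lp_space p \<Omega>" "AE x in lebesgue_on \<Omega>. f x = g x" "g \<in> borel_measurable (lebesgue_on \<Omega>)"
  shows "g \<in> lp_space p \<Omega>"
proof -
  note f = assms(1)[unfolded lp_space_real_iff]
  have "integrable (lebesgue_on \<Omega>) (\<lambda>x. \<bar>g x\<bar> powr p)"
    by (rule integrable_cong_AE_imp[of "lebesgue_on \<Omega>" "\<lambda>x. \<bar>f x\<bar> powr p"]) (use f assms(2,3) in auto)
  then show ?thesis using assms(3) by (simp add: lp_space_real_iff)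
qed

text \<open>Comparison with the largest component; the constant may be crude, as only integrability
  is drawn from it.\<close>

lemma norm_powr_le_sum:
  fixes v :: "real^'n::finite" assumes "p \<ge> 0"
  shows "norm v powr p \<le> real CARD('n) powr p * (\<Sum>i\<in>UNIV. \<bar>v $ i\<bar> powr p)"
proof -
  obtain j where j: "\<And>i. \<bar>v $ i\<bar> \<le> \<bar>v $ j\<bar>"
  proof -
    have "Max (range (\<lambda>i. \<bar>v $ i\<bar>)) \<in> range (\<lambda>i. \<bar>v $ i\<bar>)" by (intro Max_in) auto
    then obtain j where j: "Max (range (\<lambda>i. \<bar>v $ i\<bar>)) = \<bar>v $ j\<bar>" by (rule rangeE)
    have "\<bar>v $ i\<bar> \<le> Max (range (\<lambda>i. \<bar>v $ i\<bar>))" for i by (rule Max_ge) auto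
    then show thesis using that[of j] unfolding j by blast
  qed
  have "norm v \<le> (\<Sum>i\<in>UNIV. \<bar>v $ i\<bar>)" by (rule norm_le_l1_cart)
  also have "\<dots> \<le> (\<Sum>i\<in>(UNIV::'n set). \<bar>v $ j\<bar>)" using j by (intro sum_mono) auto
  also have "\<dots> = real CARD('n) * \<bar>v $ j\<bar>" by simp
  finally have "norm v powr p \<le> (real CARD('n) * \<bar>v $ j\<bar>) powr p" using assms by (intro powr_mono2) auto
  also have "\<dots> = real CARD('n) powr p * \<bar>v $ j\<bar> powr p" by (simp add: powr_mult)
  also have "\<dots> \<le> real CARD('n) powr p * (\<Sum>i\<in>UNIV. \<bar>v $ i\<bar> powr p)"
    by (intro mult_left_mono member_le_sum) auto
  finally show ?thesis .
qed

lemma integrable_norm_powr: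
  fixes v :: "'a::euclidean_space \<Rightarrow> real^'n::finite"
  assumes "\<And>i. (\<lambda>x. v x $ i) \<in> lp_space p \<Omega>" "p \<ge> 0"
  shows "(\<lambda>x. norm (v x)) \<in> borel_measurable (lebesgue_on \<Omega>)"
    "integrable (lebesgue_on \<Omega>) (\<lambda>x. norm (v x) powr p)"
proof -
  note vi = assms(1)[unfolded lp_space_real_iff]
  have [measurable]: "(\<lambda>x. v x $ i) \<in> borel_measurable (lebesgue_on \<Omega>)" for i using vi by blast
  have "(\<lambda>x. sqrt (\<Sum>i\<in>UNIV. (v x $ i)\<^sup>2)) \<in> borel_measurable (lebesgue_on \<Omega>)"
    by measurable
  then show m: "(\<lambda>x. norm (v x)) \<in> borel_measurable (lebesgue_on \<Omega>)"
    by (simp add: norm_vec_def L2_set_def)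
  show "integrable (lebesgue_on \<Omega>) (\<lambda>x. norm (v x) powr p)"
  proof (rule Bochner_Integration.integrable_bound)
    show "integrable (lebesgue_on \<Omega>) (\<lambda>x. real CARD('n) powr p * (\<Sum>i\<in>UNIV. \<bar>v x $ i\<bar> powr p))" using vi by simp
    show "(\<lambda>x. norm (v x) powr p) \<in> borel_measurable (lebesgue_on \<Omega>)" using m by measurable
    show "AE x in lebesgue_on \<Omega>. norm (norm (v x) powr p) \<le> norm (real CARD('n) powr p * (\<Sum>i\<in>UNIV. \<bar>v x $ i\<bar> powr p))"
      using norm_powr_le_sum[OF assms(2)] by (intro AE_I2) (simp add: abs_mult abs_of_nonneg sum_nonneg)
  qed
qed

text \<open>Splitting at |t| = \<epsilon> gives |t| \<le> \<epsilon> + \<epsilon> powr (1 - p) * |t|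
  powr p. Integrated over a finite measure this takes the place of Hoelder's inequality: smallness
  in L^p implies smallness in L^1.\<close>

lemma integrable_powr_imp_integrable:
  fixes f :: "'a \<Rightarrow> real"
  assumes "finite_measure M" "1 \<le> p" "f \<in> borel_measurable M" "integrable M (\<lambda>x. \<bar>f x\<bar> powr p)" "\<epsilon> > 0"
  shows "integrable M f" "(\<integral>x. \<bar>f x\<bar> powr p \<partial>M) \<le> \<epsilon> powr p \<Longrightarrow> (\<integral>x. \<bar>f x\<bar> \<partial>M) \<le> \<epsilon> * (measure M (space M) + 1)"
proof -
  interpret finite_measure M by fact
  have le: "\<bar>t\<bar> \<le> \<epsilon> + \<epsilon> powr (1 - p) * \<bar>t\<bar> powr p" for t
  proof (cases "\<bar>t\<bar> \<le> \<epsilon>")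
    case True
    have "0 \<le> \<epsilon> powr (1 - p) * \<bar>t\<bar> powr p" by simp
    then show ?thesis using True by linarith
  next
    case False
    then have "\<bar>t\<bar> powr (1 - p) \<le> \<epsilon> powr (1 - p)" using assms(2,5) by (intro powr_mono2') auto
    then have "\<bar>t\<bar> powr (1 - p) * \<bar>t\<bar> powr p \<le> \<epsilon> powr (1 - p) * \<bar>t\<bar> powr p" by (intro mult_right_mono) auto
    moreover have "\<bar>t\<bar> powr (1 - p) * \<bar>t\<bar> powr p = \<bar>t\<bar>" using False assms(5) by (simp flip: powr_add)
    ultimately show ?thesis using assms(5) by linarith
  qed
  have i: "integrable M (\<lambda>x. \<epsilon> + \<epsilon> powr (1 - p) * \<bar>f x\<bar> powr p)" using assms(4) by simp
  show fi: "integrable M f"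
  proof (rule Bochner_Integration.integrable_bound[OF i assms(3)])
    show "AE x in M. norm (f x) \<le> norm (\<epsilon> + \<epsilon> powr (1 - p) * \<bar>f x\<bar> powr p)"
      using le assms(5) by (intro AE_I2) (simp add: abs_of_nonneg add_nonneg_nonneg)
  qed
  assume "(\<integral>x. \<bar>f x\<bar> powr p \<partial>M) \<le> \<epsilon> powr p"
  then have "\<epsilon> powr (1 - p) * (\<integral>x. \<bar>f x\<bar> powr p \<partial>M) \<le> \<epsilon> powr (1 - p) * \<epsilon> powr p" by (intro mult_left_mono) auto
  also have "\<dots> = \<epsilon>" using assms(5) by (simp flip: powr_add)
  finally have *: "\<epsilon> powr (1 - p) * (\<integral>x. \<bar>f x\<bar> powr p \<partial>M) \<le> \<epsilon>" .
  have "(\<integral>x. \<bar>f x\<bar> \<partial>M) \<le> (\<integral>x. \<epsilon> + \<epsilon> powr (1 - p) * \<bar>f x\<bar> powr p \<partial>M)"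
    using fi i le by (intro integral_mono) auto
  also have "\<dots> = \<epsilon> * measure M (space M) + \<epsilon> powr (1 - p) * (\<integral>x. \<bar>f x\<bar> powr p \<partial>M)"
    using assms(4) by (simp add: mult.commute)
  also have "\<dots> \<le> \<epsilon> * (measure M (space M) + 1)" using * by (simp add: algebra_simps)
  finally show "(\<integral>x. \<bar>f x\<bar> \<partial>M) \<le> \<epsilon> * (measure M (space M) + 1)" .
qed

lemma lp_norm_less_imp:
  assumes "lp_norm p \<Omega> f < \<epsilon>" "p > 0"
  shows "(\<integral>x. norm (f x) powr p \<partial>lebesgue_on \<Omega>) \<le> \<epsilon> powr p"
proof -
  let ?I = "\<integral>x. norm (f x) powr p \<partial>lebesgue_on \<Omega>"
  have I: "?I \<ge> 0" by (intro Bochner_Integration.integral_nonneg) auto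
  have "(?I powr (1 / p)) powr p \<le> \<epsilon> powr p"
    using assms by (intro powr_mono2) (auto simp: lp_norm_def)
  then show ?thesis using I assms(2) by (simp add: powr_powr)
qed

lemma finite_measure_lebesgue_on_bounded:
  assumes "bounded \<Omega>" "\<Omega> \<in> sets lebesgue" shows "finite_measure (lebesgue_on \<Omega>)"
  using bounded_set_imp_lmeasurable[OF assms] assms(2)
  by (intro Lebesgue_Measure.finite_measure_lebesgue_on)

lemma lp_space_imp_integrable:
  fixes f :: "'a::euclidean_space \<Rightarrow> real"
  assumes "bounded \<Omega>" "\<Omega> \<in> sets lebesgue" "1 \<le> p" "f \<in> lp_space p \<Omega>"
  shows "integrable (lebesgue_on \<Omega>) f"
  using integrable_powr_imp_integrable(1)[OF finite_measure_lebesgue_on_bounded[OF assms(1,2)] assms(3) _ _ zero_less_one, of f] assms(4)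
  unfolding lp_space_real_iff by blast

lemma lp_space_L1_bound:
  fixes f :: "'a::euclidean_space \<Rightarrow> real"
  assumes "bounded \<Omega>" "\<Omega> \<in> sets lebesgue" "1 \<le> p" "f \<in> lp_space p \<Omega>" "\<epsilon> > 0"
    "(\<integral>x. \<bar>f x\<bar> powr p \<partial>lebesgue_on \<Omega>) \<le> \<epsilon> powr p"
  shows "(\<integral>x. \<bar>f x\<bar> \<partial>lebesgue_on \<Omega>) \<le> \<epsilon> * (measure (lebesgue_on \<Omega>) (space (lebesgue_on \<Omega>)) + 1)"
  using integrable_powr_imp_integrable(2)[OF finite_measure_lebesgue_on_bounded[OF assms(1,2)] assms(3) _ _ assms(5,6)] assms(4)
  unfolding lp_space_real_iff by blast

lemma bounded_measurable_in_lp_space: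
  fixes f :: "'a::euclidean_space \<Rightarrow> real"
  assumes "bounded \<Omega>" "\<Omega> \<in> sets lebesgue" "f \<in> borel_measurable (lebesgue_on \<Omega>)" "\<And>x. \<bar>f x\<bar> \<le> B" "p \<ge> 0"
  shows "f \<in> lp_space p \<Omega>"
proof -
  interpret finite_measure "lebesgue_on \<Omega>" by (rule finite_measure_lebesgue_on_bounded[OF assms(1,2)])
  have "integrable (lebesgue_on \<Omega>) (\<lambda>x. \<bar>f x\<bar> powr p)"
    using assms by (intro integrable_const_bound[where B = "B powr p"] AE_I2) (auto intro!: powr_mono2)
  then show ?thesis using assms(3) by (simp add: lp_space_real_iff)
qed

lemma test_functions_measurable_on:
  "\<phi> \<in> test_functions \<Omega> \<Longrightarrow> \<phi> \<in> borel_measurable (lebesgue_on S)"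
  by (rule measurable_restrict_space1[OF test_functions_measurable])

lemma test_functions_lp_space:
  assumes "bounded \<Omega>" "\<Omega> \<in> sets lebesgue" "\<phi> \<in> test_functions \<Omega>" "p \<ge> 0"
  shows "\<phi> \<in> lp_space p \<Omega>"
proof -
  obtain B where "\<And>x. \<bar>\<phi> x\<bar> \<le> B" using test_functions_bounded[OF assms(3)] by blast
  then show ?thesis
    by (rule bounded_measurable_in_lp_space[OF assms(1,2) test_functions_measurable_on[OF assms(3)] _ assms(4)])
qed

section \<open>Approximation in W_0^{1,p} and integration by parts\<close>

lemma sobolev1_weak_deriv:
  assumes "open \<Omega>" "u \<in> sobolev 1 s \<Omega>"
  shows "u \<in> lp_space s \<Omega>" "has_weak_deriv \<Omega> i u (weak_deriv \<Omega> i u)" "weak_deriv \<Omega> i u \<in> lp_space s \<Omega>"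
proof -
  have u: "u \<in> lp_space s \<Omega>" "\<And>i. \<exists>g. has_weak_deriv \<Omega> i u g \<and> g \<in> lp_space s \<Omega>"
    using assms(2) by (auto simp: One_nat_def)
  show "u \<in> lp_space s \<Omega>" by fact
  obtain g where g: "has_weak_deriv \<Omega> i u g" "g \<in> lp_space s \<Omega>" using u(2) by blast
  show w: "has_weak_deriv \<Omega> i u (weak_deriv \<Omega> i u)" by (rule has_weak_deriv_weak_deriv[OF g(1)])
  have "weak_deriv \<Omega> i u \<in> borel_measurable (lebesgue_on \<Omega>)"
    using locally_integrable_measurable[OF assms(1)] w unfolding has_weak_deriv_def by blast
  then show "weak_deriv \<Omega> i u \<in> lp_space s \<Omega>"
    using lp_space_cong_AE[OF g(2)] has_weak_deriv_unique[OF assms(1) g(1) w] by blast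
qed

text \<open>Boundedness of \<Omega> turns L^p convergence into L^1 convergence, and a subsequence
  then converges almost everywhere. For the derivatives L^1 convergence suffices, since they are
  paired with bounded factors.\<close>

lemma sobolev0_approx:
  fixes \<Omega> :: "(real^'n::finite) set"
  assumes \<Omega>: "open \<Omega>" "bounded \<Omega>" and p: "1 \<le> p" and u: "u \<in> sobolev0 p \<Omega>"
  obtains \<phi> where "\<And>n::nat. \<phi> n \<in> test_functions \<Omega>" "AE x in lebesgue_on \<Omega>. (\<lambda>n. \<phi> n x) \<longlonglongrightarrow> u x"
    "\<And>i. (\<lambda>n. \<integral>x. \<bar>pderiv_at i (\<phi> n) x - weak_deriv \<Omega> i u x\<bar> \<partial>lebesgue_on \<Omega>) \<longlonglongrightarrow> 0"
proof -
  have OL: "\<Omega> \<in> sets lebesgue" using \<Omega> by simp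
  let ?M = "lebesgue_on \<Omega>"
  let ?m = "measure ?M (space ?M) + 1"
  have us: "u \<in> sobolev 1 p \<Omega>" using u unfolding sobolev0_def by blast
  note ws = sobolev1_weak_deriv[OF \<Omega>(1) us]
  have "\<exists>\<phi>. \<phi> \<in> test_functions \<Omega> \<and> lp_norm p \<Omega> (\<lambda>x. \<phi> x - u x) < 1 / real (Suc n) \<and>
      lp_norm p \<Omega> (\<lambda>x. grad \<phi> x - weak_grad \<Omega> u x) < 1 / real (Suc n)" for n
  proof -
    have "1 / real (Suc n) > 0" by simp
    then show ?thesis using u unfolding sobolev0_def by blast
  qed
  then have "\<exists>\<phi>. \<forall>n. \<phi> n \<in> test_functions \<Omega> \<and> lp_norm p \<Omega> (\<lambda>x. \<phi> n x - u x) < 1 / real (Suc n) \<and>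
      lp_norm p \<Omega> (\<lambda>x. grad (\<phi> n) x - weak_grad \<Omega> u x) < 1 / real (Suc n)"
    by (intro choice allI)
  then obtain \<phi> where \<phi>: "\<And>n. \<phi> n \<in> test_functions \<Omega>"
      "\<And>n. lp_norm p \<Omega> (\<lambda>x. \<phi> n x - u x) < 1 / real (Suc n)"
      "\<And>n. lp_norm p \<Omega> (\<lambda>x. grad (\<phi> n) x - weak_grad \<Omega> u x) < 1 / real (Suc n)" by blast
  have lim0: "(\<lambda>n. 1 / real (Suc n) * ?m) \<longlonglongrightarrow> 0"
  proof -
    have "(\<lambda>n. 1 / real (Suc n)) \<longlonglongrightarrow> 0" by real_asymp
    then show ?thesis by (rule tendsto_mult_left_zero)
  qed
  have d: "(\<lambda>x. \<phi> n x - u x) \<in> lp_space p \<Omega>" for n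
    using lp_space_diff[OF test_functions_lp_space[OF \<Omega>(2) OL \<phi>(1)] ws(1)] p by simp
  have dg: "(\<lambda>x. pderiv_at i (\<phi> n) x - weak_deriv \<Omega> i u x) \<in> lp_space p \<Omega>" for n i
    using lp_space_diff[OF test_functions_lp_space[OF \<Omega>(2) OL test_functions_pderiv[OF \<phi>(1)]] ws(3)] p by simp
  have eps: "1 / real (Suc n) > 0" for n by simp
  have p0: "p > 0" using p by simp
  have L1: "integrable ?M (\<lambda>x. \<phi> n x - u x)" "(\<integral>x. \<bar>\<phi> n x - u x\<bar> \<partial>?M) \<le> 1 / real (Suc n) * ?m" for n
    by (rule lp_space_imp_integrable[OF \<Omega>(2) OL p d])
       (rule lp_space_L1_bound[OF \<Omega>(2) OL p d eps lp_norm_less_imp[OF \<phi>(2) p0, simplified real_norm_def]])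
  have L1g: "(\<integral>x. \<bar>pderiv_at i (\<phi> n) x - weak_deriv \<Omega> i u x\<bar> \<partial>?M) \<le> 1 / real (Suc n) * ?m" for n i
  proof -
    have comp: "(grad (\<phi> n) x - weak_grad \<Omega> u x) $ i = pderiv_at i (\<phi> n) x - weak_deriv \<Omega> i u x" for x i
      by (simp add: grad_def weak_grad_def)
    have "(\<integral>x. \<bar>pderiv_at i (\<phi> n) x - weak_deriv \<Omega> i u x\<bar> powr p \<partial>?M) \<le>
       (\<integral>x. norm (grad (\<phi> n) x - weak_grad \<Omega> u x) powr p \<partial>?M)"
    proof (rule integral_mono)
      show "integrable ?M (\<lambda>x. norm (grad (\<phi> n) x - weak_grad \<Omega> u x) powr p)"
        by (rule integrable_norm_powr) (unfold comp, use dg p in auto)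
      show "\<bar>pderiv_at i (\<phi> n) x - weak_deriv \<Omega> i u x\<bar> powr p \<le> norm (grad (\<phi> n) x - weak_grad \<Omega> u x) powr p" for x
        using component_le_norm_cart[of "grad (\<phi> n) x - weak_grad \<Omega> u x" i] p
        unfolding comp by (intro powr_mono2) auto
    qed (use dg[where i = i and n = n] in \<open>simp add: lp_space_real_iff\<close>)
    also have "\<dots> \<le> (1 / real (Suc n)) powr p" by (rule lp_norm_less_imp[OF \<phi>(3) p0])
    finally show ?thesis by (rule lp_space_L1_bound[OF \<Omega>(2) OL p dg eps])
  qed
  have "(\<lambda>n. \<integral>x. norm (\<phi> n x - u x) \<partial>?M) \<longlonglongrightarrow> 0"
    by (rule Lim_null_comparison[OF _ lim0]) (use L1(2) in auto)
  then obtain r :: "nat \<Rightarrow> nat" where r: "strict_mono r" "AE x in ?M. (\<lambda>n. \<phi> (r n) x - u x) \<longlonglongrightarrow> 0"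
    using tendsto_L1_AE_subseq[of ?M "\<lambda>n x. \<phi> n x - u x"] L1(1) by blast
  show thesis
  proof (rule that[of "\<lambda>n. \<phi> (r n)"])
    show "\<phi> (r n) \<in> test_functions \<Omega>" for n by (rule \<phi>(1))
    show "AE x in ?M. (\<lambda>n. \<phi> (r n) x) \<longlonglongrightarrow> u x"
      using r(2) by eventually_elim (simp add: LIM_zero_iff)
    fix i
    have "(\<lambda>n. \<integral>x. \<bar>pderiv_at i (\<phi> n) x - weak_deriv \<Omega> i u x\<bar> \<partial>?M) \<longlonglongrightarrow> 0"
      by (rule Lim_null_comparison[OF _ lim0]) (use L1g in auto)
    from LIMSEQ_subseq_LIMSEQ[OF this r(1)]
    show "(\<lambda>n. \<integral>x. \<bar>pderiv_at i (\<phi> (r n)) x - weak_deriv \<Omega> i u x\<bar> \<partial>?M) \<longlonglongrightarrow> 0" by (simp add: comp_def)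
  qed
qed

text \<open>
  Since \<open>F \<circ> \<phi>\<close> is again a test function for every test function \<open>\<phi>\<close>, no boundary term appears,
  whatever \<open>w\<close> does at the boundary.
\<close>
lemma sobolev0_integration_by_parts:
  fixes \<Omega> :: "(real^'n::finite) set" and F F' :: "real \<Rightarrow> real"
  assumes \<Omega>: "open \<Omega>" "bounded \<Omega>" and p: "1 \<le> p" and u: "u \<in> sobolev0 p \<Omega>"
    and F: "smooth1 F" "F 0 = 0" "\<And>t. (F has_real_derivative F' t) (at t)"
    and Fb: "\<And>t. \<bar>F t\<bar> \<le> A" "\<And>t. \<bar>F' t\<bar> \<le> A"
    and w: "has_weak_deriv \<Omega> i w z" "\<And>x. x \<in> \<Omega> \<Longrightarrow> \<bar>w x\<bar> \<le> B" "integrable (lebesgue_on \<Omega>) z"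
  shows "(\<integral>x. z x * F (u x) \<partial>lebesgue_on \<Omega>) = - (\<integral>x. w x * (F' (u x) * weak_deriv \<Omega> i u x) \<partial>lebesgue_on \<Omega>)"
proof -
  let ?M = "lebesgue_on \<Omega>"
  have OL: "\<Omega> \<in> sets lebesgue" using \<Omega> by simp
  have us: "u \<in> sobolev 1 p \<Omega>" using u unfolding sobolev0_def by blast
  note ws = sobolev1_weak_deriv[OF \<Omega>(1) us]
  let ?d = "weak_deriv \<Omega> i u"
  have dm: "?d \<in> borel_measurable ?M" and um: "u \<in> borel_measurable ?M"
    using ws by (auto simp: lp_space_real_iff)
  have di: "integrable ?M ?d" by (rule lp_space_imp_integrable[OF \<Omega>(2) OL p ws(3)])
  have wm: "w \<in> borel_measurable ?M" and zm: "z \<in> borel_measurable ?M"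
    using locally_integrable_measurable[OF \<Omega>(1)] w(1) unfolding has_weak_deriv_def by blast+
  have Fc: "continuous_on UNIV F" "continuous_on UNIV F'"
    using smooth1_continuous F(1) smooth1_deriv[OF F(1,3)] by blast+
  have A0: "A \<ge> 0" using Fb(1)[of 0] by linarith
  obtain \<phi> where \<phi>: "\<And>n::nat. \<phi> n \<in> test_functions \<Omega>" "AE x in ?M. (\<lambda>n. \<phi> n x) \<longlonglongrightarrow> u x"
    "\<And>i. (\<lambda>n. \<integral>x. \<bar>pderiv_at i (\<phi> n) x - weak_deriv \<Omega> i u x\<bar> \<partial>?M) \<longlonglongrightarrow> 0"
    using sobolev0_approx[OF \<Omega> p u] by blast
  have \<phi>m: "\<phi> n \<in> borel_measurable ?M" for n by (rule test_functions_measurable_on[OF \<phi>(1)])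
  have \<phi>di: "integrable ?M (pderiv_at i (\<phi> n))" for n
    by (rule lp_space_imp_integrable[OF \<Omega>(2) OL order_refl test_functions_lp_space[OF \<Omega>(2) OL
          test_functions_pderiv[OF \<phi>(1)] zero_le_one]])
  have pd: "pderiv_at i (\<lambda>x. F (\<phi> n x)) x = F' (\<phi> n x) * pderiv_at i (\<phi> n) x" for n x
    by (rule pderiv_at_compose[OF smooth_differentiable[OF test_functionsD(1)[OF \<phi>(1)]] F(3)])
  have "(\<integral>x. w x * pderiv_at i (\<lambda>x. F (\<phi> n x)) x \<partial>?M) = - (\<integral>x. z x * F (\<phi> n x) \<partial>?M)" for n
    using w(1) test_functions_compose[OF \<phi>(1) F(1,2), of n] unfolding has_weak_deriv_def by blast
  then have eq: "(\<integral>x. z x * F (\<phi> n x) \<partial>?M) = - (\<integral>x. w x * (F' (\<phi> n x) * pderiv_at i (\<phi> n) x) \<partial>?M)" for n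
    unfolding pd by simp
  have l1: "(\<lambda>n. \<integral>x. z x * F (\<phi> n x) \<partial>?M) \<longlonglongrightarrow> (\<integral>x. z x * F (u x) \<partial>?M)"
  proof (rule integral_dominated_convergence[where w = "\<lambda>x. \<bar>z x\<bar> * A"])
    show "(\<lambda>x. z x * F (u x)) \<in> borel_measurable ?M"
      using zm borel_measurable_compose_continuous[OF Fc(1) um] by measurable
    show "(\<lambda>x. z x * F (\<phi> n x)) \<in> borel_measurable ?M" for n
      using zm borel_measurable_compose_continuous[OF Fc(1) \<phi>m] by measurable
    show "AE x in ?M. (\<lambda>n. z x * F (\<phi> n x)) \<longlonglongrightarrow> z x * F (u x)"
      using \<phi>(2)
    proof eventually_elim
      case (elim x)
      have "isCont F (u x)" using F(3) DERIV_isCont by blast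
      from isCont_tendsto_compose[OF this elim] show ?case by (rule tendsto_mult_left)
    qed
    show "AE x in ?M. norm (z x * F (\<phi> n x)) \<le> \<bar>z x\<bar> * A" for n
      using Fb(1) by (intro AE_I2) (simp add: abs_mult mult_left_mono)
  qed (use w(3) in simp)
  \<comment> \<open>The limit is taken in two parts. Here the derivative of u is kept and only the
    factor F' (\<phi> n) converges, pointwise and boundedly; \<open>l3\<close> then exchanges the
    derivatives of \<phi> n and u, an L^1 error against a bounded factor.\<close>
  have l2: "(\<lambda>n. \<integral>x. w x * (F' (\<phi> n x) * ?d x) \<partial>?M) \<longlonglongrightarrow> (\<integral>x. w x * (F' (u x) * ?d x) \<partial>?M)"
  proof (rule integral_dominated_convergence[where w = "\<lambda>x. \<bar>B\<bar> * (A * \<bar>?d x\<bar>)"])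
    show "(\<lambda>x. w x * (F' (u x) * ?d x)) \<in> borel_measurable ?M"
      using wm dm borel_measurable_compose_continuous[OF Fc(2) um] by measurable
    show "(\<lambda>x. w x * (F' (\<phi> n x) * ?d x)) \<in> borel_measurable ?M" for n
      using wm dm borel_measurable_compose_continuous[OF Fc(2) \<phi>m] by measurable
    show "AE x in ?M. (\<lambda>n. w x * (F' (\<phi> n x) * ?d x)) \<longlonglongrightarrow> w x * (F' (u x) * ?d x)"
      using \<phi>(2)
    proof eventually_elim
      case (elim x)
      have "isCont F' (u x)" using Fc(2) by (simp add: continuous_on_eq_continuous_at)
      from isCont_tendsto_compose[OF this elim] show ?case by (intro tendsto_mult_left tendsto_mult_right)
    qed
    show "AE x in ?M. norm (w x * (F' (\<phi> n x) * ?d x)) \<le> \<bar>B\<bar> * (A * \<bar>?d x\<bar>)" for n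
    proof (rule AE_I2)
      fix x assume "x \<in> space ?M"
      then have "\<bar>w x\<bar> \<le> \<bar>B\<bar>" using w(2)[of x] by simp
      then show "norm (w x * (F' (\<phi> n x) * ?d x)) \<le> \<bar>B\<bar> * (A * \<bar>?d x\<bar>)"
        unfolding real_norm_def abs_mult using Fb(2) A0 by (intro mult_mono) auto
    qed
  qed (use di in simp)
  have l3: "(\<lambda>n. (\<integral>x. w x * (F' (\<phi> n x) * pderiv_at i (\<phi> n) x) \<partial>?M) - (\<integral>x. w x * (F' (\<phi> n x) * ?d x) \<partial>?M)) \<longlonglongrightarrow> 0"
  proof (rule Lim_null_comparison)
    show "(\<lambda>n. \<bar>B\<bar> * A * (\<integral>x. \<bar>pderiv_at i (\<phi> n) x - ?d x\<bar> \<partial>?M)) \<longlonglongrightarrow> 0"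
      using tendsto_mult_right_zero[OF \<phi>(3)] .
    show "\<forall>\<^sub>F n in sequentially. norm ((\<integral>x. w x * (F' (\<phi> n x) * pderiv_at i (\<phi> n) x) \<partial>?M) -
        (\<integral>x. w x * (F' (\<phi> n x) * ?d x) \<partial>?M)) \<le> \<bar>B\<bar> * A * (\<integral>x. \<bar>pderiv_at i (\<phi> n) x - ?d x\<bar> \<partial>?M)"
    proof (intro always_eventually allI)
      fix n
      have b: "\<bar>w x * F' (\<phi> n x)\<bar> \<le> \<bar>B\<bar> * A" if "x \<in> \<Omega>" for x
      proof -
        have "\<bar>w x\<bar> \<le> \<bar>B\<bar>" using w(2)[OF that] by simp
        then show ?thesis unfolding abs_mult using Fb(2) A0 by (intro mult_mono) auto
      qed
      have m: "(\<lambda>x. w x * F' (\<phi> n x)) \<in> borel_measurable ?M"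
        using wm borel_measurable_compose_continuous[OF Fc(2) \<phi>m] by measurable
      have i: "integrable ?M (\<lambda>x. f x * (w x * F' (\<phi> n x)))" if "integrable ?M f" for f
        using b by (intro integrable_mult_bounded[OF that m] AE_I2) auto
      have "(\<integral>x. w x * (F' (\<phi> n x) * pderiv_at i (\<phi> n) x) \<partial>?M) - (\<integral>x. w x * (F' (\<phi> n x) * ?d x) \<partial>?M)
        = (\<integral>x. (pderiv_at i (\<phi> n) x - ?d x) * (w x * F' (\<phi> n x)) \<partial>?M)"
        using i[OF \<phi>di] i[OF di] by (simp add: algebra_simps)
      also have "\<bar>\<dots>\<bar> \<le> (\<integral>x. \<bar>B\<bar> * A * \<bar>pderiv_at i (\<phi> n) x - ?d x\<bar> \<partial>?M)"
      proof (rule order_trans[OF integral_abs_bound integral_mono'])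
        show "integrable ?M (\<lambda>x. \<bar>B\<bar> * A * \<bar>pderiv_at i (\<phi> n) x - ?d x\<bar>)" using \<phi>di di by simp
        fix x assume "x \<in> space ?M"
        then have "x \<in> \<Omega>" by simp
        have "\<bar>pderiv_at i (\<phi> n) x - ?d x\<bar> * \<bar>w x * F' (\<phi> n x)\<bar> \<le> \<bar>pderiv_at i (\<phi> n) x - ?d x\<bar> * (\<bar>B\<bar> * A)"
          using b[OF \<open>x \<in> \<Omega>\<close>] by (intro mult_left_mono) auto
        then show "\<bar>(pderiv_at i (\<phi> n) x - ?d x) * (w x * F' (\<phi> n x))\<bar> \<le> \<bar>B\<bar> * A * \<bar>pderiv_at i (\<phi> n) x - ?d x\<bar>"
          by (subst abs_mult) (simp only: mult.commute)
      qed (use A0 in simp)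
      finally show "norm ((\<integral>x. w x * (F' (\<phi> n x) * pderiv_at i (\<phi> n) x) \<partial>?M) -
        (\<integral>x. w x * (F' (\<phi> n x) * ?d x) \<partial>?M)) \<le> \<bar>B\<bar> * A * (\<integral>x. \<bar>pderiv_at i (\<phi> n) x - ?d x\<bar> \<partial>?M)" by simp
    qed
  qed
  from tendsto_add[OF l3 l2]
  have "(\<lambda>n. \<integral>x. w x * (F' (\<phi> n x) * pderiv_at i (\<phi> n) x) \<partial>?M) \<longlonglongrightarrow> (\<integral>x. w x * (F' (u x) * ?d x) \<partial>?M)" by simp
  from tendsto_minus[OF this] show ?thesis using l1 unfolding eq by (rule LIMSEQ_unique[rotated])
qed

section \<open>Smooth truncations of powers\<close>

text \<open>One parameter governs both ends: the exponential in \<open>flat\<close> makes the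
  function flat at 0, and the arctan caps it at pi / (2 c). As c tends to 0 it approaches |t|^a for
  \<beta> = 1 and sgn(t) |t|^a for \<beta> = -1.\<close>

definition trunc_power :: "real \<Rightarrow> real \<Rightarrow> real \<Rightarrow> real \<Rightarrow> real" where
  "trunc_power \<beta> a c t = arctan (c * flat 1 \<beta> a c t) / c"

definition trunc_power' :: "real \<Rightarrow> real \<Rightarrow> real \<Rightarrow> real \<Rightarrow> real" where
  "trunc_power' \<beta> a c t =
     (a * flat 1 (-\<beta>) (a - 1) c t + 2 * c * flat 1 (-\<beta>) (a - 3) c t) / (1 + (c * flat 1 \<beta> a c t)\<^sup>2)"

lemma abs_arctan_le: "\<bar>arctan x\<bar> \<le> \<bar>x\<bar>"
proof -
  have "\<bar>1 / (1 + t\<^sup>2)\<bar> \<le> 1" for t :: real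
    using one_plus_square_pos[of t] by (simp add: divide_le_eq abs_of_pos)
  then show ?thesis using Lipschitz_of_bounded_deriv[OF arctan_deriv, of 1 x 0] by simp
qed

lemma trunc_power_deriv:
  assumes "c > 0" shows "(trunc_power \<beta> a c has_real_derivative trunc_power' \<beta> a c t) (at t)"
proof -
  have "((\<lambda>t. c * flat 1 \<beta> a c t) has_real_derivative
     c * (a * flat 1 (-\<beta>) (a - 1) c t + 2 * c * flat 1 (-\<beta>) (a - 3) c t)) (at t)"
    by (rule DERIV_cmult[OF flat_deriv[OF assms]])
  from DERIV_cdivide[OF DERIV_chain2[OF arctan_deriv this], of c]
  have "((\<lambda>t. arctan (c * flat 1 \<beta> a c t) / c) has_real_derivative
    1 / (1 + (c * flat 1 \<beta> a c t)\<^sup>2) * (c * (a * flat 1 (-\<beta>) (a - 1) c t + 2 * c * flat 1 (-\<beta>) (a - 3) c t)) / c) (at t)" .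
  also have "1 / (1 + (c * flat 1 \<beta> a c t)\<^sup>2) * (c * (a * flat 1 (-\<beta>) (a - 1) c t + 2 * c * flat 1 (-\<beta>) (a - 3) c t)) / c =
     trunc_power' \<beta> a c t" using assms by (simp add: trunc_power'_def)
  finally show ?thesis by (simp add: trunc_power_def[abs_def])
qed

lemma smooth1_trunc_power:
  assumes "c > 0" shows "smooth1 (trunc_power \<beta> a c)"
proof -
  have "smooth1 (\<lambda>t. (1 / c) * arctan (c * flat 1 \<beta> a c t))"
    by (rule smooth1_mult[OF smooth1_const smooth1_compose[OF smooth1_arctan
          smooth1_mult[OF smooth1_const smooth1_flat[OF assms]]]])
  then show ?thesis by (simp add: trunc_power_def[abs_def])
qed

lemma trunc_power_0 [simp]: "trunc_power \<beta> a c 0 = 0" "trunc_power' \<beta> a c 0 = 0"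
  by (simp_all add: trunc_power_def trunc_power'_def)

lemma trunc_power_bounded:
  assumes "c > 0" shows "\<bar>trunc_power \<beta> a c t\<bar> \<le> pi / 2 / c"
proof -
  have "\<bar>arctan (c * flat 1 \<beta> a c t)\<bar> \<le> pi / 2"
    using arctan_bounded[of "c * flat 1 \<beta> a c t"] unfolding abs_le_iff by linarith
  then have "\<bar>arctan (c * flat 1 \<beta> a c t)\<bar> / c \<le> pi / 2 / c" using assms by (intro divide_right_mono) auto
  then show ?thesis using assms by (simp add: trunc_power_def abs_divide)
qed

lemma abs_flat_le:
  assumes "\<bar>\<beta>\<bar> = 1" "c > 0" shows "\<bar>flat 1 \<beta> a c t\<bar> \<le> \<bar>t\<bar> powr a"
proof -
  have "\<bar>if t > 0 then 1 else \<beta>\<bar> = 1" using assms(1) by simp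
  moreover have "exp (- c / t\<^sup>2) \<le> 1" using assms(2) by simp
  ultimately show ?thesis
    using mult_left_le[of "exp (- c / t\<^sup>2)" "\<bar>t\<bar> powr a"] by (simp add: flat_def abs_mult)
qed

lemma abs_trunc_power_le:
  assumes "\<bar>\<beta>\<bar> = 1" "c > 0" shows "\<bar>trunc_power \<beta> a c t\<bar> \<le> \<bar>t\<bar> powr a"
proof -
  have "\<bar>arctan (c * flat 1 \<beta> a c t)\<bar> \<le> c * \<bar>flat 1 \<beta> a c t\<bar>"
    using abs_arctan_le[of "c * flat 1 \<beta> a c t"] assms(2) by (simp add: abs_mult)
  then have "\<bar>trunc_power \<beta> a c t\<bar> \<le> \<bar>flat 1 \<beta> a c t\<bar>"
    using assms(2) by (simp add: trunc_power_def abs_divide divide_le_eq mult.commute)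
  then show ?thesis using abs_flat_le[OF assms, of a t] by linarith
qed

lemma flat_minus_3:
  assumes "t \<noteq> 0" shows "flat 1 \<beta> (a - 3) c t = flat 1 \<beta> (a - 1) c t / t\<^sup>2"
proof -
  have "\<bar>t\<bar> powr (a - 3) = \<bar>t\<bar> powr ((a - 1) - 2)" by (simp add: algebra_simps)
  also have "\<dots> = \<bar>t\<bar> powr (a - 1) / t\<^sup>2" using assms powr_diff[of "\<bar>t\<bar>" "a - 1" 2] by (simp add: powr_numeral)
  finally show ?thesis by (simp add: flat_def)
qed

lemma mult_exp_neg_le: "(x::real) * exp (- x) \<le> 1"
proof -
  have "x \<le> exp x" using exp_ge_add_one_self[of x] by linarith
  then have "x * exp (- x) \<le> exp x * exp (- x)" by (intro mult_right_mono) auto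
  then show ?thesis by (simp flip: exp_add)
qed

text \<open>Up to sign the second summand is |t|^{a-1} times 2 x exp(-x) with x = c / t^2, and x
  exp(-x) \<le> 1. Hence the constant a + 2, independent of c.\<close>

lemma flat_numerator_le:
  assumes "\<bar>\<beta>\<bar> = 1" "c > 0" "a > 0"
  shows "\<bar>a * flat 1 \<beta> (a - 1) c t + 2 * c * flat 1 \<beta> (a - 3) c t\<bar> \<le> (a + 2) * \<bar>t\<bar> powr (a - 1)"
proof (cases "t = 0")
  case False
  have \<sigma>: "\<bar>if t > 0 then 1 else \<beta>\<bar> = 1" using assms(1) by simp
  have eq: "a * flat 1 \<beta> (a - 1) c t + 2 * c * flat 1 \<beta> (a - 3) c t =
     (if t > 0 then 1 else \<beta>) * (\<bar>t\<bar> powr (a - 1) * (a * exp (- c / t\<^sup>2) + 2 * ((c / t\<^sup>2) * exp (- (c / t\<^sup>2)))))"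
    unfolding flat_minus_3[OF False] by (simp add: flat_def algebra_simps)
  have le: "a * exp (- c / t\<^sup>2) + 2 * ((c / t\<^sup>2) * exp (- (c / t\<^sup>2))) \<le> a + 2"
  proof -
    have "a * exp (- c / t\<^sup>2) \<le> a * 1" using assms by (intro mult_left_mono) auto
    then show ?thesis using mult_exp_neg_le[of "c / t\<^sup>2"] by linarith
  qed
  have "a * exp (- c / t\<^sup>2) + 2 * ((c / t\<^sup>2) * exp (- (c / t\<^sup>2))) \<ge> 0"
    using assms by (intro add_nonneg_nonneg mult_nonneg_nonneg) auto
  with eq have "\<bar>a * flat 1 \<beta> (a - 1) c t + 2 * c * flat 1 \<beta> (a - 3) c t\<bar> =
      \<bar>t\<bar> powr (a - 1) * (a * exp (- c / t\<^sup>2) + 2 * ((c / t\<^sup>2) * exp (- (c / t\<^sup>2))))"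
    by (simp only: abs_mult \<sigma> mult_1 abs_of_nonneg powr_ge_zero)
  also have "\<dots> \<le> \<bar>t\<bar> powr (a - 1) * (a + 2)" by (intro mult_left_mono le) simp
  finally show ?thesis by (simp only: mult.commute)
qed simp

text \<open>The bound is uniform in c and has the same power as the limit of the derivatives, so it
  provides the domination when c tends to 0.\<close>

lemma abs_trunc_power'_le:
  assumes "\<bar>\<beta>\<bar> = 1" "c > 0" "a > 0"
  shows "\<bar>trunc_power' \<beta> a c t\<bar> \<le> (a + 2) * \<bar>t\<bar> powr (a - 1)"
proof -
  let ?N = "a * flat 1 (-\<beta>) (a - 1) c t + 2 * c * flat 1 (-\<beta>) (a - 3) c t"
  let ?D = "1 + (c * flat 1 \<beta> a c t)\<^sup>2"
  have "?D \<ge> 1" by simp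
  then have "\<bar>?N\<bar> / ?D \<le> \<bar>?N\<bar> / 1" using one_plus_square_pos by (intro divide_left_mono) auto
  then have "\<bar>trunc_power' \<beta> a c t\<bar> \<le> \<bar>?N\<bar>"
    using \<open>?D \<ge> 1\<close> by (simp add: trunc_power'_def abs_divide)
  also have "\<dots> \<le> (a + 2) * \<bar>t\<bar> powr (a - 1)"
    by (rule flat_numerator_le) (use assms in auto)
  finally show ?thesis .
qed

text \<open>Integration by parts asks for a bounded F', which \<open>abs_trunc_power'_le\<close>
  does not give near 0 when a < 1, nor at infinity when a > 1. On [-1, 1] continuity suffices;
  beyond, the numerator is of order |t|^{a-1}, while the denominator coming from the arctan is at
  least (c exp(-c))^2 |t|^{2a}.\<close>

lemma trunc_power'_bounded:
  assumes "\<bar>\<beta>\<bar> = 1" "c > 0" "a > 0"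
  obtains A where "\<And>t. \<bar>trunc_power' \<beta> a c t\<bar> \<le> A"
proof -
  have "continuous_on UNIV (trunc_power' \<beta> a c)"
    by (rule smooth1_continuous[OF smooth1_deriv[OF smooth1_trunc_power[OF assms(2)] trunc_power_deriv[OF assms(2)]]])
  then have "compact (trunc_power' \<beta> a c ` {-1..1})"
    by (rule compact_continuous_image[OF continuous_on_subset[OF _ subset_UNIV] compact_Icc])
  from compact_imp_bounded[OF this] obtain A where "\<forall>y\<in>trunc_power' \<beta> a c ` {-1..1}. norm y \<le> A"
    unfolding bounded_iff by blast
  then have A: "\<bar>trunc_power' \<beta> a c t\<bar> \<le> A" if "t \<in> {-1..1}" for t using that by simp
  let ?B = "(a + 2) / (c * exp (- c))\<^sup>2"
  have "\<bar>trunc_power' \<beta> a c t\<bar> \<le> ?B" if t: "\<bar>t\<bar> \<ge> 1" for t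
  proof -
    let ?N = "a * flat 1 (-\<beta>) (a - 1) c t + 2 * c * flat 1 (-\<beta>) (a - 3) c t"
    have "\<bar>?N\<bar> \<le> (a + 2) * \<bar>t\<bar> powr (a - 1)" by (rule flat_numerator_le) (use assms in auto)
    also have "\<dots> \<le> (a + 2) * \<bar>t\<bar> powr (2 * a)" using assms t by (intro mult_left_mono powr_mono) auto
    finally have N: "\<bar>?N\<bar> \<le> (a + 2) * (\<bar>t\<bar> powr a)\<^sup>2"
      using t by (simp add: powr_power mult.commute)
    have "1 \<le> t\<^sup>2" using t by (metis abs_le_square_iff abs_one one_power2)
    then have "c / t\<^sup>2 \<le> c / 1" using assms(2) by (intro divide_left_mono) auto
    then have "exp (- c) \<le> exp (- c / t\<^sup>2)" by simp
    then have "\<bar>t\<bar> powr a * exp (- c) \<le> \<bar>flat 1 \<beta> a c t\<bar>"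
      using assms(1) by (simp add: flat_def abs_mult mult_left_mono)
    then have "c * (\<bar>t\<bar> powr a * exp (- c)) \<le> c * \<bar>flat 1 \<beta> a c t\<bar>"
      using assms(2) by (intro mult_left_mono) auto
    then have "(c * (\<bar>t\<bar> powr a * exp (- c)))\<^sup>2 \<le> (c * \<bar>flat 1 \<beta> a c t\<bar>)\<^sup>2"
      using assms(2) by (intro power_mono) auto
    then have D: "(\<bar>t\<bar> powr a)\<^sup>2 * (c * exp (- c))\<^sup>2 \<le> 1 + (c * flat 1 \<beta> a c t)\<^sup>2"
      by (simp add: power_mult_distrib mult_ac)
    have pos: "(\<bar>t\<bar> powr a)\<^sup>2 * (c * exp (- c))\<^sup>2 > 0" using assms(2) t by (intro mult_pos_pos) auto
    have "\<bar>trunc_power' \<beta> a c t\<bar> = \<bar>?N\<bar> / (1 + (c * flat 1 \<beta> a c t)\<^sup>2)"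
      using one_plus_square_pos[of "c * flat 1 \<beta> a c t"] by (simp add: trunc_power'_def abs_divide)
    also have "\<dots> \<le> (a + 2) * (\<bar>t\<bar> powr a)\<^sup>2 / ((\<bar>t\<bar> powr a)\<^sup>2 * (c * exp (- c))\<^sup>2)"
      using N D pos assms(3) by (intro frac_le) auto
    also have "\<dots> = ?B" using t by simp
    finally show ?thesis .
  qed
  note B = this
  have "\<bar>trunc_power' \<beta> a c t\<bar> \<le> max A ?B" for t
  proof (cases "\<bar>t\<bar> \<le> 1")
    case True
    then have "t \<in> {-1..1}" by auto
    then show ?thesis using A by (intro max.coboundedI1)
  next
    case False
    then show ?thesis using B by (intro max.coboundedI2) simp
  qed
  then show thesis by (rule that)
qed

text \<open>For \<beta> = -1 the truncated power is odd, and the sign -\<beta> in its derivative is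
  positive on both half-lines.\<close>

lemma trunc_power'_nonneg:
  assumes "c > 0" "a > 0" shows "trunc_power' (-1) a c t \<ge> 0"
  unfolding trunc_power'_def flat_def using assms by (intro divide_nonneg_nonneg add_nonneg_nonneg) auto

lemma trunc_power_even_pos:
  assumes "c > 0" shows "trunc_power 1 a c t \<ge> 0" "trunc_power 1 a c t = 0 \<longleftrightarrow> t = 0"
  using assms by (auto simp: trunc_power_def flat_def arctan_eq_zero_iff)

lemma trunc_power_tendsto:
  "(\<lambda>n. trunc_power \<beta> a (1 / real (Suc n)) t) \<longlonglongrightarrow> (if t > 0 then 1 else \<beta>) * \<bar>t\<bar> powr a"
proof (cases "t = 0")
  case False
  let ?K = "(if t > 0 then 1 else \<beta>) * \<bar>t\<bar> powr a"
  let ?c = "\<lambda>n. 1 / real (Suc n)"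
  have s: "t\<^sup>2 > 0" using False by simp
  have "(\<lambda>n. exp (- ?c n / s)) \<longlonglongrightarrow> 1" if "s > 0" for s :: real using that by real_asymp
  from tendsto_mult_left[OF this[OF s], of ?K]
  have f: "(\<lambda>n. flat 1 \<beta> a (?c n) t) \<longlonglongrightarrow> ?K" by (simp add: flat_def)
  have c0: "?c \<longlonglongrightarrow> 0" by real_asymp
  have cf: "(\<lambda>n. ?c n * flat 1 \<beta> a (?c n) t) \<longlonglongrightarrow> 0" using tendsto_mult[OF c0 f] by simp
  \<comment> \<open>The truncation divides the arctan by c, so the error of replacing arctan y by y
    at y = c x must be o(c); the cubic bound leaves (c x)^2 |x|.\<close>
  have cube: "\<bar>arctan y - y\<bar> \<le> y\<^sup>2 * \<bar>y\<bar>" for y :: real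
  proof -
    have "norm ((arctan y - y) - (arctan 0 - 0)) \<le> y\<^sup>2 * norm (y - 0)"
    proof (rule field_differentiable_bound[of "{-\<bar>y\<bar>..\<bar>y\<bar>}" "\<lambda>s. arctan s - s" "\<lambda>s. 1 / (1 + s\<^sup>2) - 1"])
      fix s assume s: "s \<in> {-\<bar>y\<bar>..\<bar>y\<bar>}"
      show "((\<lambda>s. arctan s - s) has_real_derivative 1 / (1 + s\<^sup>2) - 1) (at s within {-\<bar>y\<bar>..\<bar>y\<bar>})"
        by (intro DERIV_diff DERIV_ident has_field_derivative_at_within[OF arctan_deriv])
      have "s\<^sup>2 \<le> y\<^sup>2" using s by (simp add: abs_le_square_iff[symmetric] abs_le_iff)
      have "1 / (1 + s\<^sup>2) - 1 = - (s\<^sup>2 / (1 + s\<^sup>2))" using one_plus_square_pos[of s] by (simp add: field_simps)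
      then have "norm (1 / (1 + s\<^sup>2) - 1) = s\<^sup>2 / (1 + s\<^sup>2)" using one_plus_square_pos[of s] by simp
      also have "\<dots> \<le> s\<^sup>2 / 1" by (intro divide_left_mono) (use one_plus_square_pos[of s] in auto)
      finally show "norm (1 / (1 + s\<^sup>2) - 1) \<le> y\<^sup>2" using \<open>s\<^sup>2 \<le> y\<^sup>2\<close> by simp
    qed auto
    then show ?thesis by simp
  qed
  have "(\<lambda>n. trunc_power \<beta> a (?c n) t - flat 1 \<beta> a (?c n) t) \<longlonglongrightarrow> 0"
  proof (rule Lim_null_comparison)
    show "(\<lambda>n. (?c n * flat 1 \<beta> a (?c n) t)\<^sup>2 * \<bar>flat 1 \<beta> a (?c n) t\<bar>) \<longlonglongrightarrow> 0"
      using tendsto_mult[OF tendsto_power[OF cf, of 2] tendsto_rabs[OF f]] by simp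
    show "\<forall>\<^sub>F n in sequentially. norm (trunc_power \<beta> a (?c n) t - flat 1 \<beta> a (?c n) t) \<le>
      (?c n * flat 1 \<beta> a (?c n) t)\<^sup>2 * \<bar>flat 1 \<beta> a (?c n) t\<bar>"
    proof (intro always_eventually allI)
      fix n
      define c where "c = ?c n"
      define x where "x = flat 1 \<beta> a c t"
      have c: "c > 0" by (simp add: c_def)
      have "arctan (c * x) / c - x = (arctan (c * x) - c * x) / c" using c by (simp add: field_simps)
      then have "\<bar>arctan (c * x) / c - x\<bar> \<le> (c * x)\<^sup>2 * \<bar>c * x\<bar> / c"
        using cube[of "c * x"] c by (simp add: divide_right_mono)
      also have "\<dots> = (c * x)\<^sup>2 * \<bar>x\<bar>" using c by (simp add: abs_mult)
      finally show "norm (trunc_power \<beta> a (?c n) t - flat 1 \<beta> a (?c n) t) \<le>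
        (?c n * flat 1 \<beta> a (?c n) t)\<^sup>2 * \<bar>flat 1 \<beta> a (?c n) t\<bar>"
        unfolding trunc_power_def c_def[symmetric] x_def[symmetric] by simp
    qed
  qed
  from tendsto_add[OF this f] show ?thesis by simp
qed simp

lemma trunc_power'_tendsto:
  "(\<lambda>n. trunc_power' \<beta> a (1 / real (Suc n)) t) \<longlonglongrightarrow> a * ((if t > 0 then 1 else - \<beta>) * \<bar>t\<bar> powr (a - 1))"
proof (cases "t = 0")
  case False
  let ?c = "\<lambda>n. 1 / real (Suc n)"
  have s: "t\<^sup>2 > 0" using False by simp
  have e: "(\<lambda>n. exp (- ?c n / s)) \<longlonglongrightarrow> 1" if "s > 0" for s :: real using that by real_asymp
  have f: "(\<lambda>n. flat 1 b k (?c n) t) \<longlonglongrightarrow> (if t > 0 then 1 else b) * \<bar>t\<bar> powr k" for b k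
    using tendsto_mult_left[OF e[OF s], of "(if t > 0 then 1 else b) * \<bar>t\<bar> powr k"] by (simp add: flat_def)
  have c0: "?c \<longlonglongrightarrow> 0" by real_asymp
  have D: "(\<lambda>n. 1 + (?c n * flat 1 \<beta> a (?c n) t)\<^sup>2) \<longlonglongrightarrow> 1"
    using tendsto_add[OF tendsto_const[of 1] tendsto_power[OF tendsto_mult[OF c0 f[of \<beta> a]], of 2]] by simp
  have "(\<lambda>n. 2 * ?c n * flat 1 (- \<beta>) (a - 3) (?c n) t) \<longlonglongrightarrow> 0"
    using tendsto_mult[OF tendsto_mult_left[OF c0, of 2] f[of "- \<beta>" "a - 3"]] by simp
  from tendsto_add[OF tendsto_mult_left[OF f[of "- \<beta>" "a - 1"], of a] this]
  have N: "(\<lambda>n. a * flat 1 (- \<beta>) (a - 1) (?c n) t + 2 * ?c n * flat 1 (- \<beta>) (a - 3) (?c n) t)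
     \<longlonglongrightarrow> a * ((if t > 0 then 1 else - \<beta>) * \<bar>t\<bar> powr (a - 1))" by simp
  from tendsto_divide[OF N D] show ?thesis by (simp add: trunc_power'_def)
qed simp

section \<open>The weighted integration by parts formula\<close>

text \<open>Membership in \<open>sobolev 2\<close> provides some weak derivative g in W^{1,s},
  whereas \<open>weak_deriv\<close> may choose another representative. Almost everywhere uniqueness
  carries the integrability and the second derivative over.\<close>

lemma sobolev2_weak_deriv:
  assumes "open \<Omega>" "u \<in> sobolev 2 s \<Omega>"
  shows "has_weak_deriv \<Omega> i u (weak_deriv \<Omega> i u)" "weak_deriv \<Omega> i u \<in> lp_space s \<Omega>"
    "has_weak_deriv \<Omega> i (weak_deriv \<Omega> i u) (weak_deriv \<Omega> i (weak_deriv \<Omega> i u))"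
    "weak_deriv \<Omega> i (weak_deriv \<Omega> i u) \<in> lp_space s \<Omega>"
proof -
  have "\<exists>g. has_weak_deriv \<Omega> i u g \<and> g \<in> sobolev 1 s \<Omega>"
    using assms(2) by (simp add: numeral_2_eq_2)
  then obtain g where g: "has_weak_deriv \<Omega> i u g" "g \<in> sobolev 1 s \<Omega>" by blast
  note wg = sobolev1_weak_deriv(1)[OF assms(1) g(2)] sobolev1_weak_deriv(2,3)[OF assms(1) g(2), of i]
  show w: "has_weak_deriv \<Omega> i u (weak_deriv \<Omega> i u)" by (rule has_weak_deriv_weak_deriv[OF g(1)])
  have m: "weak_deriv \<Omega> i u \<in> borel_measurable (lebesgue_on \<Omega>)"
    using locally_integrable_measurable[OF assms(1)] w unfolding has_weak_deriv_def by blast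
  have ae: "AE x in lebesgue_on \<Omega>. g x = weak_deriv \<Omega> i u x"
    by (rule has_weak_deriv_unique[OF assms(1) g(1) w])
  show "weak_deriv \<Omega> i u \<in> lp_space s \<Omega>"
    by (rule lp_space_cong_AE[OF wg(1) ae m])
  have h: "has_weak_deriv \<Omega> i (weak_deriv \<Omega> i u) (weak_deriv \<Omega> i g)"
  proof (rule has_weak_deriv_cong_AE[OF assms(1) wg(2) ae m])
    show "weak_deriv \<Omega> i g \<in> borel_measurable (lebesgue_on \<Omega>)" using wg(3) unfolding lp_space_real_iff by blast
  qed simp
  show w2: "has_weak_deriv \<Omega> i (weak_deriv \<Omega> i u) (weak_deriv \<Omega> i (weak_deriv \<Omega> i u))"
    by (rule has_weak_deriv_weak_deriv[OF h])
  show "weak_deriv \<Omega> i (weak_deriv \<Omega> i u) \<in> lp_space s \<Omega>"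
  proof (rule lp_space_cong_AE[OF wg(3) has_weak_deriv_unique[OF assms(1) h w2]])
    show "weak_deriv \<Omega> i (weak_deriv \<Omega> i u) \<in> borel_measurable (lebesgue_on \<Omega>)"
      using locally_integrable_measurable[OF assms(1)] w2 unfolding has_weak_deriv_def by blast
  qed
qed

lemma arctan_truncation:
  fixes M :: real assumes "M > 0"
  shows "((\<lambda>t. M * arctan (t / M)) has_real_derivative 1 / (1 + (t / M)\<^sup>2)) (at t)"
    and "\<bar>1 / (1 + (t / M)\<^sup>2)\<bar> \<le> 1" and "\<bar>M * arctan (t / M)\<bar> \<le> M * pi / 2"
    and "0 \<le> t * (M * arctan (t / M))" and "t * (M * arctan (t / M)) \<le> t\<^sup>2"
    and "continuous_on UNIV (\<lambda>t. 1 / (1 + (t / M)\<^sup>2))"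
proof -
  have "((\<lambda>t. t / M) has_real_derivative 1 / M) (at t)" by (rule DERIV_cdivide[OF DERIV_ident])
  from DERIV_cmult[OF DERIV_chain2[OF arctan_deriv this], of M]
  show "((\<lambda>t. M * arctan (t / M)) has_real_derivative 1 / (1 + (t / M)\<^sup>2)) (at t)" using assms by simp
  show "\<bar>1 / (1 + (t / M)\<^sup>2)\<bar> \<le> 1" using one_plus_square_pos[of "t / M"] by (simp add: divide_le_eq abs_of_pos)
  have "\<bar>arctan (t / M)\<bar> \<le> pi / 2" using arctan_bounded[of "t / M"] unfolding abs_le_iff by linarith
  then have "M * \<bar>arctan (t / M)\<bar> \<le> M * (pi / 2)" using assms by (intro mult_left_mono) auto
  then show "\<bar>M * arctan (t / M)\<bar> \<le> M * pi / 2" using assms by (simp add: abs_mult)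
  show 0: "0 \<le> t * (M * arctan (t / M))"
  proof (cases "t \<ge> 0")
    case True
    then show ?thesis using assms by (intro mult_nonneg_nonneg) (auto simp: zero_le_arctan_iff)
  next
    case False
    then show ?thesis using assms by (intro mult_nonpos_nonpos mult_nonneg_nonpos) (auto simp: arctan_le_zero_iff divide_nonpos_pos)
  qed
  have "M * \<bar>arctan (t / M)\<bar> \<le> M * \<bar>t / M\<bar>" by (rule mult_left_mono[OF abs_arctan_le]) (use assms in simp)
  then have "M * \<bar>arctan (t / M)\<bar> \<le> \<bar>t\<bar>" using assms by (simp add: abs_divide)
  then have "\<bar>t\<bar> * (M * \<bar>arctan (t / M)\<bar>) \<le> \<bar>t\<bar> * \<bar>t\<bar>" by (intro mult_left_mono) auto
  then have "\<bar>t * (M * arctan (t / M))\<bar> \<le> t\<^sup>2" using assms by (simp add: abs_mult power2_eq_square flip: abs_mult[of t t])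
  then show "t * (M * arctan (t / M)) \<le> t\<^sup>2" by linarith
  have "1 + (t / M)\<^sup>2 \<noteq> 0" for t using one_plus_square_pos[of "t / M"] by linarith
  moreover have "M \<noteq> 0" using assms by simp
  ultimately show "continuous_on UNIV (\<lambda>t. 1 / (1 + (t / M)\<^sup>2))"
    by (intro continuous_on_divide continuous_on_add continuous_on_power continuous_on_const continuous_on_id) auto
qed

text \<open>The terms are difference quotients of arctan at 0 with step 1 / (n + 1) in direction
  t.\<close>

lemma arctan_truncation_tendsto: "(\<lambda>n. real (Suc n) * arctan (t / real (Suc n))) \<longlonglongrightarrow> t"
proof -
  have h: "(\<lambda>n. 1 / real (Suc n)) \<longlonglongrightarrow> 0" by real_asymp
  have "(\<lambda>n. (arctan 0 - arctan (0 - 1 / real (Suc n) * t)) / (1 / real (Suc n))) \<longlonglongrightarrow> 1 * t"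
    using deriv_scaled_sequence[OF _ _ h, of arctan 1 0 t] arctan_deriv[of 0] by simp
  moreover have "(arctan 0 - arctan (0 - 1 / real (Suc n) * t)) / (1 / real (Suc n)) = real (Suc n) * arctan (t / real (Suc n))" for n
    by (simp add: arctan_minus)
  ultimately show ?thesis by simp
qed

text \<open>
  For \<open>p < 2\<close> the square of \<open>\<partial>\<^sub>iu\<close> need not be integrable, so \<open>F (u)\<close> cannot be tested
  against \<open>\<partial>\<^sub>iu\<close> directly. Testing it against the bounded truncations \<open>M arctan (\<partial>\<^sub>iu / M)\<close> and letting
  \<open>M \<rightarrow> \<infinity>\<close> gives, because \<open>F' \<ge> 0\<close>, the integrability of \<open>F' (u) (\<partial>\<^sub>iu)\<^sup>2\<close> together with the formula.
\<close>
lemma weighted_integration_by_parts_bounded: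
  fixes \<Omega> :: "(real^'n::finite) set" and F F' :: "real \<Rightarrow> real"
  assumes \<Omega>: "open \<Omega>" "bounded \<Omega>" and p: "1 \<le> p" and u: "u \<in> sobolev 2 p \<Omega>" "u \<in> sobolev0 p \<Omega>"
    and F: "smooth1 F" "F 0 = 0" "\<And>t. (F has_real_derivative F' t) (at t)"
    and Fb: "\<And>t. \<bar>F t\<bar> \<le> A" "\<And>t. \<bar>F' t\<bar> \<le> A" and F'0: "\<And>t. F' t \<ge> 0"
  shows "integrable (lebesgue_on \<Omega>) (\<lambda>x. F' (u x) * (weak_deriv \<Omega> i u x)\<^sup>2)"
    "(\<integral>x. F' (u x) * (weak_deriv \<Omega> i u x)\<^sup>2 \<partial>lebesgue_on \<Omega>) =
      - (\<integral>x. weak_deriv \<Omega> i (weak_deriv \<Omega> i u) x * F (u x) \<partial>lebesgue_on \<Omega>)"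
proof -
  let ?M = "lebesgue_on \<Omega>"
  let ?d = "weak_deriv \<Omega> i u" let ?dd = "weak_deriv \<Omega> i ?d"
  let ?S = "\<lambda>n t. real (Suc n) * arctan (t / real (Suc n))"
  let ?S' = "\<lambda>n t. 1 / (1 + (t / real (Suc n))\<^sup>2)"
  have OL: "\<Omega> \<in> sets lebesgue" using \<Omega> by simp
  note w = sobolev2_weak_deriv[OF \<Omega>(1) u(1), of i]
  have di: "integrable ?M ?d" and ddi: "integrable ?M ?dd"
    using lp_space_imp_integrable[OF \<Omega>(2) OL p] w(2,4) by blast+
  have us: "u \<in> sobolev 1 p \<Omega>" using u(2) unfolding sobolev0_def by blast
  have um[measurable]: "u \<in> borel_measurable ?M"
    using sobolev1_weak_deriv(1)[OF \<Omega>(1) us] unfolding lp_space_real_iff by blast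
  have dm[measurable]: "?d \<in> borel_measurable ?M" and ddm[measurable]: "?dd \<in> borel_measurable ?M"
    using di ddi by blast+
  have Fm[measurable]: "(\<lambda>x. F (u x)) \<in> borel_measurable ?M" "(\<lambda>x. F' (u x)) \<in> borel_measurable ?M"
    using borel_measurable_compose_continuous[OF smooth1_continuous[OF F(1)] um]
      borel_measurable_compose_continuous[OF smooth1_continuous[OF smooth1_deriv[OF F(1,3)]] um] by blast+
  have S'm[measurable]: "(\<lambda>x. ?S' n (?d x)) \<in> borel_measurable ?M" for n
    by (rule borel_measurable_compose_continuous[OF arctan_truncation(6) dm]) simp
  have Sm[measurable]: "(\<lambda>x. ?S n (?d x)) \<in> borel_measurable ?M" for n
    by (rule borel_measurable_compose_continuous[OF deriv_imp_continuous_on_UNIV[OF arctan_truncation(1)] dm]) simp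
  have wS: "has_weak_deriv \<Omega> i (\<lambda>x. ?S n (?d x)) (\<lambda>x. ?S' n (?d x) * ?dd x)" for n
    by (rule has_weak_deriv_compose[OF \<Omega>(1) w(3) _ arctan_truncation(1,6,2)]) auto
  have iS: "integrable ?M (\<lambda>x. ?S' n (?d x) * ?dd x)" for n
  proof -
    have "integrable ?M (\<lambda>x. ?dd x * ?S' n (?d x))"
      by (rule integrable_mult_bounded[OF ddi S'm, of _ 1]) (intro AE_I2 arctan_truncation(2), simp)
    then show ?thesis by (simp add: mult.commute)
  qed
  have ibp: "(\<integral>x. (?S' n (?d x) * ?dd x) * F (u x) \<partial>?M) = - (\<integral>x. ?S n (?d x) * (F' (u x) * ?d x) \<partial>?M)" for n
    by (rule sobolev0_integration_by_parts[OF \<Omega> p u(2) F Fb wS _ iS]) (rule arctan_truncation(3), simp)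
  have lhs: "(\<lambda>n. \<integral>x. (?S' n (?d x) * ?dd x) * F (u x) \<partial>?M) \<longlonglongrightarrow> (\<integral>x. ?dd x * F (u x) \<partial>?M)"
  proof (rule integral_dominated_convergence[where w = "\<lambda>x. \<bar>?dd x\<bar> * A"])
    show "AE x in ?M. (\<lambda>n. (?S' n (?d x) * ?dd x) * F (u x)) \<longlonglongrightarrow> ?dd x * F (u x)"
    proof (rule AE_I2)
      fix x
      have "(\<lambda>n. t / real (Suc n)) \<longlonglongrightarrow> 0" for t :: real by real_asymp
      from tendsto_power[OF this, of _ 2]
      have "(\<lambda>n. ?S' n (?d x)) \<longlonglongrightarrow> 1 / (1 + 0)"
        by (intro tendsto_divide tendsto_const tendsto_add) auto
      then have "(\<lambda>n. ?S' n (?d x) * ?dd x * F (u x)) \<longlonglongrightarrow> 1 / (1 + 0) * ?dd x * F (u x)"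
        by (intro tendsto_mult tendsto_const)
      then show "(\<lambda>n. (?S' n (?d x) * ?dd x) * F (u x)) \<longlonglongrightarrow> ?dd x * F (u x)" by simp
    qed
    show "AE x in ?M. norm ((?S' n (?d x) * ?dd x) * F (u x)) \<le> \<bar>?dd x\<bar> * A" for n
    proof (rule AE_I2)
      fix x
      have "\<bar>?S' n (?d x)\<bar> * \<bar>?dd x\<bar> \<le> 1 * \<bar>?dd x\<bar>" by (intro mult_right_mono arctan_truncation(2)) auto
      then have "(\<bar>?S' n (?d x)\<bar> * \<bar>?dd x\<bar>) * \<bar>F (u x)\<bar> \<le> \<bar>?dd x\<bar> * A" using Fb(1) by (intro mult_mono) auto
      then show "norm ((?S' n (?d x) * ?dd x) * F (u x)) \<le> \<bar>?dd x\<bar> * A" by (simp only: real_norm_def abs_mult)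
    qed
    show "(\<lambda>x. ?dd x * F (u x)) \<in> borel_measurable ?M" by measurable
    show "(\<lambda>x. (?S' n (?d x) * ?dd x) * F (u x)) \<in> borel_measurable ?M" for n
      by (intro borel_measurable_times S'm ddm Fm)
  qed (use ddi in simp)
  \<comment> \<open>Nonnegative because F' \<ge> 0 and arctan has the sign of its argument, and at
    most F' (u) d^2 because |arctan t| \<le> |t|. This is what
    \<open>integral_limit_dominated_nonneg\<close> needs with C = 1.\<close>
  let ?f = "\<lambda>n x. F' (u x) * (?d x * ?S n (?d x))"
  have fi: "integrable ?M (?f n)" for n
  proof -
    have "integrable ?M (\<lambda>x. ?d x * (F' (u x) * ?S n (?d x)))"
    proof (rule integrable_mult_bounded[OF di])
      show "(\<lambda>x. F' (u x) * ?S n (?d x)) \<in> borel_measurable ?M" by (intro borel_measurable_times Fm Sm)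
      have A: "A \<ge> 0" using Fb(1)[of 0] by linarith
      show "AE x in ?M. \<bar>F' (u x) * ?S n (?d x)\<bar> \<le> A * (real (Suc n) * pi / 2)"
        unfolding abs_mult[of "F' (u _)"] using Fb(2) A by (intro AE_I2 mult_mono arctan_truncation(3)) auto
    qed
    then show ?thesis by (simp add: mult_ac)
  qed
  have eq: "(\<integral>x. ?f n x \<partial>?M) = - (\<integral>x. (?S' n (?d x) * ?dd x) * F (u x) \<partial>?M)" for n
    unfolding ibp by (simp add: mult_ac)
  have lim: "(\<lambda>n. \<integral>x. ?f n x \<partial>?M) \<longlonglongrightarrow> - (\<integral>x. ?dd x * F (u x) \<partial>?M)"
    unfolding eq by (rule tendsto_minus[OF lhs])
  note L = integral_limit_dominated_nonneg[where fn = ?f and f = "\<lambda>x. F' (u x) * (?d x)\<^sup>2" and C = 1, OF fi _ _ _ _ lim]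
  have 1: "(\<lambda>x. F' (u x) * (?d x)\<^sup>2) \<in> borel_measurable ?M" by measurable
  have 2: "AE x in ?M. 0 \<le> ?f n x" for n
    by (intro AE_I2 mult_nonneg_nonneg[OF F'0] arctan_truncation(4)) simp
  have 3: "AE x in ?M. (\<lambda>n. ?f n x) \<longlonglongrightarrow> F' (u x) * (?d x)\<^sup>2"
    unfolding power2_eq_square by (intro AE_I2 tendsto_mult_left arctan_truncation_tendsto)
  have 4: "AE x in ?M. ?f n x \<le> 1 * (F' (u x) * (?d x)\<^sup>2)" for n
    unfolding mult_1 by (intro AE_I2 mult_left_mono F'0 arctan_truncation(5)) simp
  show "integrable ?M (\<lambda>x. F' (u x) * (?d x)\<^sup>2)" by (rule L(1)[OF 1 2 3 4])
  show "(\<integral>x. F' (u x) * (?d x)\<^sup>2 \<partial>?M) = - (\<integral>x. ?dd x * F (u x) \<partial>?M)" by (rule L(2)[OF 1 2 3 4])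
qed

lemma sgn_powr_eq:
  fixes t p :: real
  shows "(if t > 0 then 1 else - 1) * \<bar>t\<bar> powr (p - 1) = \<bar>t\<bar> powr (p - 2) * t"
proof (cases "t = 0")
  case False
  have "\<bar>t\<bar> powr (p - 1) = \<bar>t\<bar> powr ((p - 2) + 1)" by simp
  also have "\<dots> = \<bar>t\<bar> powr (p - 2) * \<bar>t\<bar>" using False by (subst powr_add) simp
  finally show ?thesis using False by simp
qed simp

text \<open>Young's inequality with crude constants, by comparison with the maximum. It supplies the
  integrable majorant for a second derivative times |u|^{p-1}.\<close>

lemma mult_powr_le_sum_powr:
  fixes a b p :: real assumes "1 < p" "0 \<le> a" "0 \<le> b"
  shows "a * b powr (p - 1) \<le> a powr p + b powr p"
proof -
  let ?m = "max a b"
  have m: "?m \<ge> 0" using assms by simp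
  have "a * b powr (p - 1) \<le> ?m * ?m powr (p - 1)"
    using assms by (intro mult_mono powr_mono2) auto
  also have "\<dots> = ?m powr p" using powr_mult_base[OF m, of "p - 1"] by simp
  also have "\<dots> \<le> a powr p + b powr p" by (simp add: max_def)
  finally show ?thesis .
qed

text \<open>F is taken as \<open>trunc_power (-1) (p - 1) c\<close>, and c tends to 0. On the right,
  |F (u)| \<le> |u|^{p-1} allows dominated convergence. On the left the limiting weight is singular
  near zeros of u when p < 2, and its integrability is part of the conclusion.\<close>

lemma weighted_integration_by_parts:
  fixes \<Omega> :: "(real^'n::finite) set" and i :: 'n
  assumes \<Omega>: "open \<Omega>" "bounded \<Omega>" and p: "1 < p" and u: "u \<in> sobolev 2 p \<Omega>" "u \<in> sobolev0 p \<Omega>"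
  defines "d \<equiv> weak_deriv \<Omega> i u"
  shows "integrable (lebesgue_on \<Omega>) (\<lambda>x. \<bar>u x\<bar> powr (p - 2) * (d x)\<^sup>2)"
    "integrable (lebesgue_on \<Omega>) (\<lambda>x. weak_deriv \<Omega> i d x * (\<bar>u x\<bar> powr (p - 2) * u x))"
    "(p - 1) * (\<integral>x. \<bar>u x\<bar> powr (p - 2) * (d x)\<^sup>2 \<partial>lebesgue_on \<Omega>) =
      - (\<integral>x. weak_deriv \<Omega> i d x * (\<bar>u x\<bar> powr (p - 2) * u x) \<partial>lebesgue_on \<Omega>)"
proof -
  let ?M = "lebesgue_on \<Omega>" let ?dd = "weak_deriv \<Omega> i d"
  let ?c = "\<lambda>n. 1 / real (Suc n)"
  let ?F = "\<lambda>n. trunc_power (-1) (p - 1) (?c n)" let ?F' = "\<lambda>n. trunc_power' (-1) (p - 1) (?c n)"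
  have c: "?c n > 0" for n by simp
  have a: "p - 1 > 0" using p by simp
  have b1: "\<bar>-1::real\<bar> = 1" by simp
  have p1: "1 \<le> p" using p by simp
  have OL: "\<Omega> \<in> sets lebesgue" using \<Omega> by simp
  note w = sobolev2_weak_deriv[OF \<Omega>(1) u(1), of i, folded d_def]
  have us: "u \<in> sobolev 1 p \<Omega>" using u(2) unfolding sobolev0_def by blast
  have ul: "u \<in> lp_space p \<Omega>" by (rule sobolev1_weak_deriv(1)[OF \<Omega>(1) us])
  have [measurable]: "u \<in> borel_measurable ?M" "d \<in> borel_measurable ?M" "?dd \<in> borel_measurable ?M"
    using ul w(2,4) unfolding lp_space_real_iff by blast+
  have Fm: "(\<lambda>x. ?F n (u x)) \<in> borel_measurable ?M" for n
    by (rule borel_measurable_compose_continuous[OF smooth1_continuous[OF smooth1_trunc_power[OF c]]]) measurable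
  have step: "integrable ?M (\<lambda>x. ?F' n (u x) * (d x)\<^sup>2)"
    "(\<integral>x. ?F' n (u x) * (d x)\<^sup>2 \<partial>?M) = - (\<integral>x. ?dd x * ?F n (u x) \<partial>?M)" for n
  proof -
    obtain A where A: "\<And>t. \<bar>?F' n t\<bar> \<le> A" using trunc_power'_bounded[OF b1 c a] by blast
    have B: "\<bar>?F n t\<bar> \<le> max A (pi / 2 / ?c n)" "\<bar>?F' n t\<bar> \<le> max A (pi / 2 / ?c n)" for t
      using A trunc_power_bounded[OF c] by (blast intro: max.coboundedI1 max.coboundedI2)+
    note X = weighted_integration_by_parts_bounded[OF \<Omega> p1 u smooth1_trunc_power[OF c] trunc_power_0(1)
        trunc_power_deriv[OF c] B trunc_power'_nonneg[OF c a], of i, folded d_def]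
    show "integrable ?M (\<lambda>x. ?F' n (u x) * (d x)\<^sup>2)"
      "(\<integral>x. ?F' n (u x) * (d x)\<^sup>2 \<partial>?M) = - (\<integral>x. ?dd x * ?F n (u x) \<partial>?M)" by (fact X)+
  qed
  let ?w = "\<lambda>x. \<bar>?dd x\<bar> powr p + \<bar>u x\<bar> powr p"
  have wi: "integrable ?M ?w" using ul w(4) unfolding lp_space_real_iff by simp
  have wb: "\<bar>?dd x\<bar> * \<bar>u x\<bar> powr (p - 1) \<le> ?w x" for x by (rule mult_powr_le_sum_powr[OF p]) auto
  have Gm: "(\<lambda>x. ?dd x * (\<bar>u x\<bar> powr (p - 2) * u x)) \<in> borel_measurable ?M" by measurable
  have Gabs: "\<bar>\<bar>t\<bar> powr (p - 2) * t\<bar> = \<bar>t\<bar> powr (p - 1)" for t :: real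
    unfolding sgn_powr_eq[symmetric] by (simp add: abs_mult)
  show Gi: "integrable ?M (\<lambda>x. ?dd x * (\<bar>u x\<bar> powr (p - 2) * u x))"
  proof (rule Bochner_Integration.integrable_bound[OF wi Gm])
    show "AE x in ?M. norm (?dd x * (\<bar>u x\<bar> powr (p - 2) * u x)) \<le> norm (?w x)"
    proof (rule AE_I2)
      fix x
      show "norm (?dd x * (\<bar>u x\<bar> powr (p - 2) * u x)) \<le> norm (?w x)"
        using wb[of x] unfolding real_norm_def abs_mult[of "?dd x"] Gabs by linarith
    qed
  qed
  have lim: "(\<lambda>n. \<integral>x. ?dd x * ?F n (u x) \<partial>?M) \<longlonglongrightarrow> (\<integral>x. ?dd x * (\<bar>u x\<bar> powr (p - 2) * u x) \<partial>?M)"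
  proof (rule integral_dominated_convergence[OF Gm _ wi])
    show "(\<lambda>x. ?dd x * ?F n (u x)) \<in> borel_measurable ?M" for n using Fm by measurable
    show "AE x in ?M. (\<lambda>n. ?dd x * ?F n (u x)) \<longlonglongrightarrow> ?dd x * (\<bar>u x\<bar> powr (p - 2) * u x)"
      unfolding sgn_powr_eq[symmetric] by (intro AE_I2 tendsto_mult_left trunc_power_tendsto)
    show "AE x in ?M. norm (?dd x * ?F n (u x)) \<le> ?w x" for n
    proof (rule AE_I2)
      fix x
      have "\<bar>?dd x\<bar> * \<bar>?F n (u x)\<bar> \<le> \<bar>?dd x\<bar> * \<bar>u x\<bar> powr (p - 1)"
        by (intro mult_left_mono abs_trunc_power_le[OF b1 c]) auto
      then show "norm (?dd x * ?F n (u x)) \<le> ?w x" using wb[of x] unfolding real_norm_def abs_mult by linarith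
    qed
  qed
  let ?f = "\<lambda>x. (p - 1) * (\<bar>u x\<bar> powr (p - 2) * (d x)\<^sup>2)"
  have lim': "(\<lambda>n. \<integral>x. ?F' n (u x) * (d x)\<^sup>2 \<partial>?M) \<longlonglongrightarrow> - (\<integral>x. ?dd x * (\<bar>u x\<bar> powr (p - 2) * u x) \<partial>?M)"
    unfolding step(2) by (rule tendsto_minus[OF lim])
  \<comment> \<open>With a = p - 1 the uniform bound is (a + 2) |t|^{p-2} = (p + 1) |t|^{p-2}, while
    the limit is (p - 1) |t|^{p-2}; C is the ratio.\<close>
  note L = integral_limit_dominated_nonneg[where fn = "\<lambda>n x. ?F' n (u x) * (d x)\<^sup>2" and f = ?f and C = "(p + 1) / (p - 1)",
      OF step(1) _ _ _ _ lim']
  have 1: "?f \<in> borel_measurable ?M" by measurable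
  have 2: "AE x in ?M. 0 \<le> ?F' n (u x) * (d x)\<^sup>2" for n
    using trunc_power'_nonneg[OF c a] by (intro AE_I2) simp
  have 3: "AE x in ?M. (\<lambda>n. ?F' n (u x) * (d x)\<^sup>2) \<longlonglongrightarrow> ?f x"
  proof (rule AE_I2)
    fix x
    have "(if u x > 0 then 1 else - (- 1)) = (1::real)" "p - 1 - 1 = p - 2" by simp_all
    then have "(\<lambda>n. ?F' n (u x)) \<longlonglongrightarrow> (p - 1) * \<bar>u x\<bar> powr (p - 2)"
      using trunc_power'_tendsto[of "-1" "p - 1" "u x"] by (simp only: mult_1)
    from tendsto_mult_right[OF this] show "(\<lambda>n. ?F' n (u x) * (d x)\<^sup>2) \<longlonglongrightarrow> ?f x" by (simp add: mult.assoc)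
  qed
  have 4: "AE x in ?M. ?F' n (u x) * (d x)\<^sup>2 \<le> (p + 1) / (p - 1) * ?f x" for n
  proof (rule AE_I2)
    fix x
    have "p - 1 + 2 = p + 1" "p - 1 - 1 = p - 2" by simp_all
    then have "?F' n (u x) \<le> (p + 1) * \<bar>u x\<bar> powr (p - 2)"
      using abs_trunc_power'_le[OF b1 c a, of n "u x"] by (simp only: abs_le_iff)
    then have "?F' n (u x) * (d x)\<^sup>2 \<le> (p + 1) * \<bar>u x\<bar> powr (p - 2) * (d x)\<^sup>2" by (rule mult_right_mono) simp
    then show "?F' n (u x) * (d x)\<^sup>2 \<le> (p + 1) / (p - 1) * ?f x" using a by (simp add: mult.assoc)
  qed
  have "integrable ?M ?f" by (rule L(1)[OF 1 2 3 4])
  then show i: "integrable ?M (\<lambda>x. \<bar>u x\<bar> powr (p - 2) * (d x)\<^sup>2)" using a by simp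
  have "(\<integral>x. ?f x \<partial>?M) = - (\<integral>x. ?dd x * (\<bar>u x\<bar> powr (p - 2) * u x) \<partial>?M)" by (rule L(2)[OF 1 2 3 4])
  then show "(p - 1) * (\<integral>x. \<bar>u x\<bar> powr (p - 2) * (d x)\<^sup>2 \<partial>?M) = - (\<integral>x. ?dd x * (\<bar>u x\<bar> powr (p - 2) * u x) \<partial>?M)"
    by simp
qed

text \<open>Testing an even truncation of the modulus of \<open>u\<close> against the coordinate \<open>x\<^sub>i\<close>, whose weak derivative is 1.\<close>
lemma sobolev0_zero_deriv_imp_zero:
  fixes \<Omega> :: "(real^'n::finite) set"
  assumes \<Omega>: "open \<Omega>" "bounded \<Omega>" and p: "1 \<le> p" and u: "u \<in> sobolev0 p \<Omega>"
    and z: "AE x in lebesgue_on \<Omega>. u x \<noteq> 0 \<longrightarrow> weak_deriv \<Omega> i u x = 0"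
  shows "ae_zero \<Omega> u"
proof -
  let ?M = "lebesgue_on \<Omega>"
  let ?F = "trunc_power 1 1 1" let ?F' = "trunc_power' 1 1 1"
  have c: "(1::real) > 0" and b1: "\<bar>1::real\<bar> = 1" by simp_all
  have OL: "\<Omega> \<in> sets lebesgue" using \<Omega> by simp
  interpret finite_measure ?M by (rule finite_measure_lebesgue_on_bounded[OF \<Omega>(2) OL])
  have us: "u \<in> sobolev 1 p \<Omega>" using u unfolding sobolev0_def by blast
  note ws = sobolev1_weak_deriv[OF \<Omega>(1) us]
  have um[measurable]: "u \<in> borel_measurable ?M" using ws(1) unfolding lp_space_real_iff by blast
  obtain A where A: "\<And>t. \<bar>?F' t\<bar> \<le> A" using trunc_power'_bounded[OF b1 c c] by blast
  have B: "\<bar>?F t\<bar> \<le> max A (pi / 2 / 1)" "\<bar>?F' t\<bar> \<le> max A (pi / 2 / 1)" for t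
    using A trunc_power_bounded[OF c] by (blast intro: max.coboundedI1 max.coboundedI2)+
  have "pderiv_at i (\<lambda>x. x $ i) = (\<lambda>x. 1)" by (rule ext) (simp add: pderiv_at_coord)
  then have x: "has_weak_deriv \<Omega> i (\<lambda>x. x $ i) (\<lambda>x. 1)"
    using smooth_has_weak_deriv[OF \<Omega>(1) smooth_coord, of i i] by simp
  obtain R where R: "\<And>x. x \<in> \<Omega> \<Longrightarrow> norm x \<le> R" using \<Omega>(2) unfolding bounded_iff by blast
  have xb: "\<bar>x $ i\<bar> \<le> R" if "x \<in> \<Omega>" for x using R[OF that] component_le_norm_cart[of x i] by linarith
  have "(\<integral>x. 1 * ?F (u x) \<partial>?M) = - (\<integral>x. x $ i * (?F' (u x) * weak_deriv \<Omega> i u x) \<partial>?M)"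
    by (rule sobolev0_integration_by_parts[OF \<Omega> p u smooth1_trunc_power[OF c] trunc_power_0(1)
        trunc_power_deriv[OF c] B x xb integrable_const])
  \<comment> \<open>Where u is zero, \<open>?F'\<close> vanishes; elsewhere the derivative of u
    does. So the integral of ?F (u) is 0, and \<open>?F\<close> is positive off 0.\<close>
  also have "(\<integral>x. x $ i * (?F' (u x) * weak_deriv \<Omega> i u x) \<partial>?M) = 0"
  proof (rule integral_eq_zero_AE)
    show "AE x in ?M. x $ i * (?F' (u x) * weak_deriv \<Omega> i u x) = 0"
      using z by eventually_elim (metis mult_eq_0_iff trunc_power_0(2))
  qed
  finally have 0: "(\<integral>x. ?F (u x) \<partial>?M) = 0" by simp
  have Fm: "(\<lambda>x. ?F (u x)) \<in> borel_measurable ?M"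
    by (rule borel_measurable_compose_continuous[OF smooth1_continuous[OF smooth1_trunc_power[OF c]] um])
  have Fi: "integrable ?M (\<lambda>x. ?F (u x))"
    by (rule integrable_const_bound[OF _ Fm, of "max A (pi / 2 / 1)"]) (use B(1) in \<open>auto intro!: AE_I2\<close>)
  have "AE x in ?M. ?F (u x) = 0"
    using integral_nonneg_eq_0_iff_AE[OF Fi] 0 trunc_power_even_pos(1)[OF c] by simp
  then show ?thesis unfolding ae_zero_def by eventually_elim (simp add: trunc_power_even_pos(2))
qed

lemma powr_half_mult_eq: "\<bar>t\<bar> powr ((p - 2) / 2) * \<bar>t\<bar> = \<bar>t :: real\<bar> powr (p / 2)"
proof (cases "t = 0")
  case False
  have "\<bar>t\<bar> powr (p / 2) = \<bar>t\<bar> powr ((p - 2) / 2 + 1)" by (simp add: field_simps)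
  also have "\<dots> = \<bar>t\<bar> powr ((p - 2) / 2) * \<bar>t\<bar>" using False by (subst powr_add) simp
  finally show ?thesis by simp
qed simp

lemma powr_half_square: "(\<bar>t\<bar> powr (s / 2))\<^sup>2 = \<bar>t :: real\<bar> powr s"
  by (simp add: power2_eq_square flip: powr_add)

text \<open>In the integration by parts the test function itself is now the bounded factor, and F is
  an even truncation of |t|^{p/2}. The chain rule for bounded derivatives does not cover this power,
  whose derivative is unbounded near 0 for p < 2 and at infinity for p > 2. The limit in the
  truncation is dominated by a multiple of |u|^{(p-2)/2} |d|, whose square is integrable by
  assumption.\<close>

lemma has_weak_deriv_abs_powr:
  fixes \<Omega> :: "(real^'n::finite) set"
  assumes \<Omega>: "open \<Omega>" "bounded \<Omega>" and p: "1 \<le> p" and u: "u \<in> sobolev0 p \<Omega>"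
    and i: "integrable (lebesgue_on \<Omega>) (\<lambda>x. \<bar>u x\<bar> powr (p - 2) * (weak_deriv \<Omega> i u x)\<^sup>2)"
  shows "has_weak_deriv \<Omega> i (\<lambda>x. \<bar>u x\<bar> powr ((p - 2) / 2) * \<bar>u x\<bar>)
     (\<lambda>x. p / 2 * ((if u x > 0 then 1 else - 1) * \<bar>u x\<bar> powr ((p - 2) / 2)) * weak_deriv \<Omega> i u x)"
    (is "has_weak_deriv \<Omega> i ?v ?g")
proof -
  let ?M = "lebesgue_on \<Omega>" let ?d = "weak_deriv \<Omega> i u"
  let ?c = "\<lambda>n. 1 / real (Suc n)"
  let ?F = "\<lambda>n. trunc_power 1 (p / 2) (?c n)" let ?F' = "\<lambda>n. trunc_power' 1 (p / 2) (?c n)"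
  have c: "?c n > 0" for n by simp
  have a: "p / 2 > 0" using p by simp
  have b1: "\<bar>1::real\<bar> = 1" by simp
  have OL: "\<Omega> \<in> sets lebesgue" using \<Omega> by simp
  interpret finite_measure ?M by (rule finite_measure_lebesgue_on_bounded[OF \<Omega>(2) OL])
  have us: "u \<in> sobolev 1 p \<Omega>" using u unfolding sobolev0_def by blast
  note ws = sobolev1_weak_deriv[OF \<Omega>(1) us]
  have [measurable]: "u \<in> borel_measurable ?M" "?d \<in> borel_measurable ?M"
    using ws(1,3) unfolding lp_space_real_iff by blast+
  have Fm: "(\<lambda>x. ?F n (u x)) \<in> borel_measurable ?M" "(\<lambda>x. ?F' n (u x)) \<in> borel_measurable ?M" for n
    by (rule borel_measurable_compose_continuous[OF smooth1_continuous[OF smooth1_trunc_power[OF c]]], measurable)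
      (rule borel_measurable_compose_continuous[OF smooth1_continuous[OF smooth1_deriv[OF smooth1_trunc_power[OF c] trunc_power_deriv[OF c]]]], measurable)
  have vi: "integrable ?M (\<lambda>x. \<bar>u x\<bar> powr (p / 2))"
  proof (rule Bochner_Integration.integrable_bound)
    show "integrable ?M (\<lambda>x. 1 + \<bar>u x\<bar> powr p)" using ws(1) unfolding lp_space_real_iff by simp
    show "AE x in ?M. norm (\<bar>u x\<bar> powr (p / 2)) \<le> norm (1 + \<bar>u x\<bar> powr p)"
    proof (rule AE_I2)
      fix x
      \<comment> \<open>On a finite measure this elementary bound replaces the Cauchy-Schwarz
        inequality: square integrability gives integrability.\<close>
      have "y \<le> 1 + y\<^sup>2" for y :: real using zero_le_power2[of "y - 1/2"] by (simp add: power2_eq_square algebra_simps)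
      from this[of "\<bar>u x\<bar> powr (p / 2)"] show "norm (\<bar>u x\<bar> powr (p / 2)) \<le> norm (1 + \<bar>u x\<bar> powr p)"
        unfolding powr_half_square by (simp add: abs_of_nonneg add_nonneg_nonneg)
    qed
  qed measurable
  have di: "integrable ?M (\<lambda>x. \<bar>u x\<bar> powr ((p - 2) / 2) * \<bar>?d x\<bar>)"
  proof (rule Bochner_Integration.integrable_bound)
    show "integrable ?M (\<lambda>x. 1 + \<bar>u x\<bar> powr (p - 2) * (?d x)\<^sup>2)" using i by simp
    show "AE x in ?M. norm (\<bar>u x\<bar> powr ((p - 2) / 2) * \<bar>?d x\<bar>) \<le> norm (1 + \<bar>u x\<bar> powr (p - 2) * (?d x)\<^sup>2)"
    proof (rule AE_I2)
      fix x
      have "y \<le> 1 + y\<^sup>2" for y :: real using zero_le_power2[of "y - 1/2"] by (simp add: power2_eq_square algebra_simps)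
      from this[of "\<bar>u x\<bar> powr ((p - 2) / 2) * \<bar>?d x\<bar>"]
      show "norm (\<bar>u x\<bar> powr ((p - 2) / 2) * \<bar>?d x\<bar>) \<le> norm (1 + \<bar>u x\<bar> powr (p - 2) * (?d x)\<^sup>2)"
        unfolding power_mult_distrib powr_half_square by (simp add: abs_of_nonneg add_nonneg_nonneg)
    qed
  qed measurable
  have gm[measurable]: "?g \<in> borel_measurable ?M" by measurable
  have gi: "integrable ?M ?g"
  proof (rule Bochner_Integration.integrable_bound[OF integrable_mult_right[OF di, of "p / 2"] gm])
    show "AE x in ?M. norm (?g x) \<le> norm (p / 2 * (\<bar>u x\<bar> powr ((p - 2) / 2) * \<bar>?d x\<bar>))"
      by (intro AE_I2) (simp add: abs_mult)
  qed
  show ?thesis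
    unfolding has_weak_deriv_def
  proof (intro conjI ballI)
    show "locally_integrable \<Omega> ?v"
      unfolding powr_half_mult_eq by (rule integrable_imp_locally_integrable[OF OL vi])
    show "locally_integrable \<Omega> ?g" by (rule integrable_imp_locally_integrable[OF OL gi])
    fix \<phi> assume \<phi>: "\<phi> \<in> test_functions \<Omega>"
    have p\<phi>: "pderiv_at i \<phi> \<in> test_functions \<Omega>" by (rule test_functions_pderiv[OF \<phi>])
    obtain B where B: "\<And>x. \<bar>\<phi> x\<bar> \<le> B" using test_functions_bounded[OF \<phi>] by blast
    obtain B' where B': "\<And>x. \<bar>pderiv_at i \<phi> x\<bar> \<le> B'" using test_functions_bounded[OF p\<phi>] by blast
    have [measurable]: "\<phi> \<in> borel_measurable ?M" "pderiv_at i \<phi> \<in> borel_measurable ?M"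
      using test_functions_measurable_on \<phi> p\<phi> by blast+
    have B0: "B \<ge> 0" "B' \<ge> 0" using B[of 0] B'[of 0] by linarith+
    have w: "has_weak_deriv \<Omega> i \<phi> (pderiv_at i \<phi>)" by (rule smooth_has_weak_deriv[OF \<Omega>(1) test_functionsD(1)[OF \<phi>]])
    have wi: "integrable ?M (pderiv_at i \<phi>)"
      by (rule lp_space_imp_integrable[OF \<Omega>(2) OL order_refl test_functions_lp_space[OF \<Omega>(2) OL p\<phi> zero_le_one]])
    have ibp: "(\<integral>x. pderiv_at i \<phi> x * ?F n (u x) \<partial>?M) = - (\<integral>x. \<phi> x * (?F' n (u x) * ?d x) \<partial>?M)" for n
    proof -
      obtain A where A: "\<And>t. \<bar>?F' n t\<bar> \<le> A" using trunc_power'_bounded[OF b1 c a] by blast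
      have C: "\<bar>?F n t\<bar> \<le> max A (pi / 2 / ?c n)" "\<bar>?F' n t\<bar> \<le> max A (pi / 2 / ?c n)" for t
        using A trunc_power_bounded[OF c] by (blast intro: max.coboundedI1 max.coboundedI2)+
      show ?thesis
        by (rule sobolev0_integration_by_parts[OF \<Omega> p u smooth1_trunc_power[OF c] trunc_power_0(1)
            trunc_power_deriv[OF c] C w B wi])
    qed
    have l1: "(\<lambda>n. \<integral>x. pderiv_at i \<phi> x * ?F n (u x) \<partial>?M) \<longlonglongrightarrow> (\<integral>x. pderiv_at i \<phi> x * \<bar>u x\<bar> powr (p / 2) \<partial>?M)"
    proof (rule integral_dominated_convergence[where w = "\<lambda>x. B' * \<bar>u x\<bar> powr (p / 2)"])
      show "(\<lambda>x. pderiv_at i \<phi> x * \<bar>u x\<bar> powr (p / 2)) \<in> borel_measurable ?M" by measurable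
      show "(\<lambda>x. pderiv_at i \<phi> x * ?F n (u x)) \<in> borel_measurable ?M" for n using Fm by measurable
      show "integrable ?M (\<lambda>x. B' * \<bar>u x\<bar> powr (p / 2))" using vi by simp
      show "AE x in ?M. (\<lambda>n. pderiv_at i \<phi> x * ?F n (u x)) \<longlonglongrightarrow> pderiv_at i \<phi> x * \<bar>u x\<bar> powr (p / 2)"
      proof (intro AE_I2 tendsto_mult_left)
        show "(\<lambda>n. ?F n (u x)) \<longlonglongrightarrow> \<bar>u x\<bar> powr (p / 2)" for x
          using trunc_power_tendsto[of 1 "p / 2" "u x"] by simp
      qed
      show "AE x in ?M. norm (pderiv_at i \<phi> x * ?F n (u x)) \<le> B' * \<bar>u x\<bar> powr (p / 2)" for n
        unfolding real_norm_def abs_mult using B' B0 by (intro AE_I2 mult_mono abs_trunc_power_le[OF b1 c]) auto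
    qed
    have l2: "(\<lambda>n. \<integral>x. \<phi> x * (?F' n (u x) * ?d x) \<partial>?M) \<longlonglongrightarrow> (\<integral>x. \<phi> x * ?g x \<partial>?M)"
    proof (rule integral_dominated_convergence[where w = "\<lambda>x. B * ((p / 2 + 2) * (\<bar>u x\<bar> powr ((p - 2) / 2) * \<bar>?d x\<bar>))"])
      show "(\<lambda>x. \<phi> x * ?g x) \<in> borel_measurable ?M" by measurable
      show "(\<lambda>x. \<phi> x * (?F' n (u x) * ?d x)) \<in> borel_measurable ?M" for n using Fm by measurable
      show "integrable ?M (\<lambda>x. B * ((p / 2 + 2) * (\<bar>u x\<bar> powr ((p - 2) / 2) * \<bar>?d x\<bar>)))"
        by (intro integrable_mult_right di)
      show "AE x in ?M. (\<lambda>n. \<phi> x * (?F' n (u x) * ?d x)) \<longlonglongrightarrow> \<phi> x * ?g x"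
      proof (intro AE_I2 tendsto_mult_left tendsto_mult_right)
        have "p / 2 - 1 = (p - 2) / 2" by (simp add: field_simps)
        then show "(\<lambda>n. ?F' n (u x)) \<longlonglongrightarrow> p / 2 * ((if u x > 0 then 1 else - 1) * \<bar>u x\<bar> powr ((p - 2) / 2))" for x
          using trunc_power'_tendsto[of 1 "p / 2" "u x"] by (simp only:)
      qed
      show "AE x in ?M. norm (\<phi> x * (?F' n (u x) * ?d x)) \<le> B * ((p / 2 + 2) * (\<bar>u x\<bar> powr ((p - 2) / 2) * \<bar>?d x\<bar>))" for n
      proof (rule AE_I2)
        fix x
        have "p / 2 - 1 = (p - 2) / 2" by (simp add: field_simps)
        then have "\<bar>?F' n (u x)\<bar> \<le> (p / 2 + 2) * \<bar>u x\<bar> powr ((p - 2) / 2)"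
          using abs_trunc_power'_le[OF b1 c a, of n "u x"] by (simp only:)
        then have X: "\<bar>?F' n (u x)\<bar> * \<bar>?d x\<bar> \<le> ((p / 2 + 2) * \<bar>u x\<bar> powr ((p - 2) / 2)) * \<bar>?d x\<bar>"
          by (rule mult_right_mono) simp
        have "\<bar>\<phi> x\<bar> * (\<bar>?F' n (u x)\<bar> * \<bar>?d x\<bar>) \<le> B * (((p / 2 + 2) * \<bar>u x\<bar> powr ((p - 2) / 2)) * \<bar>?d x\<bar>)"
          by (rule mult_mono[OF B X B0(1)]) simp
        then show "norm (\<phi> x * (?F' n (u x) * ?d x)) \<le> B * ((p / 2 + 2) * (\<bar>u x\<bar> powr ((p - 2) / 2) * \<bar>?d x\<bar>))"
          by (simp only: real_norm_def abs_mult mult.assoc)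
      qed
    qed
    have "(\<integral>x. pderiv_at i \<phi> x * \<bar>u x\<bar> powr (p / 2) \<partial>?M) = - (\<integral>x. \<phi> x * ?g x \<partial>?M)"
      using l1 tendsto_minus[OF l2] unfolding ibp by (rule LIMSEQ_unique)
    then show "(\<integral>x. ?v x * pderiv_at i \<phi> x \<partial>?M) = - (\<integral>x. ?g x * \<phi> x \<partial>?M)"
      unfolding powr_half_mult_eq by (simp only: mult.commute)
  qed
qed

section \<open>The eigenvalue quotients\<close>

lemma lp_space_add:
  fixes f g :: "'a::euclidean_space \<Rightarrow> real"
  assumes "f \<in> lp_space p \<Omega>" "g \<in> lp_space p \<Omega>" "p \<ge> 0"
  shows "(\<lambda>x. f x + g x) \<in> lp_space p \<Omega>"
proof -
  have "(\<lambda>x. - g x) \<in> lp_space p \<Omega>" using assms(2) by (simp add: lp_space_real_iff)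
  from lp_space_diff[OF assms(1) this assms(3)] show ?thesis by simp
qed

lemma lp_space_sum:
  fixes f :: "'b \<Rightarrow> 'a::euclidean_space \<Rightarrow> real"
  assumes "finite A" "\<And>a. a \<in> A \<Longrightarrow> f a \<in> lp_space p \<Omega>" "p \<ge> 0"
  shows "(\<lambda>x. \<Sum>a\<in>A. f a x) \<in> lp_space p \<Omega>"
  using assms(1,2)
proof (induction A rule: finite_induct)
  case (insert a A)
  have "(\<lambda>x. f a x + (\<Sum>a\<in>A. f a x)) \<in> lp_space p \<Omega>"
    by (rule lp_space_add[OF insert.prems insert.IH assms(3)]) (auto intro: insert.prems)
  then show ?case using insert.hyps by simp
qed (simp add: lp_space_real_iff)

text \<open>Rests on (p - 1) * q = p.\<close>

lemma f1_in_lp_space: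
  fixes f :: "'a::euclidean_space \<Rightarrow> real"
  assumes "1 < p" "q = p / (p - 1)" "f \<in> lp_space p \<Omega>"
  shows "f1 p f \<in> lp_space q \<Omega>"
proof -
  have [measurable]: "f \<in> borel_measurable (lebesgue_on \<Omega>)" using assms(3) unfolding lp_space_real_iff by blast
  have "\<bar>f1 p f x\<bar> powr q = \<bar>f x\<bar> powr p" for x
  proof -
    have "\<bar>f1 p f x\<bar> = \<bar>f x\<bar> powr (p - 1)"
      unfolding f1_def sgn_powr_eq[symmetric] by (simp add: abs_mult)
    then show ?thesis using assms(1,2) by (simp add: powr_powr)
  qed
  moreover have "f1 p f \<in> borel_measurable (lebesgue_on \<Omega>)" unfolding f1_def by measurable
  ultimately show ?thesis using assms(3) by (simp add: lp_space_real_iff)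
qed

lemma f1_mult_self: "f1 p f x * f x = \<bar>f x\<bar> powr p"
proof (cases "f x = 0")
  case False
  have "\<bar>f x\<bar> powr p = \<bar>f x\<bar> powr ((p - 2) + 2)" by simp
  also have "\<dots> = \<bar>f x\<bar> powr (p - 2) * \<bar>f x\<bar> powr 2" using False by (subst powr_add) simp
  finally show ?thesis using False by (simp add: f1_def power2_eq_square)
qed (simp add: f1_def)

lemma lp_norm_2_square: "(lp_norm 2 \<Omega> f)\<^sup>2 = (\<integral>x. (norm (f x))\<^sup>2 \<partial>lebesgue_on \<Omega>)"
proof -
  have "(\<integral>x. (norm (f x))\<^sup>2 \<partial>lebesgue_on \<Omega>) \<ge> 0" by (intro Bochner_Integration.integral_nonneg) auto
  then show ?thesis unfolding lp_norm_def by (simp add: powr_half_sqrt)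
qed

lemma lp_norm_powr:
  assumes "p > 0" shows "lp_norm p \<Omega> f powr p = (\<integral>x. norm (f x) powr p \<partial>lebesgue_on \<Omega>)"
proof -
  have "(\<integral>x. norm (f x) powr p \<partial>lebesgue_on \<Omega>) \<ge> 0" by (intro Bochner_Integration.integral_nonneg) auto
  then show ?thesis using assms by (simp add: lp_norm_def powr_powr)
qed

lemma lp_norm_nonneg: "lp_norm p \<Omega> f \<ge> 0"
  by (simp add: lp_norm_def)

text \<open>Zero arguments are treated apart because \<open>Youngs_inequality_0\<close> concerns
  positive ones. With \<open>0 powr 0 = 0\<close> the left-hand side is then 0 even at the endpoints
  s = 0 and s = 1.\<close>

lemma weighted_Young:
  fixes s a b :: real
  assumes "0 \<le> s" "s \<le> 1" "0 \<le> a" "0 \<le> b"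
  shows "a powr s * b powr (1 - s) \<le> s * a + (1 - s) * b"
proof (cases "a = 0 \<or> b = 0")
  case True
  then show ?thesis using assms by (auto intro!: mult_nonneg_nonneg)
next
  case False
  then show ?thesis using assms by (intro Youngs_inequality_0) auto
qed

text \<open>At \<open>p = 2\<close> the weight \<open>0 powr 0 = 0\<close> only decreases the left-hand side.\<close>
lemma Hoelder_weighted:
  fixes a b :: "'a \<Rightarrow> real"
  assumes p: "2 \<le> p" and nn: "\<And>x. 0 \<le> a x" "\<And>x. 0 \<le> b x"
    and int: "integrable M (\<lambda>x. a x powr p)" "integrable M (\<lambda>x. b x powr p)" "integrable M (\<lambda>x. a x powr (p - 2) * (b x)\<^sup>2)"
    and pos: "\<alpha> > 0" "\<beta> > 0" and eq: "(\<integral>x. a x powr p \<partial>M) = \<alpha> powr p" "(\<integral>x. b x powr p \<partial>M) = \<beta> powr p"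
  shows "(\<integral>x. a x powr (p - 2) * (b x)\<^sup>2 \<partial>M) \<le> \<alpha> powr (p - 2) * \<beta>\<^sup>2"
proof -
  let ?s = "(p - 2) / p"
  have s: "0 \<le> ?s" "?s \<le> 1" "1 - ?s = 2 / p" using p by (auto simp: field_simps)
  let ?K = "\<alpha> powr (p - 2) * \<beta>\<^sup>2"
  \<comment> \<open>Young's inequality with weights (p - 2) / p and 2 / p for the normalised
    functions a / \<alpha> and b / \<beta>; after integration the two weights add up to 1.\<close>
  have pt: "a x powr (p - 2) * (b x)\<^sup>2 \<le> ?K * (?s / \<alpha> powr p * a x powr p + (2 / p) / \<beta> powr p * b x powr p)" for x
  proof -
    have "(a x / \<alpha>) powr (p - 2) * (b x / \<beta>)\<^sup>2 = ((a x / \<alpha>) powr p) powr ?s * ((b x / \<beta>) powr p) powr (1 - ?s)"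
      unfolding s(3) using p nn[of x] pos by (simp add: powr_powr)
    also have "\<dots> \<le> ?s * (a x / \<alpha>) powr p + (1 - ?s) * (b x / \<beta>) powr p"
      by (rule weighted_Young) (use s in auto)
    also have "\<dots> = ?s / \<alpha> powr p * a x powr p + (2 / p) / \<beta> powr p * b x powr p"
      unfolding s(3) using nn[of x] pos by (simp add: powr_divide)
    finally have le: "(a x / \<alpha>) powr (p - 2) * (b x / \<beta>)\<^sup>2 \<le> \<dots>" .
    have "a x powr (p - 2) * (b x)\<^sup>2 = ?K * ((a x / \<alpha>) powr (p - 2) * (b x / \<beta>)\<^sup>2)"
      using nn[of x] pos by (simp add: powr_divide power_divide)
    also have "\<dots> \<le> ?K * (?s / \<alpha> powr p * a x powr p + (2 / p) / \<beta> powr p * b x powr p)"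
      using le by (rule mult_left_mono) simp
    finally show ?thesis .
  qed
  have "(\<integral>x. a x powr (p - 2) * (b x)\<^sup>2 \<partial>M) \<le>
      (\<integral>x. ?K * (?s / \<alpha> powr p * a x powr p + (2 / p) / \<beta> powr p * b x powr p) \<partial>M)"
    using int pt by (intro integral_mono) auto
  also have "\<dots> = ?K * (?s / \<alpha> powr p * \<alpha> powr p + (2 / p) / \<beta> powr p * \<beta> powr p)"
    using int eq by simp
  also have "\<dots> = ?K * (?s + 2 / p)" using pos by simp
  also have "?s + 2 / p = 1" using s(3) by linarith
  finally show ?thesis by simp
qed

lemma cINF_cmult:
  fixes f :: "'a \<Rightarrow> real"
  assumes "c > 0" "S \<noteq> {}" "bdd_below (f ` S)"
  shows "(INF x\<in>S. c * f x) = c * (INF x\<in>S. f x)"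
proof (rule antisym)
  have le: "c * (INF x\<in>S. f x) \<le> c * f x" if "x \<in> S" for x
    using assms that by (intro mult_left_mono cINF_lower) auto
  then show "c * (INF x\<in>S. f x) \<le> (INF x\<in>S. c * f x)" by (intro cINF_greatest assms(2))
  have bdd: "bdd_below ((\<lambda>x. c * f x) ` S)" using le by (auto intro!: bdd_belowI2)
  have "(INF x\<in>S. c * f x) / c \<le> f x" if "x \<in> S" for x
    using cINF_lower[OF bdd that] assms(1) by (simp add: divide_le_eq mult.commute)
  then have "(INF x\<in>S. c * f x) / c \<le> (INF x\<in>S. f x)" by (intro cINF_greatest assms(2))
  then show "(INF x\<in>S. c * f x) \<le> c * (INF x\<in>S. f x)"
    using assms(1) by (simp add: divide_le_eq mult.commute)
qed

section \<open>Nonzero elements of the domain\<close>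

lemma test_functions_in_sobolev0:
  fixes \<Omega> :: "(real^'n::finite) set"
  assumes \<Omega>: "open \<Omega>" "bounded \<Omega>" and p: "0 < p" and \<phi>: "\<phi> \<in> test_functions \<Omega>"
  shows "\<phi> \<in> sobolev 1 p \<Omega>" "\<phi> \<in> sobolev 2 p \<Omega>" "\<phi> \<in> sobolev0 p \<Omega>"
proof -
  have OL: "\<Omega> \<in> sets lebesgue" using \<Omega> by simp
  have l: "\<psi> \<in> lp_space p \<Omega>" if "\<psi> \<in> test_functions \<Omega>" for \<psi>
    by (rule test_functions_lp_space[OF \<Omega>(2) OL that]) (use p in simp)
  have w: "has_weak_deriv \<Omega> i \<psi> (pderiv_at i \<psi>)" if "\<psi> \<in> test_functions \<Omega>" for \<psi> i
    by (rule smooth_has_weak_deriv[OF \<Omega>(1) test_functionsD(1)[OF that]])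
  have s1: "\<psi> \<in> sobolev 1 p \<Omega>" if "\<psi> \<in> test_functions \<Omega>" for \<psi>
    using l[OF that] w[OF that] l[OF test_functions_pderiv[OF that]] by (auto simp: One_nat_def)
  show "\<phi> \<in> sobolev 1 p \<Omega>" by (rule s1[OF \<phi>])
  show "\<phi> \<in> sobolev 2 p \<Omega>"
    unfolding numeral_2_eq_2 sobolev.simps(2)[of "Suc 0"]
    using l[OF \<phi>] w[OF \<phi>] s1[OF test_functions_pderiv[OF \<phi>], unfolded One_nat_def] by blast
  have "AE x in lebesgue_on \<Omega>. \<forall>i\<in>UNIV. weak_deriv \<Omega> i \<phi> x = pderiv_at i \<phi> x"
    using weak_deriv_AE_eq[OF \<Omega>(1) w[OF \<phi>]] by (subst AE_finite_all) auto
  then have "AE x in lebesgue_on \<Omega>. norm (grad \<phi> x - weak_grad \<Omega> \<phi> x) powr p = 0"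
    by eventually_elim (simp add: grad_def weak_grad_def)
  then have g: "lp_norm p \<Omega> (\<lambda>x. grad \<phi> x - weak_grad \<Omega> \<phi> x) = 0"
    unfolding lp_norm_def by (subst integral_eq_zero_AE) auto
  have z: "lp_norm p \<Omega> (\<lambda>x. \<phi> x - \<phi> x) = 0" by (simp add: lp_norm_def)
  show "\<phi> \<in> sobolev0 p \<Omega>"
    unfolding sobolev0_def
  proof (intro CollectI conjI allI impI)
    fix \<epsilon> :: real assume "\<epsilon> > 0"
    then show "\<exists>\<psi>\<in>test_functions \<Omega>. lp_norm p \<Omega> (\<lambda>x. \<psi> x - \<phi> x) < \<epsilon> \<and>
        lp_norm p \<Omega> (\<lambda>x. grad \<psi> x - weak_grad \<Omega> \<phi> x) < \<epsilon>"
      using g z \<phi> by (intro bexI[of _ \<phi>]) auto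
  qed (rule s1[OF \<phi>])
qed

text \<open>Positivity at a single point suffices: the zero set of a continuous function is closed,
  so it contains every point of an open set that it contains almost entirely.\<close>

lemma nonzero_test_function:
  fixes \<Omega> :: "(real^'n::finite) set"
  assumes "open \<Omega>" "\<Omega> \<noteq> {}"
  obtains \<phi> where "\<phi> \<in> test_functions \<Omega>" "\<not> ae_zero \<Omega> \<phi>"
proof -
  obtain y where y: "y \<in> \<Omega>" using assms(2) by blast
  obtain \<phi> where \<phi>: "\<phi> \<in> test_functions \<Omega>" "\<And>x. x \<in> {y} \<Longrightarrow> \<phi> x > 0"
    using positive_test_function[of "{y}" \<Omega>] assms(1) y by auto
  have "\<not> ae_zero \<Omega> \<phi>"
  proof
    assume "ae_zero \<Omega> \<phi>"
    then have "AE x \<in> \<Omega> in lebesgue. x \<in> {x. \<phi> x = 0}"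
      using assms(1) unfolding ae_zero_def by (subst (asm) AE_restrict_space_iff) auto
    moreover have "closed {x. \<phi> x = 0}"
      by (intro closed_Collect_eq smooth_continuous test_functionsD(1)[OF \<phi>(1)] continuous_on_const)
    ultimately have "y \<in> {x. \<phi> x = 0}"
      using mem_closed_if_AE_lebesgue_open[OF assms(1)] y by blast
    then show False using \<phi>(2)[of y] by simp
  qed
  with \<phi>(1) show thesis by (rule that)
qed

section \<open>Identities and bounds for a single function of the domain\<close>

locale sobolev_function =
  fixes \<Omega> :: "(real^'n::finite) set" and p :: real and u :: "real^'n \<Rightarrow> real"
  assumes \<Omega>: "open \<Omega>" "bounded \<Omega>" and p: "1 < p"
    and u: "u \<in> sobolev 2 p \<Omega>" "u \<in> sobolev0 p \<Omega>"
begin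

abbreviation "M \<equiv> lebesgue_on \<Omega>"
abbreviation "d i \<equiv> weak_deriv \<Omega> i u"
abbreviation "dd i \<equiv> weak_deriv \<Omega> i (weak_deriv \<Omega> i u)"

text \<open>Up to constants, the denominator of the eigenvalue quotient in all its forms. Where u is
  zero, \<open>0 powr (p - 2) = 0\<close> removes the gradient, whatever the sign of p - 2.\<close>

definition energy :: real where
  "energy = (\<integral>x. \<bar>u x\<bar> powr (p - 2) * (norm (weak_grad \<Omega> u x))\<^sup>2 \<partial>M)"

lemma p0: "0 < p" and p1: "1 \<le> p" using p by auto

lemma u_sobolev1: "u \<in> sobolev 1 p \<Omega>" using u(2) unfolding sobolev0_def by blast

lemma u_lp: "u \<in> lp_space p \<Omega>" by (rule sobolev1_weak_deriv(1)[OF \<Omega>(1) u_sobolev1])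

lemma d_lp: "d i \<in> lp_space p \<Omega>" and dd_lp: "dd i \<in> lp_space p \<Omega>"
  by (rule sobolev2_weak_deriv[OF \<Omega>(1) u(1)])+

lemma measurable_u [measurable]: "u \<in> borel_measurable M" "d i \<in> borel_measurable M" "dd i \<in> borel_measurable M"
  using u_lp d_lp dd_lp unfolding lp_space_real_iff by blast+

lemma laplacian_lp: "laplacian \<Omega> u \<in> lp_space p \<Omega>"
proof -
  have "(\<lambda>x. \<Sum>i\<in>UNIV. dd i x) \<in> lp_space p \<Omega>" by (rule lp_space_sum[OF finite dd_lp]) (use p0 in simp)
  then show ?thesis unfolding laplacian_def[abs_def] .
qed

lemma f0_lp: "q = p / (p - 1) \<Longrightarrow> f0 p \<Omega> u \<in> lp_space q \<Omega>"
proof -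
  assume q: "q = p / (p - 1)"
  have "neg_laplacian \<Omega> u \<in> lp_space p \<Omega>"
    using laplacian_lp unfolding lp_space_real_iff neg_laplacian_def[abs_def] by simp
  from f1_in_lp_space[OF p q this] show ?thesis by (simp add: f0_eq_comp)
qed

lemma f0_mult: "f0 p \<Omega> u x * neg_laplacian \<Omega> u x = \<bar>laplacian \<Omega> u x\<bar> powr p"
  using f1_mult_self[of p "neg_laplacian \<Omega> u" x] by (simp add: f0_eq_comp neg_laplacian_def)

lemma numerator:
  "integrable M (\<lambda>x. f0 p \<Omega> u x * neg_laplacian \<Omega> u x)"
  "pairing \<Omega> (f0 p \<Omega> u) (neg_laplacian \<Omega> u) = lp_norm p \<Omega> (laplacian \<Omega> u) powr p"
  "(lp_norm 2 \<Omega> (\<lambda>x. \<bar>laplacian \<Omega> u x\<bar> powr (p / 2)))\<^sup>2 = lp_norm p \<Omega> (laplacian \<Omega> u) powr p"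
proof -
  show "integrable M (\<lambda>x. f0 p \<Omega> u x * neg_laplacian \<Omega> u x)"
    using laplacian_lp unfolding f0_mult lp_space_real_iff by blast
  show "pairing \<Omega> (f0 p \<Omega> u) (neg_laplacian \<Omega> u) = lp_norm p \<Omega> (laplacian \<Omega> u) powr p"
    unfolding pairing_def f0_mult lp_norm_powr[OF p0] by simp
  show "(lp_norm 2 \<Omega> (\<lambda>x. \<bar>laplacian \<Omega> u x\<bar> powr (p / 2)))\<^sup>2 = lp_norm p \<Omega> (laplacian \<Omega> u) powr p"
    unfolding lp_norm_2_square lp_norm_powr[OF p0] by (simp add: powr_half_square)
qed

lemma norm_weak_grad_square: "(norm (weak_grad \<Omega> v x))\<^sup>2 = (\<Sum>i\<in>UNIV. (weak_deriv \<Omega> i v x)\<^sup>2)"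
  by (simp add: norm_vec_def L2_set_def weak_grad_def sum_nonneg)

text \<open>Summation of \<open>weighted_integration_by_parts\<close> over the coordinates; its
  minus sign is absorbed by that of \<open>neg_laplacian\<close>.\<close>

lemma energy_eq:
  "integrable M (\<lambda>x. \<bar>u x\<bar> powr (p - 2) * (norm (weak_grad \<Omega> u x))\<^sup>2)"
  "pairing \<Omega> (f1 p u) (neg_laplacian \<Omega> u) = (p - 1) * energy"
  "(lp_norm 2 \<Omega> (\<lambda>x. \<bar>u x\<bar> powr ((p - 2) / 2) * norm (weak_grad \<Omega> u x)))\<^sup>2 = energy"
proof -
  note w = weighted_integration_by_parts[OF \<Omega> p u]
  have s: "\<bar>u x\<bar> powr (p - 2) * (norm (weak_grad \<Omega> u x))\<^sup>2 = (\<Sum>i\<in>UNIV. \<bar>u x\<bar> powr (p - 2) * (d i x)\<^sup>2)" for x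
    unfolding norm_weak_grad_square by (rule sum_distrib_left)
  show "integrable M (\<lambda>x. \<bar>u x\<bar> powr (p - 2) * (norm (weak_grad \<Omega> u x))\<^sup>2)"
    unfolding s by (intro Bochner_Integration.integrable_sum w(1))
  have "f1 p u x * neg_laplacian \<Omega> u x = - (\<Sum>i\<in>UNIV. dd i x * (\<bar>u x\<bar> powr (p - 2) * u x))" for x
    by (simp add: f1_def neg_laplacian_def laplacian_def sum_distrib_left mult_ac)
  then have "pairing \<Omega> (f1 p u) (neg_laplacian \<Omega> u) = - (\<Sum>i\<in>UNIV. \<integral>x. dd i x * (\<bar>u x\<bar> powr (p - 2) * u x) \<partial>M)"
    unfolding pairing_def by (simp add: Bochner_Integration.integral_sum[OF w(2)])
  also have "\<dots> = (\<Sum>i\<in>UNIV. - (\<integral>x. dd i x * (\<bar>u x\<bar> powr (p - 2) * u x) \<partial>M))" by (simp add: sum_negf)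
  also have "\<dots> = (\<Sum>i\<in>UNIV. (p - 1) * (\<integral>x. \<bar>u x\<bar> powr (p - 2) * (d i x)\<^sup>2 \<partial>M))" by (simp only: w(3))
  also have "\<dots> = (p - 1) * (\<Sum>i\<in>UNIV. \<integral>x. \<bar>u x\<bar> powr (p - 2) * (d i x)\<^sup>2 \<partial>M)" by (rule sum_distrib_left[symmetric])
  also have "\<dots> = (p - 1) * energy"
    unfolding energy_def s by (subst Bochner_Integration.integral_sum[OF w(1)]) simp
  finally show "pairing \<Omega> (f1 p u) (neg_laplacian \<Omega> u) = (p - 1) * energy" .
  show "(lp_norm 2 \<Omega> (\<lambda>x. \<bar>u x\<bar> powr ((p - 2) / 2) * norm (weak_grad \<Omega> u x)))\<^sup>2 = energy"
    unfolding lp_norm_2_square energy_def by (simp add: power_mult_distrib powr_half_square)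
qed

lemma energy_nonneg: "energy \<ge> 0"
  unfolding energy_def by (intro Bochner_Integration.integral_nonneg) auto

text \<open>A vanishing energy forces the gradient to vanish wherever the weight does not, that is,
  where u is nonzero. This is the hypothesis of \<open>sobolev0_zero_deriv_imp_zero\<close>.\<close>

lemma energy_pos: "\<not> ae_zero \<Omega> u \<Longrightarrow> energy > 0"
proof -
  assume nz: "\<not> ae_zero \<Omega> u"
  have "energy \<noteq> 0"
  proof
    assume "energy = 0"
    then have "AE x in M. \<bar>u x\<bar> powr (p - 2) * (norm (weak_grad \<Omega> u x))\<^sup>2 = 0"
      using integral_nonneg_eq_0_iff_AE[OF energy_eq(1)] unfolding energy_def by simp
    then have "AE x in M. u x \<noteq> 0 \<longrightarrow> d i x = 0" for i
    proof eventually_elim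
      case (elim x)
      have "d i x = weak_grad \<Omega> u x $ i" by (simp add: weak_grad_def)
      then show ?case using elim by auto
    qed
    from sobolev0_zero_deriv_imp_zero[OF \<Omega> p1 u(2) this] nz show False by blast
  qed
  then show ?thesis using energy_nonneg by simp
qed

lemma integrable_grad_powr: "integrable M (\<lambda>x. norm (weak_grad \<Omega> u x) powr p)"
  by (rule integrable_norm_powr(2)) (use d_lp p0 in \<open>auto simp: weak_grad_def\<close>)

lemma lp_norms_pos:
  assumes nz: "\<not> ae_zero \<Omega> u"
  shows "0 < lp_norm p \<Omega> u" "0 < lp_norm p \<Omega> (weak_grad \<Omega> u)"
proof -
  have ui: "integrable M (\<lambda>x. \<bar>u x\<bar> powr p)" using u_lp unfolding lp_space_real_iff by blast
  have "(\<integral>x. \<bar>u x\<bar> powr p \<partial>M) \<noteq> 0"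
  proof
    assume "(\<integral>x. \<bar>u x\<bar> powr p \<partial>M) = 0"
    then have "AE x in M. \<bar>u x\<bar> powr p = 0" using integral_nonneg_eq_0_iff_AE[OF ui] by simp
    then have "ae_zero \<Omega> u" unfolding ae_zero_def by eventually_elim simp
    with nz show False by blast
  qed
  then have "lp_norm p \<Omega> u \<noteq> 0" by (simp add: lp_norm_def)
  then show "0 < lp_norm p \<Omega> u" using lp_norm_nonneg[of p \<Omega> u] by linarith
  have "(\<integral>x. norm (weak_grad \<Omega> u x) powr p \<partial>M) \<noteq> 0"
  proof
    assume "(\<integral>x. norm (weak_grad \<Omega> u x) powr p \<partial>M) = 0"
    then have "AE x in M. norm (weak_grad \<Omega> u x) powr p = 0"
      using integral_nonneg_eq_0_iff_AE[OF integrable_grad_powr] by simp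
    then have "AE x in M. u x \<noteq> 0 \<longrightarrow> d i x = 0" for i
    proof eventually_elim
      case (elim x)
      have "d i x = weak_grad \<Omega> u x $ i" by (simp add: weak_grad_def)
      then show ?case using elim by simp
    qed
    from sobolev0_zero_deriv_imp_zero[OF \<Omega> p1 u(2) this] nz show False by blast
  qed
  then have "lp_norm p \<Omega> (weak_grad \<Omega> u) \<noteq> 0" by (simp add: lp_norm_def)
  then show "0 < lp_norm p \<Omega> (weak_grad \<Omega> u)" using lp_norm_nonneg[of p \<Omega> "weak_grad \<Omega> u"] by linarith
qed

lemma energy_le:
  assumes "2 \<le> p" "\<not> ae_zero \<Omega> u"
  shows "energy \<le> lp_norm p \<Omega> u powr (p - 2) * (lp_norm p \<Omega> (weak_grad \<Omega> u))\<^sup>2"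
  unfolding energy_def
proof (rule Hoelder_weighted[OF assms(1) _ _ _ integrable_grad_powr energy_eq(1) lp_norms_pos[OF assms(2)]])
  show "integrable M (\<lambda>x. \<bar>u x\<bar> powr p)" using u_lp unfolding lp_space_real_iff by blast
  show "(\<integral>x. \<bar>u x\<bar> powr p \<partial>M) = lp_norm p \<Omega> u powr p"
    "(\<integral>x. norm (weak_grad \<Omega> u x) powr p \<partial>M) = lp_norm p \<Omega> (weak_grad \<Omega> u) powr p"
    unfolding lp_norm_powr[OF p0] by simp_all
qed auto

text \<open>Squaring the weak derivative from \<open>has_weak_deriv_abs_powr\<close> removes the
  sign and leaves the factor (p / 2)^2; square integrability of v itself comes from v^2 =
  |u|^p.\<close>

lemma abs_power_sobolev:
  defines "v \<equiv> \<lambda>x. \<bar>u x\<bar> powr ((p - 2) / 2) * \<bar>u x\<bar>"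
  shows "v \<in> sobolev 1 2 \<Omega>" "(lp_norm 2 \<Omega> (weak_grad \<Omega> v))\<^sup>2 = p\<^sup>2 / 4 * energy"
proof -
  let ?g = "\<lambda>i x. p / 2 * ((if u x > 0 then 1 else - 1) * \<bar>u x\<bar> powr ((p - 2) / 2)) * d i x"
  have w: "has_weak_deriv \<Omega> i v (?g i)" for i
    unfolding v_def by (rule has_weak_deriv_abs_powr[OF \<Omega> p1 u(2) weighted_integration_by_parts(1)[OF \<Omega> p u]])
  have g2: "(?g i x)\<^sup>2 = p\<^sup>2 / 4 * (\<bar>u x\<bar> powr (p - 2) * (d i x)\<^sup>2)" for i x
  proof -
    have "(if u x > 0 then 1 else - 1 :: real)\<^sup>2 = 1" by simp
    then show ?thesis by (simp only: power_mult_distrib powr_half_square power_divide) simp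
  qed
  have "integrable M (\<lambda>x. \<bar>v x\<bar> powr 2)"
  proof -
    have "\<bar>v x\<bar> powr 2 = \<bar>u x\<bar> powr p" for x
      unfolding v_def powr_half_mult_eq by (simp add: powr_powr)
    then show ?thesis using u_lp by (simp add: lp_space_real_iff)
  qed
  then have vl: "v \<in> lp_space 2 \<Omega>" unfolding lp_space_real_iff v_def by (auto intro: borel_measurable_times)
  have gm: "?g i \<in> borel_measurable M" for i by measurable
  have "integrable M (\<lambda>x. \<bar>?g i x\<bar> powr 2)" for i
  proof -
    have "\<bar>y\<bar> powr 2 = y\<^sup>2" for y :: real by simp
    then show ?thesis using weighted_integration_by_parts(1)[OF \<Omega> p u, of i] by (simp only: g2 integrable_mult_right)
  qed
  then have gl: "?g i \<in> lp_space 2 \<Omega>" for i using gm unfolding lp_space_real_iff by blast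
  show "v \<in> sobolev 1 2 \<Omega>"
    unfolding One_nat_def sobolev.simps using vl w gl by blast
  have m: "weak_deriv \<Omega> i v \<in> borel_measurable M" for i
    using locally_integrable_measurable[OF \<Omega>(1)] has_weak_deriv_weak_deriv[OF w[of i]]
    unfolding has_weak_deriv_def by blast
  have "AE x in M. \<forall>i\<in>UNIV. weak_deriv \<Omega> i v x = ?g i x"
    using weak_deriv_AE_eq[OF \<Omega>(1) w] by (subst AE_finite_all) auto
  then have ae: "AE x in M. (norm (weak_grad \<Omega> v x))\<^sup>2 = p\<^sup>2 / 4 * (\<bar>u x\<bar> powr (p - 2) * (norm (weak_grad \<Omega> u x))\<^sup>2)"
  proof eventually_elim
    case (elim x)
    then have "weak_deriv \<Omega> i v x = ?g i x" for i by blast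
    then have "(norm (weak_grad \<Omega> v x))\<^sup>2 = (\<Sum>i\<in>UNIV. (?g i x)\<^sup>2)"
      unfolding norm_weak_grad_square by (simp only:)
    also have "\<dots> = p\<^sup>2 / 4 * (\<bar>u x\<bar> powr (p - 2) * (norm (weak_grad \<Omega> u x))\<^sup>2)"
      unfolding g2 norm_weak_grad_square sum_distrib_left ..
    finally show ?case .
  qed
  have "(lp_norm 2 \<Omega> (weak_grad \<Omega> v))\<^sup>2 = (\<integral>x. p\<^sup>2 / 4 * (\<bar>u x\<bar> powr (p - 2) * (norm (weak_grad \<Omega> u x))\<^sup>2) \<partial>M)"
    unfolding lp_norm_2_square
  proof (rule integral_cong_AE[OF _ _ ae])
    show "(\<lambda>x. (norm (weak_grad \<Omega> v x))\<^sup>2) \<in> borel_measurable M"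
      unfolding norm_weak_grad_square using m by measurable
    show "(\<lambda>x. p\<^sup>2 / 4 * (\<bar>u x\<bar> powr (p - 2) * (norm (weak_grad \<Omega> u x))\<^sup>2)) \<in> borel_measurable M"
      using energy_eq(1) by simp
  qed
  then show "(lp_norm 2 \<Omega> (weak_grad \<Omega> v))\<^sup>2 = p\<^sup>2 / 4 * energy" unfolding energy_def by simp
qed

end

text \<open>The gradient of |u|^{(p-2)/2} |u| has squared L^2 norm p^2/4 times the energy. The
  second formula therefore takes squared norms and the factor p^2 / (4 (p - 1)); the infimum of the
  unsquared quotient is the square root of the one used here. For p < 2 Hoelder's inequality
  reverses, so the lower bound is claimed for p \<ge> 2. The positivity clauses certify that no
  quotient is a division by zero, which would have the value 0.\<close>

theorem proposition4:
  fixes \<Omega> :: "(real^'n::finite) set" and p q :: real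
    and X X0 :: "(real^'n \<Rightarrow> real) set" and lambda1 :: real
  assumes "open \<Omega>" and "bounded \<Omega>" and "connected \<Omega>" and "\<Omega> \<noteq> {}"
    and "C_boundary 2 \<Omega>"
    and "1 < p" and "q = p / (p - 1)"
  defines "X \<equiv> sobolev 2 p \<Omega> \<inter> sobolev0 p \<Omega>"
    and "X0 \<equiv> nonzero_part \<Omega> X"
    and "lambda1 \<equiv> first_eigenvalue \<Omega> X (neg_laplacian \<Omega>) (f0 p \<Omega>) (f1 p)"
  shows "(\<forall>u\<in>X. f0 p \<Omega> u \<in> lp_space q \<Omega>) \<and> (\<forall>u\<in>lp_space p \<Omega>. f1 p u \<in> lp_space q \<Omega>) \<and>
    has_first_eigenvalue \<Omega> X (neg_laplacian \<Omega>) (f0 p \<Omega>) (f1 p) \<and>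
    (\<forall>u\<in>X0. 0 < lp_norm 2 \<Omega> (\<lambda>x. \<bar>u x\<bar> powr ((p - 2) / 2) * norm (weak_grad \<Omega> u x)) \<and>
        (\<lambda>x. \<bar>u x\<bar> powr ((p - 2) / 2) * \<bar>u x\<bar>) \<in> sobolev 1 2 \<Omega> \<and>
        0 < lp_norm 2 \<Omega> (weak_grad \<Omega> (\<lambda>x. \<bar>u x\<bar> powr ((p - 2) / 2) * \<bar>u x\<bar>)) \<and>
        0 < lp_norm p \<Omega> u \<and> 0 < lp_norm p \<Omega> (weak_grad \<Omega> u)) \<and>
    lambda1 = 1 / (p - 1) *
      (INF u\<in>X0. lp_norm p \<Omega> (laplacian \<Omega> u) powr p /
         (lp_norm 2 \<Omega> (\<lambda>x. \<bar>u x\<bar> powr ((p - 2) / 2) * norm (weak_grad \<Omega> u x)))\<^sup>2) \<and>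
    lambda1 = p\<^sup>2 / (4 * (p - 1)) *
      (INF u\<in>X0. (lp_norm 2 \<Omega> (\<lambda>x. \<bar>laplacian \<Omega> u x\<bar> powr (p / 2)))\<^sup>2 /
         (lp_norm 2 \<Omega> (weak_grad \<Omega> (\<lambda>x. \<bar>u x\<bar> powr ((p - 2) / 2) * \<bar>u x\<bar>)))\<^sup>2) \<and>
    (2 \<le> p \<longrightarrow>
      lambda1 \<ge> 1 / (p - 1) *
        (INF u\<in>X0. lp_norm p \<Omega> (laplacian \<Omega> u) powr p /
           (lp_norm p \<Omega> u powr (p - 2) * (lp_norm p \<Omega> (weak_grad \<Omega> u))\<^sup>2)))"
proof -
  have p: "1 < p" by fact
  have S: "sobolev_function \<Omega> p u" if "u \<in> X" for u
    using that assms(1,2) p unfolding X_def by unfold_locales auto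
  have X0X: "u \<in> X" "\<not> ae_zero \<Omega> u" if "u \<in> X0" for u
    using that unfolding X0_def nonzero_part_def by auto
  let ?v = "\<lambda>u x. \<bar>u x\<bar> powr ((p - 2) / 2) * \<bar>u x\<bar>"
  let ?N = "\<lambda>u. lp_norm p \<Omega> (laplacian \<Omega> u) powr p"
  let ?E = "\<lambda>u. (lp_norm 2 \<Omega> (\<lambda>x. \<bar>u x\<bar> powr ((p - 2) / 2) * norm (weak_grad \<Omega> u x)))\<^sup>2"
  let ?B = "\<lambda>u. lp_norm p \<Omega> u powr (p - 2) * (lp_norm p \<Omega> (weak_grad \<Omega> u))\<^sup>2"
  have N0: "?N u \<ge> 0" for u by simp
  have E: "?E u > 0" "pairing \<Omega> (f1 p u) (neg_laplacian \<Omega> u) = (p - 1) * ?E u"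
    "(lp_norm 2 \<Omega> (weak_grad \<Omega> (?v u)))\<^sup>2 = p\<^sup>2 / 4 * ?E u" if "u \<in> X0" for u
    using sobolev_function.energy_pos[OF S] sobolev_function.energy_eq(2,3)[OF S]
      sobolev_function.abs_power_sobolev(2)[OF S] X0X[OF that] by auto
  have pos_of_sq: "0 < lp_norm 2 \<Omega> f" if "(lp_norm 2 \<Omega> f)\<^sup>2 > 0" for f :: "real^'n \<Rightarrow> 'b::real_normed_vector"
    using that lp_norm_nonneg[of 2 \<Omega> f] by (cases "lp_norm 2 \<Omega> f = 0") auto
  have quot: "pairing \<Omega> (f0 p \<Omega> u) (neg_laplacian \<Omega> u) / pairing \<Omega> (f1 p u) (neg_laplacian \<Omega> u) =
      1 / (p - 1) * (?N u / ?E u)" if "u \<in> X0" for u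
    using sobolev_function.numerator(2)[OF S[OF X0X(1)[OF that]]] E(2)[OF that] by simp
  obtain \<phi> where \<phi>: "\<phi> \<in> test_functions \<Omega>" "\<not> ae_zero \<Omega> \<phi>"
    using nonzero_test_function[OF assms(1,4)] by blast
  have "\<phi> \<in> X0"
    using test_functions_in_sobolev0(2,3)[OF assms(1,2) _ \<phi>(1), of p] p \<phi>(2)
    by (simp add: X0_def X_def nonzero_part_def)
  then have ne: "X0 \<noteq> {}" by blast
  \<comment> \<open>A real-valued \<open>INF\<close> can be rescaled and compared only over a
    nonempty set and for values bounded below; here 0 is a lower bound.\<close>
  have bdd: "bdd_below ((\<lambda>u. ?N u / ?E u) ` X0)"
    using E(1) by (intro bdd_belowI2[of _ 0]) (simp add: less_imp_le)
  have lam: "lambda1 = 1 / (p - 1) * (INF u\<in>X0. ?N u / ?E u)"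
  proof -
    have "lambda1 = (INF u\<in>X0. 1 / (p - 1) * (?N u / ?E u))"
      unfolding lambda1_def first_eigenvalue_def X0_def[symmetric] using quot by (intro INF_cong) auto
    also have "\<dots> = 1 / (p - 1) * (INF u\<in>X0. ?N u / ?E u)"
      by (rule cINF_cmult[OF _ ne bdd]) (use p in simp)
    finally show ?thesis .
  qed
  have lam2: "lambda1 = p\<^sup>2 / (4 * (p - 1)) *
      (INF u\<in>X0. (lp_norm 2 \<Omega> (\<lambda>x. \<bar>laplacian \<Omega> u x\<bar> powr (p / 2)))\<^sup>2 / (lp_norm 2 \<Omega> (weak_grad \<Omega> (?v u)))\<^sup>2)"
  proof -
    \<comment> \<open>4 / p^2 is the inverse of the factor that \<open>abs_power_sobolev\<close>
      puts in front of the energy.\<close>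
    have "(lp_norm 2 \<Omega> (\<lambda>x. \<bar>laplacian \<Omega> u x\<bar> powr (p / 2)))\<^sup>2 / (lp_norm 2 \<Omega> (weak_grad \<Omega> (?v u)))\<^sup>2 =
        4 / p\<^sup>2 * (?N u / ?E u)" if "u \<in> X0" for u
      unfolding sobolev_function.numerator(3)[OF S[OF X0X(1)[OF that]]] E(3)[OF that] by simp
    then have "(INF u\<in>X0. (lp_norm 2 \<Omega> (\<lambda>x. \<bar>laplacian \<Omega> u x\<bar> powr (p / 2)))\<^sup>2 / (lp_norm 2 \<Omega> (weak_grad \<Omega> (?v u)))\<^sup>2) =
        (INF u\<in>X0. 4 / p\<^sup>2 * (?N u / ?E u))" by (intro INF_cong) auto
    also have "\<dots> = 4 / p\<^sup>2 * (INF u\<in>X0. ?N u / ?E u)"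
      by (rule cINF_cmult[OF _ ne bdd]) (use p in simp)
    finally have eq: "(INF u\<in>X0. (lp_norm 2 \<Omega> (\<lambda>x. \<bar>laplacian \<Omega> u x\<bar> powr (p / 2)))\<^sup>2 /
        (lp_norm 2 \<Omega> (weak_grad \<Omega> (?v u)))\<^sup>2) = 4 / p\<^sup>2 * (INF u\<in>X0. ?N u / ?E u)" .
    have "p\<^sup>2 / (4 * (p - 1)) * (4 / p\<^sup>2 * I) = 1 / (p - 1) * I" for I :: real
      using p by (simp add: divide_simps)
    then show ?thesis unfolding eq lam by simp
  qed
  have lam3: "1 / (p - 1) * (INF u\<in>X0. ?N u / ?B u) \<le> lambda1" if "2 \<le> p"
  proof -
    have "(INF u\<in>X0. ?N u / ?B u) \<le> (INF u\<in>X0. ?N u / ?E u)"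
    proof (rule cINF_mono[OF ne])
      show "bdd_below ((\<lambda>u. ?N u / ?B u) ` X0)" by (intro bdd_belowI2[of _ 0]) simp
      fix u assume u: "u \<in> X0"
      \<comment> \<open>Hoelder's inequality enlarges the denominator, so the quotients are compared
        at the same u.\<close>
      have "?E u \<le> ?B u"
        using sobolev_function.energy_le[OF S that] sobolev_function.energy_eq(3)[OF S] X0X[OF u] by auto
      then have "?N u / ?B u \<le> ?N u / ?E u"
        using E(1)[OF u] by (intro divide_left_mono N0 mult_pos_pos) auto
      then show "\<exists>m\<in>X0. ?N m / ?B m \<le> ?N u / ?E u" using u by blast
    qed
    then show ?thesis unfolding lam using p by (intro mult_left_mono) auto
  qed
  have ex: "has_first_eigenvalue \<Omega> X (neg_laplacian \<Omega>) (f0 p \<Omega>) (f1 p)"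
    unfolding has_first_eigenvalue_def X0_def[symmetric]
  proof (intro conjI ballI ne)
    fix u assume u: "u \<in> X0"
    show "integrable (lebesgue_on \<Omega>) (\<lambda>x. f0 p \<Omega> u x * neg_laplacian \<Omega> u x)"
      by (rule sobolev_function.numerator(1)[OF S[OF X0X(1)[OF u]]])
    show "pairing \<Omega> (f1 p u) (neg_laplacian \<Omega> u) \<noteq> 0" using E(1,2)[OF u] p by simp
  next
    show "bdd_below ((\<lambda>u. pairing \<Omega> (f0 p \<Omega> u) (neg_laplacian \<Omega> u) / pairing \<Omega> (f1 p u) (neg_laplacian \<Omega> u)) ` X0)"
      using quot E(1) p by (intro bdd_belowI2[of _ 0]) (simp add: less_imp_le)
  qed
  have props: "0 < lp_norm 2 \<Omega> (\<lambda>x. \<bar>u x\<bar> powr ((p - 2) / 2) * norm (weak_grad \<Omega> u x)) \<and>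
      ?v u \<in> sobolev 1 2 \<Omega> \<and> 0 < lp_norm 2 \<Omega> (weak_grad \<Omega> (?v u)) \<and>
      0 < lp_norm p \<Omega> u \<and> 0 < lp_norm p \<Omega> (weak_grad \<Omega> u)" if u: "u \<in> X0" for u
  proof (intro conjI)
    show "0 < lp_norm 2 \<Omega> (\<lambda>x. \<bar>u x\<bar> powr ((p - 2) / 2) * norm (weak_grad \<Omega> u x))"
      by (rule pos_of_sq[OF E(1)[OF u]])
    show "?v u \<in> sobolev 1 2 \<Omega>" by (rule sobolev_function.abs_power_sobolev(1)[OF S[OF X0X(1)[OF u]]])
    show "0 < lp_norm 2 \<Omega> (weak_grad \<Omega> (?v u))"
    proof (rule pos_of_sq)
      have "p\<^sup>2 / 4 * ?E u > 0" using E(1)[OF u] p by (intro mult_pos_pos) auto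
      then show "(lp_norm 2 \<Omega> (weak_grad \<Omega> (?v u)))\<^sup>2 > 0" unfolding E(3)[OF u] .
    qed
    show "0 < lp_norm p \<Omega> u" "0 < lp_norm p \<Omega> (weak_grad \<Omega> u)"
      by (rule sobolev_function.lp_norms_pos[OF S[OF X0X(1)[OF u]] X0X(2)[OF u]])+
  qed
  show ?thesis
    using sobolev_function.f0_lp[OF S assms(7)] f1_in_lp_space[OF p assms(7)] ex props lam lam2 lam3
    by blast
qed

end
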